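(* Let $\Omega\subset\mathbb R^n$, $n\ge2$, be a bounded domain with smooth boundary. Let $\mathcal Q$ be a standard Borel class of real potentials on $\Omega$ on which the Schrödinger Dirichlet-to-Neumann map $\Lambda_q$ is defined. Fix a countable dense set $\{f_j\}_{j\ge1}\subset H^{1/2}(\partial\Omega;\mathbb R)$ and set \[ T(q)=\big(\langle\Lambda_qf_i,f_j\rangle\big)_{i,j\ge1}\in\mathbb R^{\mathbb N\times\mathbb N}. \] Assume that $T:\mathcal Q\to\mathbb R^{\mathbb N\times\mathbb N}$ is Borel and that deterministic uniqueness holds on $\mathcal Q$: for $q_1,q_2\in\mathcal Q$, $\Lambda_{q_1}=\Lambda_{q_2}$ implies $q_1=q_2$. If $q$ and $\widetilde q$ are $\mathcal Q$-valued random variables with \[ \operatorname{Law}(T(q))=\operatorname{Law}(T(\widetilde q)), \] then $\operatorname{Law}(q)=\operatorname{Law}(\widetilde q)$. In addition, for the class $\mathcal Q_+^\infty(\Omega)=\{q\in C^\infty(\overline\Omega;\mathbb R):q\ge0\}$ with its usual Fréchet Borel structure, the map $T$ is Borel. The analogous statement to the first paragraph holds for conductivities: if $\mathcal G$ is a standard Borel class of conductivities on which the conductivity Dirichlet-to-Neumann map $\Lambda_\gamma$ is defined and injective and the map $T(\gamma)=(\langle\Lambda_\gamma f_i,f_j\rangle)_{i,j\ge1}$ is Borel, then for $\mathcal G$-valued random variables $\gamma,\widetilde\gamma$, $\operatorname{Law}(T(\gamma))=\operatorname{Law}(T(\widetilde\gamma))$ implies $\operatorname{Law}(\gamma)=\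operatorname{Law}(\widetilde\gamma)$.
   Context: Schrödinger DN map: $\Lambda_q f=\partial_\nu u_f|_{\partial\Omega}$, where $(-\Delta+q)u_f=0$ in $\Omega$, $u_f|_{\partial\Omega}=f$ (unique solvability is part of $\Lambda_q$ being defined). Conductivity DN map: $\Lambda_\gamma f=\gamma\partial_\nu u_f|_{\partial\Omega}$, where $\nabla\cdot(\gamma\nabla u_f)=0$ in $\Omega$, $u_f|_{\partial\Omega}=f$. Both are bounded operators $H^{1/2}(\partial\Omega)\to H^{-1/2}(\partial\Omega)$, equivalently bounded bilinear forms on $H^{1/2}(\partial\Omega;\mathbb R)$; $\nu$ is the outer unit normal and $\langle\cdot,\cdot\rangle$ the duality pairing. $\mathbb R^{\mathbb N\times\mathbb N}$ carries the product Borel structure. *)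

theory Defs
  imports "HOL-Probability.Probability"
begin

section \<open>Smooth functions and smooth domains\<close>

primrec iter_deriv :: "'a list \<Rightarrow> ('a::euclidean_space \<Rightarrow> real) \<Rightarrow> 'a \<Rightarrow> real" where
  "iter_deriv [] f = f"
| "iter_deriv (b # bs) f = (\<lambda>x. frechet_derivative (iter_deriv bs f) (at x) b)"

text \<open>Used for open \<open>U\<close> only; there it says that all iterated partial derivatives exist and are
  differentiable (hence continuous), i.e. that \<open>f\<close> is of class \<open>C\<^sup>\<infinity>\<close> on \<open>U\<close>.\<close>

definition smooth_on :: "'a::euclidean_space set \<Rightarrow> ('a \<Rightarrow> real) \<Rightarrow> bool" where
  "smooth_on U f \<longleftrightarrow> (\<forall>bs\<in>lists Basis. iter_deriv bs f differentiable_on U)"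

text \<open>Near each boundary point \<open>\<Omega>\<close> is the sublevel set of a smooth function without critical
  points.\<close>

definition smooth_boundary :: "'a::euclidean_space set \<Rightarrow> bool" where
  "smooth_boundary \<Omega> \<longleftrightarrow> (\<forall>p\<in>frontier \<Omega>. \<exists>U \<rho>. open U \<and> p \<in> U \<and> smooth_on U \<rho> \<and>
     (\<forall>x\<in>U. \<exists>b\<in>Basis. iter_deriv [b] \<rho> x \<noteq> 0) \<and> \<Omega> \<inter> U = {x\<in>U. \<rho> x < 0})"

definition smooth_bounded_domain :: "'a::euclidean_space set \<Rightarrow> bool" where
  "smooth_bounded_domain \<Omega> \<longleftrightarrow>
     open \<Omega> \<and> connected \<Omega> \<and> \<Omega> \<noteq> {} \<and> bounded \<Omega> \<and> smooth_boundary \<Omega>"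


section \<open>Surface measure\<close>

text \<open>For \<open>s = 0\<close> the empty set would be given the weight \<open>0 ^ 0 = 1\<close>; only \<open>s = n - 1 \<ge> 1\<close> is used.\<close>

definition hausdorff_outer :: "nat \<Rightarrow> 'a::euclidean_space set \<Rightarrow> ennreal" where
  "hausdorff_outer s A = (SUP \<delta>\<in>{0::real<..}.
     INF C\<in>{C::nat \<Rightarrow> 'a set. A \<subseteq> (\<Union>i. C i) \<and> (\<forall>i. bounded (C i) \<and> diameter (C i) \<le> \<delta>)}.
       \<Sum>i. ennreal (unit_ball_vol (real s) * (diameter (C i) / 2) ^ s))"

definition hausdorff_measure :: "nat \<Rightarrow> 'a::euclidean_space measure" where
  "hausdorff_measure s = measure_of UNIV (sets borel) (hausdorff_outer s)"

definition surface_measure :: "'a::euclidean_space set \<Rightarrow> 'a measure" where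
  "surface_measure \<Omega> = restrict_space (hausdorff_measure (DIM('a) - 1)) (frontier \<Omega>)"


section \<open>Sobolev spaces\<close>

text \<open>Elements of \<open>L\<^sup>2\<close>, \<open>H\<^sup>1\<close> and \<open>H\<^sup>1\<^sup>/\<^sup>2\<close> are handled through representatives; their values
  outside \<open>\<Omega>\<close> (respectively outside the boundary) are irrelevant.\<close>

definition square_integrable :: "'a measure \<Rightarrow> ('a \<Rightarrow> 'b::euclidean_space) \<Rightarrow> bool" where
  "square_integrable M u \<longleftrightarrow> u \<in> borel_measurable M \<and> integrable M (\<lambda>x. (norm (u x))\<^sup>2)"

definition test_function :: "'a::euclidean_space set \<Rightarrow> ('a \<Rightarrow> real) \<Rightarrow> bool" where
  "test_function \<Omega> \<phi> \<longleftrightarrow> smooth_on UNIV \<phi> \<and>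
     compact (closure {x. \<phi> x \<noteq> 0}) \<and> closure {x. \<phi> x \<noteq> 0} \<subseteq> \<Omega>"

definition has_weak_gradient ::
    "'a::euclidean_space set \<Rightarrow> ('a \<Rightarrow> real) \<Rightarrow> ('a \<Rightarrow> 'a) \<Rightarrow> bool" where
  "has_weak_gradient \<Omega> u G \<longleftrightarrow> square_integrable (lebesgue_on \<Omega>) G \<and>
     (\<forall>\<phi> b. test_function \<Omega> \<phi> \<longrightarrow> b \<in> Basis \<longrightarrow>
        (LINT x|lebesgue_on \<Omega>. u x * iter_deriv [b] \<phi> x) =
        - (LINT x|lebesgue_on \<Omega>. (G x \<bullet> b) * \<phi> x))"

definition H1 :: "'a::euclidean_space set \<Rightarrow> ('a \<Rightarrow> real) set" where
  "H1 \<Omega> = {u. square_integrable (lebesgue_on \<Omega>) u \<and> (\<exists>G. has_weak_gradient \<Omega> u G)}"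

text \<open>The choice is harmless: weak gradients are unique up to null sets.\<close>

definition weak_grad :: "'a::euclidean_space set \<Rightarrow> ('a \<Rightarrow> real) \<Rightarrow> 'a \<Rightarrow> 'a" where
  "weak_grad \<Omega> u = (SOME G. has_weak_gradient \<Omega> u G)"

definition H1_norm :: "'a::euclidean_space set \<Rightarrow> ('a \<Rightarrow> real) \<Rightarrow> real" where
  "H1_norm \<Omega> u = sqrt (LINT x|lebesgue_on \<Omega>. (u x)\<^sup>2 + (norm (weak_grad \<Omega> u x))\<^sup>2)"

text \<open>The trace operator is the continuous extension of the restriction map
  \<open>\<phi> \<mapsto> \<phi>|\<partial>\<Omega>\<close> from smooth functions to \<open>H\<^sup>1(\<Omega>)\<close>, with values in \<open>L\<^sup>2(\<partial>\<Omega>)\<close>.\<close>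

definition has_trace :: "'a::euclidean_space set \<Rightarrow> ('a \<Rightarrow> real) \<Rightarrow> ('a \<Rightarrow> real) \<Rightarrow> bool" where
  "has_trace \<Omega> u f \<longleftrightarrow> u \<in> H1 \<Omega> \<and> square_integrable (surface_measure \<Omega>) f \<and>
     (\<exists>\<phi>::nat \<Rightarrow> 'a \<Rightarrow> real. (\<forall>k. smooth_on UNIV (\<phi> k)) \<and>
        (\<lambda>k. H1_norm \<Omega> (\<lambda>x. u x - \<phi> k x)) \<longlonglongrightarrow> 0 \<and>
        (\<lambda>k. \<integral>\<^sup>+x. ennreal ((f x - \<phi> k x)\<^sup>2) \<partial>surface_measure \<Omega>) \<longlonglongrightarrow> 0)"

definition H1_0 :: "'a::euclidean_space set \<Rightarrow> ('a \<Rightarrow> real) set" where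
  "H1_0 \<Omega> = {v. has_trace \<Omega> v (\<lambda>_. 0)}"

text \<open>\<open>H\<^sup>1\<^sup>/\<^sup>2(\<partial>\<Omega>)\<close> is the range of the trace operator, with the quotient norm.\<close>

definition Hhalf :: "'a::euclidean_space set \<Rightarrow> ('a \<Rightarrow> real) set" where
  "Hhalf \<Omega> = {f. \<exists>u. has_trace \<Omega> u f}"

definition Hhalf_norm :: "'a::euclidean_space set \<Rightarrow> ('a \<Rightarrow> real) \<Rightarrow> real" where
  "Hhalf_norm \<Omega> f = Inf {H1_norm \<Omega> u |u. has_trace \<Omega> u f}"

definition dense_seq_Hhalf :: "'a::euclidean_space set \<Rightarrow> (nat \<Rightarrow> 'a \<Rightarrow> real) \<Rightarrow> bool" where
  "dense_seq_Hhalf \<Omega> f \<longleftrightarrow> range f \<subseteq> Hhalf \<Omega> \<and>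
     (\<forall>g\<in>Hhalf \<Omega>. \<forall>\<epsilon>>0. \<exists>j. Hhalf_norm \<Omega> (\<lambda>x. g x - f j x) < \<epsilon>)"


section \<open>Dirichlet-to-Neumann maps\<close>

definition schroedinger_form ::
    "'a::euclidean_space set \<Rightarrow> ('a \<Rightarrow> real) \<Rightarrow> ('a \<Rightarrow> real) \<Rightarrow> ('a \<Rightarrow> real) \<Rightarrow> real" where
  "schroedinger_form \<Omega> q u v =
     (LINT x|lebesgue_on \<Omega>. weak_grad \<Omega> u x \<bullet> weak_grad \<Omega> v x + q x * u x * v x)"

definition conductivity_form ::
    "'a::euclidean_space set \<Rightarrow> ('a \<Rightarrow> real) \<Rightarrow> ('a \<Rightarrow> real) \<Rightarrow> ('a \<Rightarrow> real) \<Rightarrow> real" where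
  "conductivity_form \<Omega> \<gamma> u v =
     (LINT x|lebesgue_on \<Omega>. \<gamma> x * (weak_grad \<Omega> u x \<bullet> weak_grad \<Omega> v x))"

type_synonym 'a form = "('a \<Rightarrow> real) \<Rightarrow> ('a \<Rightarrow> real) \<Rightarrow> real"

definition weak_solution ::
    "'a::euclidean_space set \<Rightarrow> 'a form \<Rightarrow> ('a \<Rightarrow> real) \<Rightarrow> ('a \<Rightarrow> real) \<Rightarrow> bool" where
  "weak_solution \<Omega> a f u \<longleftrightarrow> has_trace \<Omega> u f \<and> (\<forall>v\<in>H1_0 \<Omega>. a u v = 0)"

definition uniquely_solvable :: "'a::euclidean_space set \<Rightarrow> 'a form \<Rightarrow> bool" where
  "uniquely_solvable \<Omega> a \<longleftrightarrow> (\<forall>f\<in>Hhalf \<Omega>. (\<exists>u. weak_solution \<Omega> a f u) \<and>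
     (\<forall>u u'. weak_solution \<Omega> a f u \<longrightarrow> weak_solution \<Omega> a f u' \<longrightarrow>
        (AE x in lebesgue_on \<Omega>. u x = u' x)))"

text \<open>\<open>dn_map \<Omega> a f\<close> is the (weak) conormal derivative of the solution \<open>u\<^sub>f\<close>, as the functional
  \<open>g \<mapsto> \<langle>\<Lambda> f, g\<rangle> = a(u\<^sub>f, v)\<close> with \<open>v\<close> any \<open>H\<^sup>1\<close> extension of \<open>g\<close>. By Green's formula this is the
  boundary integral of \<open>\<partial>\<^sub>\<nu> u\<^sub>f\<close> (respectively \<open>\<gamma> \<partial>\<^sub>\<nu> u\<^sub>f\<close>) against \<open>g\<close> when \<open>u\<^sub>f\<close> is regular. The value
  does not depend on \<open>v\<close> because \<open>a(u\<^sub>f, \<cdot>)\<close> vanishes on functions of zero trace. The \<open>restrict\<close>-style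
  abstractions make equality of DN maps equality on \<open>H\<^sup>1\<^sup>/\<^sup>2(\<partial>\<Omega>)\<close>.\<close>

definition dn_map :: "'a::euclidean_space set \<Rightarrow> 'a form \<Rightarrow> 'a form" where
  "dn_map \<Omega> a = (\<lambda>f\<in>Hhalf \<Omega>. \<lambda>g\<in>Hhalf \<Omega>.
     THE r. \<exists>u v. weak_solution \<Omega> a f u \<and> has_trace \<Omega> v g \<and> r = a u v)"

text \<open>Potentials are measurable functions that act as bounded forms on \<open>H\<^sup>1(\<Omega>)\<close>; this covers
  \<open>L\<^sup>\<infinity>(\<Omega>)\<close>.\<close>

definition schroedinger_dn_defined :: "'a::euclidean_space set \<Rightarrow> ('a \<Rightarrow> real) \<Rightarrow> bool" where
  "schroedinger_dn_defined \<Omega> q \<longleftrightarrow> q \<in> borel_measurable (lebesgue_on \<Omega>) \<and>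
     (\<exists>C. \<forall>u\<in>H1 \<Omega>. \<forall>v\<in>H1 \<Omega>. integrable (lebesgue_on \<Omega>) (\<lambda>x. q x * u x * v x) \<and>
        \<bar>LINT x|lebesgue_on \<Omega>. q x * u x * v x\<bar> \<le> C * H1_norm \<Omega> u * H1_norm \<Omega> v) \<and>
     uniquely_solvable \<Omega> (schroedinger_form \<Omega> q)"

text \<open>Uniform ellipticity is not imposed: it is one sufficient condition for unique solvability, so
  all \<open>L\<^sup>\<infinity>\<close> conductivities with a positive lower bound are included.\<close>

definition conductivity_dn_defined :: "'a::euclidean_space set \<Rightarrow> ('a \<Rightarrow> real) \<Rightarrow> bool" where
  "conductivity_dn_defined \<Omega> \<gamma> \<longleftrightarrow> \<gamma> \<in> borel_measurable (lebesgue_on \<Omega>) \<and>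
     (\<exists>C. AE x in lebesgue_on \<Omega>. 0 < \<gamma> x \<and> \<gamma> x \<le> C) \<and>
     uniquely_solvable \<Omega> (conductivity_form \<Omega> \<gamma>)"

text \<open>Since the DN maps see coefficients only up to null sets, injectivity is meaningful for
  almost-everywhere classes, and coefficient classes are sets of such classes.\<close>

definition ae_class :: "'a::euclidean_space set \<Rightarrow> ('a \<Rightarrow> real) \<Rightarrow> ('a \<Rightarrow> real) set" where
  "ae_class \<Omega> q = {p \<in> borel_measurable (lebesgue_on \<Omega>). AE x in lebesgue_on \<Omega>. p x = q x}"

definition rep :: "('a \<Rightarrow> real) set \<Rightarrow> 'a \<Rightarrow> real" where
  "rep X = (SOME q. q \<in> X)"

definition schroedinger_potentials :: "'a::euclidean_space set \<Rightarrow> ('a \<Rightarrow> real) set set" where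
  "schroedinger_potentials \<Omega> = ae_class \<Omega> ` {q. schroedinger_dn_defined \<Omega> q}"

definition conductivities :: "'a::euclidean_space set \<Rightarrow> ('a \<Rightarrow> real) set set" where
  "conductivities \<Omega> = ae_class \<Omega> ` {\<gamma>. conductivity_dn_defined \<Omega> \<gamma>}"

definition schroedinger_dn :: "'a::euclidean_space set \<Rightarrow> ('a \<Rightarrow> real) set \<Rightarrow> 'a form" where
  "schroedinger_dn \<Omega> q = dn_map \<Omega> (schroedinger_form \<Omega> (rep q))"

definition conductivity_dn :: "'a::euclidean_space set \<Rightarrow> ('a \<Rightarrow> real) set \<Rightarrow> 'a form" where
  "conductivity_dn \<Omega> \<gamma> = dn_map \<Omega> (conductivity_form \<Omega> (rep \<gamma>))"

definition dn_matrix :: "(nat \<Rightarrow> 'a \<Rightarrow> real) \<Rightarrow> 'a form \<Rightarrow> nat \<times> nat \<Rightarrow> real" where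
  "dn_matrix f \<Lambda> = (\<lambda>(i, j). \<Lambda> (f i) (f j))"

abbreviation matrix_space :: "(nat \<times> nat \<Rightarrow> real) measure" where
  "matrix_space \<equiv> \<Pi>\<^sub>M ij\<in>UNIV. borel"


section \<open>Borel structures\<close>

definition borel_of :: "'q topology \<Rightarrow> 'q measure" where
  "borel_of X = sigma (topspace X) {U. openin X U}"

definition standard_borel :: "'q measure \<Rightarrow> bool" where
  "standard_borel M \<longleftrightarrow> (\<exists>X. completely_metrizable_space X \<and> second_countable X \<and>
     topspace X = space M \<and> sets M = sets (borel_of X))"

text \<open>\<open>C\<^sup>\<infinity>\<close> up to the boundary: every partial derivative has a continuous extension to the closure.
  The functions are fixed (as \<open>undefined\<close>) off the closure, so that equality is equality there.\<close>

definition smooth_closure :: "'a::euclidean_space set \<Rightarrow> ('a \<Rightarrow> real) set" where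
  "smooth_closure \<Omega> = {q \<in> extensional (closure \<Omega>).
     continuous_on (closure \<Omega>) q \<and> smooth_on \<Omega> q \<and>
     (\<forall>bs\<in>lists Basis. \<exists>g. continuous_on (closure \<Omega>) g \<and> (\<forall>x\<in>\<Omega>. g x = iter_deriv bs q x))}"

text \<open>The Frechet topology is given by the seminorms \<open>sup\<^sub>\<Omega> |\<partial>\<^sup>\<alpha> q|\<close>; their balls form a subbase.\<close>

definition smooth_closure_topology :: "'a::euclidean_space set \<Rightarrow> ('a \<Rightarrow> real) topology" where
  "smooth_closure_topology \<Omega> = topology_generated_by
     {{g \<in> smooth_closure \<Omega>. (SUP x\<in>\<Omega>. \<bar>iter_deriv bs g x - iter_deriv bs h x\<bar>) < \<epsilon>} | h bs \<epsilon>.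
        h \<in> smooth_closure \<Omega> \<and> bs \<in> lists Basis \<and> 0 < \<epsilon>}"

definition nonneg_smooth_potentials :: "'a::euclidean_space set \<Rightarrow> ('a \<Rightarrow> real) measure" where
  "nonneg_smooth_potentials \<Omega> = borel_of
     (subtopology (smooth_closure_topology \<Omega>) {q. \<forall>x\<in>closure \<Omega>. 0 \<le> q x})"

end

theory Submission
  imports Defs
begin

text \<open>
  The matrix of the bilinear form \<open>\<Lambda>\<close> on a dense sequence determines \<open>\<Lambda>\<close>, since \<open>\<Lambda>\<close> is symmetric and
  continuous in each argument; so uniqueness for \<open>\<Lambda>\<close> makes \<open>T\<close> injective. The law of an injective
  Borel image determines the law: by inner regularity on the graph of \<open>T\<close>, every Borel set is
  approximated from inside, in probability, by sets of the form \<open>T\<^sup>-\<^sup>1(K)\<close> with \<open>K\<close> compact.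

  For \<open>q \<ge> 0\<close> the form of \<open>-\<Delta> + q\<close> is coercive on functions of zero trace, which gives unique
  solvability, and \<open>\<langle>\<Lambda>\<^sub>q f, f\<rangle>\<close> is the minimum of \<open>\<integral> |\<nabla>u|\<^sup>2 + q u\<^sup>2\<close> over \<open>u\<close> with trace \<open>f\<close>, hence upper
  semicontinuous in \<open>q\<close>; polarization then shows that \<open>T\<close> is Borel. Since traces are limits of boundary
  values in \<open>L\<^sup>2\<close> of the Hausdorff measure, coercivity comes from an inequality of Friedrichs type,
  \<open>\<integral>\<^sub>\<Omega> \<phi>\<^sup>2 \<le> C (\<integral>\<^sub>\<partial>\<^sub>\<Omega> \<phi>\<^sup>2 + \<integral>\<^sub>\<Omega> |\<nabla>\<phi>|\<^sup>2)\<close> for smooth \<open>\<phi>\<close>, obtained by integrating along parallel lines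
  up to their first exit from \<open>\<Omega>\<close>.
\<close>

text \<open>The natural tool for the first part would be the Lusin-Souslin theorem, by which
  injective Borel maps send Borel sets to Borel sets. The argument on the graph replaces it: however
  irregular \<open>T\<close> is, a compact subset of its graph has a compact projection. This
  compares the two laws from one side only, and exchanging the variables gives equality.
  Measurability on smooth potentials rests on openness. A sublevel set of a minimum over
  \<open>u\<close> is a union over uncountably many \<open>u\<close>, which would be useless for
  Borel sets but is harmless for open ones. The analytic obstacle is that the boundary enters only
  through the Hausdorff measure, and traces only through limits of smooth functions. The Friedrichs
  inequality is therefore proved without charts and reduced to measure theory: the map from a point
  of \<open>\<Omega>\<close> to its first exit point pushes Lebesgue measure forward to at most a
  constant multiple of the Hausdorff measure. Both equations are treated through one notion, a
  bounded symmetric form on \<open>H1 \<Omega>\<close>.\<close>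

section \<open>Injective Borel images of random variables\<close>

text \<open>The embedding is \<open>p \<mapsto> (d(x\<^sub>n, p))\<^sub>n\<close> for a dense sequence \<open>x\<^sub>n\<close>. By completeness its range is cut
  out by countably many conditions: the triangle inequalities and \<open>inf\<^sub>n y\<^sub>n = 0\<close>.\<close>

lemma standard_borel_embedding:
  assumes "standard_borel M"
  obtains e :: "'q \<Rightarrow> nat \<Rightarrow> real" where "inj_on e (space M)" "e ` space M \<in> sets borel"
    "e \<in> borel_measurable M" "\<And>A. A \<in> sets M \<Longrightarrow> \<exists>B\<in>sets borel. A = e -` B \<inter> space M"
proof -
  obtain X where X: "completely_metrizable_space X" "second_countable X" "topspace X = space M"
    "sets M = sets (borel_of X)"
    using assms unfolding standard_borel_def by blast
  obtain S d where "Metric_space S d" and mc: "Metric_space.mcomplete S d"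
    and XS: "X = Metric_space.mtopology S d"
    using X(1) unfolding completely_metrizable_space_def by blast
  interpret Metric_space S d by fact
  have SM: "space M = S" using X XS by simp
  have setsM: "sets M = sigma_sets S {U. openin mtopology U}"
    using X(4) XS by (simp add: borel_of_def sets_measure_of_conv) (use openin_subset in force)
  show thesis
  proof (cases "S = {}")
    \<comment> \<open>A dense sequence needs a point to enumerate, so the empty space is treated
      apart.\<close>
    case True
    have "sets M = {{}}" using SM True by (simp add: space_empty_iff)
    then show ?thesis
      using SM True by (intro that[of "\<lambda>_ _. 0"]) auto
  next
    case False
    obtain C where C: "countable C" "C \<subseteq> S" "mtopology closure_of C = S"
      using second_countable_imp_separable_space[OF X(2)] XS unfolding separable_space_def by auto
    have "C \<noteq> {}" using C False by auto
    define x where "x = from_nat_into C"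
    have xS: "x n \<in> S" for n using C \<open>C \<noteq> {}\<close> from_nat_into unfolding x_def by blast
    have dense: "\<exists>n. d (x n) p < r" if "p \<in> S" "r > 0" for p r
    proof -
      have "p \<in> mtopology closure_of C" using C that by simp
      then obtain c where "c \<in> C" "d p c < r"
        using \<open>r > 0\<close> unfolding metric_closure_of by fastforce
      moreover obtain n where "c = x n"
        using C \<open>c \<in> C\<close> from_nat_into_surj unfolding x_def by metis
      ultimately show ?thesis using commute by metis
    qed
    define e where "e p = (\<lambda>n. d (x n) p)" for p
    define E :: "(nat \<Rightarrow> real) set" where "E = {y. (\<forall>n m. \<bar>y n - y m\<bar> \<le> d (x n) (x m) \<and> d (x n) (x m) \<le> y n + y m)
      \<and> (\<forall>k::nat. \<exists>n. y n < 1 / (real k + 1))}"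
    have "E \<in> sets borel"
    proof -
      have "E = (\<Inter>n m. {y. \<bar>y n - y m\<bar> \<le> d (x n) (x m)} \<inter> {y. d (x n) (x m) \<le> y n + y m})
        \<inter> (\<Inter>k::nat. \<Union>n. {y. y n < 1 / (real k + 1)})"
        unfolding E_def by (auto simp: set_eq_iff add.commute)
      moreover have "{y::nat\<Rightarrow>real. \<bar>y n - y m\<bar> \<le> d (x n) (x m)} \<in> sets borel" for n m
        by (intro borel_closed closed_Collect_le continuous_intros continuous_on_product_coordinates)
      moreover have "{y::nat\<Rightarrow>real. d (x n) (x m) \<le> y n + y m} \<in> sets borel" for n m
        by (intro borel_closed closed_Collect_le continuous_intros continuous_on_product_coordinates)
      moreover have "{y::nat\<Rightarrow>real. y n < 1 / (real k + 1)} \<in> sets borel" for n and k::nat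
        by (intro borel_open open_Collect_less continuous_intros continuous_on_product_coordinates)
      ultimately show ?thesis by simp
    qed
    have inj: "inj_on e S"
    proof (rule inj_onI)
      fix p p' assume p: "p \<in> S" "p' \<in> S" "e p = e p'"
      have "d p p' \<le> r" if "r > 0" for r
      proof -
        obtain n where "d (x n) p < r / 2" using dense p \<open>r > 0\<close> half_gt_zero by blast
        moreover have "d (x n) p' = d (x n) p" using p unfolding e_def by metis
        ultimately show ?thesis
          using triangle[OF p(1) xS[of n] p(2)] commute[of p "x n"] by linarith
      qed
      then have "d p p' \<le> 0" by (meson dense_ge)
      then show "p = p'" using p zero nonneg by (metis order_antisym)
    qed
    have eE: "e ` S = E"
    proof (intro set_eqI iffI)
      fix y assume "y \<in> e ` S"
      then obtain p where p: "p \<in> S" "y = e p" by blast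
      have "\<bar>y n - y m\<bar> \<le> d (x n) (x m) \<and> d (x n) (x m) \<le> y n + y m" for n m
        using triangle[OF xS[of n] xS[of m] p(1)] triangle[OF xS[of m] xS[of n] p(1)]
          triangle[OF xS[of n] p(1) xS[of m]] commute[of "x n" "x m"] commute[of "p" "x m"]
        unfolding p e_def by auto
      moreover have "\<exists>n. y n < 1 / (real k + 1)" for k :: nat
        using dense[OF p(1), of "1 / (real k + 1)"] unfolding p e_def by auto
      ultimately show "y \<in> E" unfolding E_def by blast
    next
      fix y assume y: "y \<in> E"
      \<comment> \<open>Indices along which \<open>y\<close> tends to 0. The corresponding points
        are Cauchy because \<open>d (x i) (x j) \<le> y i + y j\<close>, and the two inequalities
        together identify \<open>y\<close> with the distances to their limit.\<close>
      have "\<exists>n. \<forall>k::nat. y (n k) < 1 / (real k + 1)"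
        using y unfolding E_def by (intro choice) blast
      then obtain n where n: "\<And>k::nat. y (n k) < 1 / (real k + 1)" by blast
      have le: "d (x i) (x j) \<le> y i + y j" "\<bar>y i - y j\<bar> \<le> d (x i) (x j)" for i j
        using y unfolding E_def by blast+
      have small: "\<exists>N. \<forall>k\<ge>N. 1 / (real k + 1) < r" if "r > 0" for r
      proof -
        obtain N where "inverse (Suc N) < r" using reals_Archimedean[OF \<open>r > 0\<close>] by blast
        moreover have "1 / (real k + 1) \<le> inverse (Suc N)" if "k \<ge> N" for k
          using that by (simp add: field_simps)
        ultimately show ?thesis by (metis le_less_trans)
      qed
      have "MCauchy (\<lambda>k. x (n k))"
        unfolding MCauchy_def
      proof (intro conjI allI impI)
        fix r :: real assume "r > 0"
        then obtain N where "\<forall>k\<ge>N. 1 / (real k + 1) < r / 2" using small[of "r/2"] by auto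
        then have "d (x (n k)) (x (n k')) < r" if "k \<ge> N" "k' \<ge> N" for k k'
          using le(1)[of "n k" "n k'"] n[of k] n[of k'] that by (smt (verit) field_sum_of_halves)
        then show "\<exists>N. \<forall>k k'. N \<le> k \<longrightarrow> N \<le> k' \<longrightarrow> d (x (n k)) (x (n k')) < r" by blast
      qed (use xS in auto)
      then obtain p where "limitin mtopology (\<lambda>k. x (n k)) p sequentially"
        using mc unfolding mcomplete_def by blast
      then have p: "p \<in> S" "\<And>r. r > 0 \<Longrightarrow> \<exists>N. \<forall>k\<ge>N. d (x (n k)) p < r"
        unfolding limit_metric_sequentially by blast+
      have "y i = d (x i) p" for i
      proof -
        have "\<bar>y i - d (x i) p\<bar> \<le> r" if "r > 0" for r
        proof -
          have "r / 3 > 0" using that by simp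
          obtain N1 where N1: "\<forall>k\<ge>N1. 1 / (real k + 1) < r / 3" using small[OF \<open>r / 3 > 0\<close>] by blast
          obtain N2 where N2: "\<forall>k\<ge>N2. d (x (n k)) p < r / 3" using p(2)[OF \<open>r / 3 > 0\<close>] by blast
          define k where "k = max N1 N2"
          have "y (n k) < r / 3" "d (x (n k)) p < r / 3"
            using N1 N2 n[of k] unfolding k_def by (smt (verit) max.cobounded1, simp)
          then show ?thesis
            using le[of i "n k"] triangle[OF xS[of i] xS[of "n k"] p(1)]
              triangle[OF xS[of i] p(1) xS[of "n k"]] commute[of p "x (n k)"] by linarith
        qed
        then have "\<bar>y i - d (x i) p\<bar> \<le> 0" by (meson dense_ge)
        then show ?thesis by simp
      qed
      then have "y = e p" unfolding e_def by blast
      then show "y \<in> e ` S" using p by blast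
    qed
    have ball: "mball p r \<in> sets M" for p r
      using setsM by (auto intro: sigma_sets.Basic)
    have meas: "e \<in> borel_measurable M"
    proof (rule measurable_coordinatewise_then_product)
      fix n show "(\<lambda>p. e p n) \<in> borel_measurable M"
      proof (rule borel_measurableI_less)
        fix r
        have "{p \<in> space M. e p n < r} = mball (x n) r"
          using SM xS unfolding e_def mball_def by auto
        then show "{p \<in> space M. e p n < r} \<in> sets M" using ball by simp
      qed
    qed
    have op: "\<exists>B\<in>sets borel. A = e -` B \<inter> space M" if A: "openin mtopology A" for A
    proof -
      \<comment> \<open>Lying in a ball around \<open>x n\<close> is a condition on the single
        coordinate \<open>n\<close> of \<open>e p\<close>. Rational radii keep the union of balls
        that exhausts \<open>A\<close> countable.\<close>
      define I where "I = {(n, r::rat). mball (x n) (of_rat r) \<subseteq> A}"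
      define B where "B = (\<Union>(n, r)\<in>I. {y::nat\<Rightarrow>real. y n < of_rat r})"
      have "B \<in> sets borel" unfolding B_def
        by (intro sets.countable_UN') (auto intro!: borel_open open_Collect_less continuous_intros continuous_on_product_coordinates)
      moreover have "A = e -` B \<inter> space M"
      proof (intro set_eqI iffI)
        fix p assume "p \<in> A"
        then have pS: "p \<in> S" using A openin_mtopology by blast
        obtain r where r: "r > 0" "mball p r \<subseteq> A"
          using A \<open>p \<in> A\<close> unfolding openin_mtopology by blast
        obtain s where s: "0 < s" "s < r / 2" "s \<in> \<rat>" using Rats_dense_in_real[of 0 "r/2"] r by auto
        then obtain s' where s': "s = of_rat s'" by (auto elim: Rats_cases)
        obtain n where n: "d (x n) p < s" using dense[OF pS s(1)] by blast
        have "mball (x n) s \<subseteq> mball p r"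
        proof
          fix z assume "z \<in> mball (x n) s"
          then show "z \<in> mball p r"
            using pS xS[of n] n s triangle[OF pS xS[of n], of z] commute[of p "x n"] by auto
        qed
        then have "(n, s') \<in> I" using r unfolding I_def s' by auto
        then have "e p \<in> B" using n unfolding B_def e_def s' by auto
        then show "p \<in> e -` B \<inter> space M" using pS SM by auto
      next
        fix p assume p: "p \<in> e -` B \<inter> space M"
        then obtain n r where nr: "mball (x n) (of_rat r) \<subseteq> A" "d (x n) p < of_rat r"
          unfolding B_def I_def e_def by auto
        then have "p \<in> mball (x n) (of_rat r)" using p SM xS by (simp add: in_mball)
        then show "p \<in> A" using nr by blast
      qed
      ultimately show ?thesis by blast
    qed
    have "\<exists>B\<in>sets borel. A = e -` B \<inter> space M" if "A \<in> sets M" for A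
      using that unfolding setsM
    proof (induction rule: sigma_sets.induct)
      case (Basic a) then show ?case using op by simp
    next
      case Empty then show ?case by (intro bexI[of _ "{}"]) auto
    next
      case (Compl a)
      then obtain B where "B \<in> sets borel" "a = e -` B \<inter> space M" by blast
      then show ?case using SM by (intro bexI[of _ "- B"]) (auto simp: borel_comp)
    next
      case (Union a)
      then obtain B where "\<And>i. B i \<in> sets borel" "\<And>i::nat. a i = e -` B i \<inter> space M" by metis
      then show ?case by (intro bexI[of _ "\<Union>i. B i"]) auto
    qed
    then show ?thesis using that[of e] inj eE SM \<open>E \<in> sets borel\<close> meas by simp
  qed
qed

text \<open>A compact \<open>K\<close> inside the graph of \<open>T\<close> projects to a compact set of matrices, and by injectivity \<open>T p\<close>
  lies in that projection only if \<open>(p, T p)\<close> lies in \<open>K\<close>.\<close>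

lemma distr_eq_of_distr_inj_eq:
  fixes T :: "'q \<Rightarrow> nat \<times> nat \<Rightarrow> real"
  assumes M: "standard_borel M"
    and T: "T \<in> borel_measurable M" "inj_on T (space M)"
    and P: "prob_space P" "prob_space P'"
    and q: "q \<in> measurable P M" "q' \<in> measurable P' M"
    and eq: "distr P borel (\<lambda>\<omega>. T (q \<omega>)) = distr P' borel (\<lambda>\<omega>. T (q' \<omega>))"
  shows "distr P M q = distr P' M q'"
proof -
  obtain e :: "'q \<Rightarrow> nat \<Rightarrow> real" where inj: "inj_on e (space M)" and E: "e ` space M \<in> sets borel"
    and [measurable]: "e \<in> borel_measurable M"
    and sM: "\<And>A. A \<in> sets M \<Longrightarrow> \<exists>B\<in>sets borel. A = e -` B \<inter> space M"
    using standard_borel_embedding[OF M] by blast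
  note T(1)[measurable]
  define E where "E = e ` space M"
  have [measurable]: "E \<in> sets borel" using E E_def by simp
  have inv[measurable]: "the_inv_into (space M) e \<in> measurable (restrict_space borel E) M"
  proof (rule measurableI)
    fix y assume "y \<in> space (restrict_space borel E)"
    then show "the_inv_into (space M) e y \<in> space M"
      by (auto simp: E_def space_restrict_space intro!: the_inv_into_into[OF inj])
  next
    fix A assume "A \<in> sets M"
    then obtain B where B: "B \<in> sets borel" "A = e -` B \<inter> space M" using sM by blast
    have "the_inv_into (space M) e -` A \<inter> space (restrict_space borel E) = E \<inter> B"
      using inj by (auto simp: E_def B space_restrict_space the_inv_into_f_f)
    then show "the_inv_into (space M) e -` A \<inter> space (restrict_space borel E) \<in> sets (restrict_space borel E)"
      using B by (simp add: sets_restrict_space)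
  qed
  \<comment> \<open>\<open>T\<close> in the coordinates given by \<open>e\<close>, continued by a
    constant off the Borel range \<open>E\<close>, so that it is Borel on all sequences.\<close>
  define S where "S y = (if y \<in> E then T (the_inv_into (space M) e y) else undefined)" for y
  have [measurable]: "S \<in> borel_measurable borel"
    unfolding S_def by (subst measurable_restrict_space_iff[symmetric]) measurable
  have Se: "S (e p) = T p" if "p \<in> space M" for p
    using that inj by (simp add: S_def E_def the_inv_into_f_f)
  \<comment> \<open>The graph of \<open>T\<close> in these coordinates. It lives in a product of
    Polish spaces, where finite Borel measures are inner regular; the given space has only an
    abstract sigma-algebra.\<close>
  define G where "G = {z :: (nat \<Rightarrow> real) \<times> (nat \<times> nat \<Rightarrow> real). fst z \<in> E \<and> S (fst z) = snd z}"
  have G[measurable]: "G \<in> sets borel"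
  proof -
    have "G = (fst -` E) \<inter> (\<Inter>ij. {z. S (fst z) ij = snd z ij})"
      unfolding G_def by auto
    moreover have "fst -` E \<in> sets (borel :: ((nat \<Rightarrow> real) \<times> (nat \<times> nat \<Rightarrow> real)) measure)"
      using measurable_sets[of fst borel borel E] by (simp add: borel_measurable_continuous_onI continuous_on_fst)
    moreover have "{z::(nat \<Rightarrow> real) \<times> (nat \<times> nat \<Rightarrow> real). S (fst z) ij = snd z ij} \<in> sets borel" for ij
    proof -
      have [measurable]: "(\<lambda>x::nat \<times> nat \<Rightarrow> real. x ij) \<in> borel_measurable borel"
        by (intro borel_measurable_continuous_onI continuous_on_product_coordinates)
      have [measurable]: "fst \<in> borel_measurable (borel :: ((nat \<Rightarrow> real) \<times> (nat \<times> nat \<Rightarrow> real)) measure)"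
         "snd \<in> borel_measurable (borel :: ((nat \<Rightarrow> real) \<times> (nat \<times> nat \<Rightarrow> real)) measure)"
        by (simp_all add: borel_measurable_continuous_onI continuous_on_fst continuous_on_snd)
      have "{z\<in>space borel. S (fst z) ij = (snd z :: nat \<times> nat \<Rightarrow> real) ij} \<in> sets borel"
        by measurable
      then show ?thesis by simp
    qed
    ultimately show ?thesis by auto
  qed
  have GE: "\<exists>p\<in>space M. z = (e p, T p)" if "z \<in> G" for z
    using that Se unfolding G_def E_def by (cases z) auto
  \<comment> \<open>Stated for arbitrary sample spaces, so that it can be used again with
    \<open>P\<close> and \<open>P'\<close> exchanged.\<close>
  have le: "measure (distr P M q) A \<le> measure (distr P' M q') A"
    if P: "prob_space P" and P': "prob_space P'" and q[measurable]: "q \<in> measurable P M"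
    and q'[measurable]: "q' \<in> measurable P' M" and A: "A \<in> sets M"
    and eq: "distr P borel (\<lambda>\<omega>. T (q \<omega>)) = distr P' borel (\<lambda>\<omega>. T (q' \<omega>))"
    for P :: "'x measure" and P' :: "'y measure" and q q' A
  proof -
    interpret P: prob_space P by fact
    interpret P': prob_space P' by fact
    interpret D: prob_space "distr P M q" by (rule P.prob_space_distr) fact
    interpret D': prob_space "distr P' M q'" by (rule P'.prob_space_distr) fact
    obtain B where B[measurable]: "B \<in> sets borel" and AB: "A = e -` B \<inter> space M" using sM[OF A] by blast
    define GA where "GA = G \<inter> fst -` B"
    have GA: "GA \<in> sets borel"
      unfolding GA_def using measurable_sets[of fst borel borel B]
      by (auto simp: borel_measurable_continuous_onI continuous_on_fst)
    define \<Psi> where "\<Psi> p = (e p, T p)" for p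
    have [measurable]: "\<Psi> \<in> borel_measurable M" unfolding \<Psi>_def by measurable
    have \<Psi>A: "\<Psi> p \<in> GA \<longleftrightarrow> p \<in> A" if "p \<in> space M" for p
      using that Se by (auto simp: \<Psi>_def GA_def AB G_def E_def)
    define N where "N = distr P borel (\<lambda>\<omega>. \<Psi> (q \<omega>))"
    interpret N: prob_space N unfolding N_def by (rule P.prob_space_distr) measurable
    have "emeasure N GA = (SUP K \<in> {K. K \<subseteq> GA \<and> compact K}. emeasure N K)"
      by (rule inner_regular) (use GA N.emeasure_finite in \<open>auto simp: N_def\<close>)
    also have "\<dots> \<le> emeasure (distr P' M q') A"
    proof (rule SUP_least)
      fix K assume "K \<in> {K. K \<subseteq> GA \<and> compact K}"
      then have K: "K \<subseteq> GA" "compact K" by auto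
      have K'[measurable]: "snd ` K \<in> sets borel"
        using K by (intro borel_compact compact_continuous_image continuous_intros)
      have [measurable]: "K \<in> sets borel" using K borel_compact by blast
      have iff: "T p \<in> snd ` K \<longleftrightarrow> \<Psi> p \<in> K" if "p \<in> space M" for p
      proof
        assume "T p \<in> snd ` K"
        then obtain z where z: "z \<in> K" "T p = snd z" by blast
        then have "z \<in> G" using K unfolding GA_def by blast
        then obtain p' where p': "p' \<in> space M" "z = (e p', T p')" using GE by blast
        then have "p = p'" using T(2) that z by (auto dest: inj_onD)
        then show "\<Psi> p \<in> K" using p' z unfolding \<Psi>_def by simp
      qed (auto simp: \<Psi>_def image_iff intro: bexI[of _ "(e p, T p)"])
      have sp: "\<omega> \<in> space P \<Longrightarrow> q \<omega> \<in> space M" "\<omega>' \<in> space P' \<Longrightarrow> q' \<omega>' \<in> space M" for \<omega> \<omega>'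
        using measurable_space[OF q] measurable_space[OF q'] by auto
      \<comment> \<open>For compact \<open>K\<close> the event that the pair lies in
        \<open>K\<close> can be read off from \<open>T\<close> alone, so it has the same probability
        for both variables. For \<open>q'\<close> it implies membership in \<open>A\<close>.\<close>
      have "emeasure N K = emeasure (distr P borel (\<lambda>\<omega>. T (q \<omega>))) (snd ` K)"
        unfolding N_def using iff sp
        by (subst (1 2) emeasure_distr) (auto intro!: arg_cong[where f="emeasure P"])
      also have "\<dots> = emeasure (distr P' borel (\<lambda>\<omega>. T (q' \<omega>))) (snd ` K)" using eq by simp
      also have "\<dots> \<le> emeasure (distr P' M q') A"
      proof (subst (1 2) emeasure_distr)
        have "q' \<omega> \<in> A" if "\<omega> \<in> space P'" "T (q' \<omega>) \<in> snd ` K" for \<omega>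
          using iff[of "q' \<omega>"] sp(2)[of \<omega>] K \<Psi>A that by blast
        then show "emeasure P' ((\<lambda>\<omega>. T (q' \<omega>)) -` snd ` K \<inter> space P') \<le> emeasure P' (q' -` A \<inter> space P')"
          using A by (intro emeasure_mono) auto
      qed (use A in auto)
      finally show "emeasure N K \<le> emeasure (distr P' M q') A" .
    qed
    finally have "emeasure N GA \<le> emeasure (distr P' M q') A" .
    moreover have "emeasure N GA = emeasure (distr P M q) A"
    proof -
      have "(\<lambda>\<omega>. \<Psi> (q \<omega>)) -` GA \<inter> space P = q -` A \<inter> space P"
        using measurable_space[OF q] \<Psi>A by blast
      then show ?thesis unfolding N_def using GA A by (simp add: emeasure_distr)
    qed
    ultimately show ?thesis
      by (simp add: D.emeasure_eq_measure D'.emeasure_eq_measure)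
  qed
  interpret P: prob_space P by fact
  interpret P': prob_space P' by fact
  interpret D: prob_space "distr P M q" by (rule P.prob_space_distr) fact
  interpret D': prob_space "distr P' M q'" by (rule P'.prob_space_distr) fact
  show ?thesis
  proof (rule measure_eqI)
    fix A assume "A \<in> sets (distr P M q)"
    then have "measure (distr P M q) A = measure (distr P' M q') A"
      using le[OF P q _ eq] le[OF P(2,1) q(2,1) _ eq[symmetric]] by (auto intro: antisym)
    then show "emeasure (distr P M q) A = emeasure (distr P' M q') A"
      by (simp add: D.emeasure_eq_measure D'.emeasure_eq_measure)
  qed simp
qed

section \<open>Square-integrable functions\<close>

text \<open>Evaluation at the vertex \<open>t = - b / c\<close>; if \<open>c = 0\<close>, a nonzero
  slope would make the affine function negative somewhere. Besides Cauchy-Schwarz it also gives the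
  weak equation of a minimizer, since \<open>a = 0\<close> forces \<open>b = 0\<close>.\<close>

lemma quadratic_nonneg_imp_discriminant:
  fixes a b c :: real
  assumes "\<And>t. 0 \<le> a + 2 * t * b + t\<^sup>2 * c" and "0 \<le> c"
  shows "b\<^sup>2 \<le> a * c"
proof (cases "c = 0")
  case True
  have "b = 0"
  proof (rule ccontr)
    assume "b \<noteq> 0"
    then show False using assms(1)[of "- (a + 1) / (2 * b)"] True by (simp add: field_simps)
  qed
  then show ?thesis using True by simp
next
  case False
  then have "c > 0" using assms by simp
  have "0 \<le> a + 2 * (- b / c) * b + (- b / c)\<^sup>2 * c" by (rule assms(1))
  also have "\<dots> = (a * c - b\<^sup>2) / c" using \<open>c > 0\<close> by (simp add: field_simps power2_eq_square)
  finally show ?thesis using \<open>c > 0\<close> by (simp add: zero_le_divide_iff)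
qed

text \<open>Values in a Euclidean space are allowed so that the pair of a function and its weak
  gradient falls under the same lemmas as either component.\<close>

definition l2norm :: "'a measure \<Rightarrow> ('a \<Rightarrow> 'b::euclidean_space) \<Rightarrow> real" where
  "l2norm M f = sqrt (LINT x|M. (norm (f x))\<^sup>2)"

lemma square_integrable_measurable: "square_integrable M f \<Longrightarrow> f \<in> borel_measurable M"
  by (simp add: square_integrable_def)

lemma square_integrable_scaleR:
  assumes "square_integrable M f" shows "square_integrable M (\<lambda>x. c *\<^sub>R f x)"
  using assms unfolding square_integrable_def by (auto simp: power_mult_distrib)

text \<open>The difference of the two sides is the square of \<open>norm (x - y)\<close>.\<close>

lemma norm_add_square_le: "(norm (x + y))\<^sup>2 \<le> 2 * (norm x)\<^sup>2 + 2 * (norm (y::'a::real_inner))\<^sup>2"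
proof -
  have "0 \<le> (norm (x - y))\<^sup>2" by simp
  then show ?thesis by (simp add: power2_norm_eq_inner inner_simps inner_commute)
qed

lemma square_integrable_add:
  assumes "square_integrable M f" "square_integrable M g"
  shows "square_integrable M (\<lambda>x. f x + g x)"
proof -
  have [measurable]: "f \<in> borel_measurable M" "g \<in> borel_measurable M"
    using assms by (auto simp: square_integrable_def)
  have "integrable M (\<lambda>x. 2 * (norm (f x))\<^sup>2 + 2 * (norm (g x))\<^sup>2)"
    using assms by (auto simp: square_integrable_def)
  then have "integrable M (\<lambda>x. (norm (f x + g x))\<^sup>2)"
    by (rule Bochner_Integration.integrable_bound) (use norm_add_square_le in auto)
  then show ?thesis by (simp add: square_integrable_def)
qed

lemma square_integrable_diff:
  assumes "square_integrable M f" "square_integrable M g"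
  shows "square_integrable M (\<lambda>x. f x - g x)"
  using square_integrable_add[OF assms(1) square_integrable_scaleR[OF assms(2), of "-1"]] by simp

lemma square_integrable_inner:
  assumes "square_integrable M f" "square_integrable M g"
  shows "integrable M (\<lambda>x. f x \<bullet> g x)"
proof -
  have [measurable]: "f \<in> borel_measurable M" "g \<in> borel_measurable M"
    using assms by (auto simp: square_integrable_def)
  have le: "\<bar>x \<bullet> y\<bar> \<le> (norm x)\<^sup>2 + (norm y)\<^sup>2" for x y :: 'b
  proof -
    have "\<bar>x \<bullet> y\<bar> \<le> norm x * norm y" by (rule Cauchy_Schwarz_ineq2)
    moreover have "2 * (norm x * norm y) \<le> (norm x)\<^sup>2 + (norm y)\<^sup>2"
      using sum_squares_bound[of "norm x" "norm y"] by simp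
    moreover have "0 \<le> norm x * norm y" by simp
    ultimately show ?thesis by linarith
  qed
  have "integrable M (\<lambda>x. (norm (f x))\<^sup>2 + (norm (g x))\<^sup>2)"
    using assms by (auto simp: square_integrable_def)
  then show ?thesis
    by (rule Bochner_Integration.integrable_bound) (use le in auto)
qed

lemma l2norm_nonneg: "0 \<le> l2norm M f"
  unfolding l2norm_def by (simp add: integral_nonneg_AE)

lemma l2norm_square: "(l2norm M f)\<^sup>2 = (LINT x|M. f x \<bullet> f x)"
  unfolding l2norm_def by (simp add: integral_nonneg_AE power2_norm_eq_inner)

lemma l2norm_minus_commute: "l2norm M (\<lambda>x. f x - g x) = l2norm M (\<lambda>x. g x - f x)"
  by (simp add: l2norm_def norm_minus_commute)

lemma l2norm_cong_AE:
  assumes "AE x in M. f x = g x" "f \<in> borel_measurable M" "g \<in> borel_measurable M"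
  shows "l2norm M f = l2norm M g"
  unfolding l2norm_def
  by (rule arg_cong[where f = sqrt], rule integral_cong_AE) (use assms in auto)

lemma l2norm_Cauchy_Schwarz:
  assumes "square_integrable M f" "square_integrable M g"
  shows "\<bar>LINT x|M. f x \<bullet> g x\<bar> \<le> l2norm M f * l2norm M g"
proof -
  note int = square_integrable_inner[OF assms(1,1)] square_integrable_inner[OF assms]
    square_integrable_inner[OF assms(2,2)]
  have "0 \<le> (l2norm M f)\<^sup>2 + 2 * t * (LINT x|M. f x \<bullet> g x) + t\<^sup>2 * (l2norm M g)\<^sup>2" for t
  proof -
    have "0 \<le> (LINT x|M. (f x + t *\<^sub>R g x) \<bullet> (f x + t *\<^sub>R g x))" by (intro integral_nonneg_AE) simp
    also have "\<dots> = (LINT x|M. f x \<bullet> f x + 2 * t * (f x \<bullet> g x) + t\<^sup>2 * (g x \<bullet> g x))"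
      by (intro Bochner_Integration.integral_cong refl)
         (simp add: inner_simps inner_commute power2_eq_square algebra_simps)
    also have "\<dots> = (l2norm M f)\<^sup>2 + 2 * t * (LINT x|M. f x \<bullet> g x) + t\<^sup>2 * (l2norm M g)\<^sup>2"
      using int by (simp add: l2norm_square)
    finally show ?thesis .
  qed
  then have "(LINT x|M. f x \<bullet> g x)\<^sup>2 \<le> (l2norm M f)\<^sup>2 * (l2norm M g)\<^sup>2"
    by (rule quadratic_nonneg_imp_discriminant) simp
  then have "(LINT x|M. f x \<bullet> g x)\<^sup>2 \<le> (l2norm M f * l2norm M g)\<^sup>2" by (simp add: power_mult_distrib)
  then show ?thesis
    using abs_le_square_iff[of "LINT x|M. f x \<bullet> g x" "l2norm M f * l2norm M g"] l2norm_nonneg[of M f]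
      l2norm_nonneg[of M g] by simp
qed

lemma l2norm_scaleR: "l2norm M (\<lambda>x. c *\<^sub>R f x) = \<bar>c\<bar> * l2norm M f"
  by (simp add: l2norm_def power_mult_distrib real_sqrt_mult)

lemma l2norm_triangle:
  assumes "square_integrable M f" "square_integrable M g"
  shows "l2norm M (\<lambda>x. f x + g x) \<le> l2norm M f + l2norm M g"
proof (rule power2_le_imp_le)
  note int = square_integrable_inner[OF assms(1,1)] square_integrable_inner[OF assms]
    square_integrable_inner[OF assms(2,2)]
  have "(l2norm M (\<lambda>x. f x + g x))\<^sup>2 = (LINT x|M. f x \<bullet> f x + 2 * (f x \<bullet> g x) + g x \<bullet> g x)"
    unfolding l2norm_square by (intro Bochner_Integration.integral_cong refl)
         (simp add: inner_simps inner_commute algebra_simps)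
  also have "\<dots> = (l2norm M f)\<^sup>2 + 2 * (LINT x|M. f x \<bullet> g x) + (l2norm M g)\<^sup>2"
      using int by (simp add: l2norm_square)
  also have "\<dots> \<le> (l2norm M f)\<^sup>2 + 2 * (l2norm M f * l2norm M g) + (l2norm M g)\<^sup>2"
    using l2norm_Cauchy_Schwarz[OF assms] by simp
  also have "\<dots> = (l2norm M f + l2norm M g)\<^sup>2" by (simp add: power2_sum)
  finally show "(l2norm M (\<lambda>x. f x + g x))\<^sup>2 \<le> (l2norm M f + l2norm M g)\<^sup>2" .
qed (simp add: l2norm_nonneg)

lemma l2norm_eq_0_imp_AE:
  assumes "square_integrable M f" "l2norm M f = 0"
  shows "AE x in M. f x = 0"
proof -
  have "(LINT x|M. (norm (f x))\<^sup>2) = 0" using assms unfolding l2norm_def by simp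
  then have "AE x in M. (norm (f x))\<^sup>2 = 0"
    using assms by (subst (asm) integral_nonneg_eq_0_iff_AE) (auto simp: square_integrable_def)
  then show ?thesis by simp
qed

lemma nn_integral_square_integrable:
  assumes "square_integrable M f"
  shows "(\<integral>\<^sup>+x. ennreal ((norm (f x))\<^sup>2) \<partial>M) = ennreal ((l2norm M f)\<^sup>2)"
  using assms by (subst nn_integral_eq_integral)
    (auto simp: square_integrable_def l2norm_square power2_norm_eq_inner)

text \<open>The Riesz-Fischer theorem. A rapidly converging subsequence converges almost everywhere,
  and Fatou's lemma turns its pointwise limit into a limit in the mean.\<close>

lemma square_integrable_complete:
  fixes f :: "nat \<Rightarrow> 'a \<Rightarrow> 'b::euclidean_space"
  assumes si: "\<And>k. square_integrable M (f k)"
    and cau: "\<And>\<epsilon>. 0 < \<epsilon> \<Longrightarrow> \<exists>N. \<forall>m\<ge>N. \<forall>n\<ge>N. l2norm M (\<lambda>x. f m x - f n x) < \<epsilon>"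
  obtains g where "square_integrable M g" "(\<lambda>k. l2norm M (\<lambda>x. f k x - g x)) \<longlonglongrightarrow> 0"
proof -
  have [measurable]: "f k \<in> borel_measurable M" for k using si by (simp add: square_integrable_def)
  define N where "N k = (SOME N. \<forall>m\<ge>N. \<forall>n\<ge>N. l2norm M (\<lambda>x. f m x - f n x) < (1/4)^k)" for k
  have N: "l2norm M (\<lambda>x. f m x - f n x) < (1/4)^k" if "m \<ge> N k" "n \<ge> N k" for m n k
    using someI_ex[OF cau[of "(1/4)^k"]] that unfolding N_def by simp
  \<comment> \<open>The sum places both \<open>r k\<close> and \<open>r (Suc k)\<close> beyond
    \<open>N k\<close>, and the summand \<open>k\<close> sends \<open>r k\<close> to
    infinity.\<close>
  define r where "r k = k + (\<Sum>i\<le>k. N i)" for k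
  have rN: "r k \<ge> N k" "r (Suc k) \<ge> N k" "r k \<ge> k" for k
  proof -
    have "(\<Sum>i\<le>k. N i) \<ge> N k" by (rule member_le_sum) auto
    then show "r k \<ge> N k" "r (Suc k) \<ge> N k" by (auto simp: r_def)
  qed (simp add: r_def)
  define D where "D k x = norm (f (r (Suc k)) x - f (r k) x)" for k x
  have [measurable]: "D k \<in> borel_measurable M" for k unfolding D_def by measurable
  \<comment> \<open>The squares of \<open>D k\<close> have integral at most \<open>(1/16)^k\<close>.
    The weight \<open>4^k\<close> leaves a summable bound for the integrals, and pointwise it turns
    finiteness of the series into geometric decay of \<open>D k\<close> with ratio 1/2.\<close>
  have nnD: "(\<integral>\<^sup>+x. ennreal (4^k * (D k x)\<^sup>2) \<partial>M) \<le> ennreal ((1/4)^k)" for k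
  proof -
    have "(\<integral>\<^sup>+x. ennreal (4^k * (D k x)\<^sup>2) \<partial>M) = ennreal (4^k) * (\<integral>\<^sup>+x. ennreal ((D k x)\<^sup>2) \<partial>M)"
      by (subst nn_integral_cmult[symmetric]) (auto simp: ennreal_mult)
    also have "(\<integral>\<^sup>+x. ennreal ((D k x)\<^sup>2) \<partial>M) = ennreal ((l2norm M (\<lambda>x. f (r (Suc k)) x - f (r k) x))\<^sup>2)"
      unfolding D_def by (rule nn_integral_square_integrable) (intro square_integrable_diff si)
    also have "\<dots> \<le> ennreal (((1/4)^k)\<^sup>2)"
      by (intro ennreal_leI power_mono less_imp_le[OF N] rN l2norm_nonneg)
    also have "ennreal (4^k) * ennreal (((1/4)^k)\<^sup>2) = ennreal ((1/4)^k)"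
    proof -
      have "(4::real)^k * (1/4)^k = 1" by (simp add: power_one_over)
      then have "(4::real)^k * ((1/4)^k)\<^sup>2 = (1/4)^k" unfolding power2_eq_square by (metis mult.assoc mult_1)
      then show ?thesis by (subst ennreal_mult[symmetric]) auto
    qed
    finally show ?thesis by (simp add: mult_left_mono)
  qed
  have "(\<integral>\<^sup>+x. (\<Sum>k. ennreal (4^k * (D k x)\<^sup>2)) \<partial>M) = (\<Sum>k. \<integral>\<^sup>+x. ennreal (4^k * (D k x)\<^sup>2) \<partial>M)"
    by (rule nn_integral_suminf) measurable
  also have "\<dots> \<le> (\<Sum>k. ennreal ((1/4)^k))" by (intro suminf_le nnD) auto
  also have "\<dots> = ennreal (\<Sum>k. (1/4)^k)" by (intro suminf_ennreal2) (auto intro: summable_geometric)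
  also have "\<dots> < \<infinity>" by simp
  finally have "(\<integral>\<^sup>+x. (\<Sum>k. ennreal (4^k * (D k x)\<^sup>2)) \<partial>M) \<noteq> \<infinity>" by simp
  then have "AE x in M. (\<Sum>k. ennreal (4^k * (D k x)\<^sup>2)) \<noteq> \<infinity>"
    by (rule nn_integral_PInf_AE[rotated]) measurable
  then have conv: "AE x in M. convergent (\<lambda>k. f (r k) x)"
  proof eventually_elim
    fix x assume fin: "(\<Sum>k. ennreal (4^k * (D k x)\<^sup>2)) \<noteq> \<infinity>"
    define s where "s = enn2real (\<Sum>k. ennreal (4^k * (D k x)\<^sup>2))"
    have le_suminf: "F k \<le> (\<Sum>k. F k)" for F :: "nat \<Rightarrow> ennreal" and k
      using sum_le_suminf[of F "{k}"] by simp
    have "D k x \<le> sqrt s * (1/2)^k" for k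
    proof -
      have "ennreal (4^k * (D k x)\<^sup>2) \<le> (\<Sum>k. ennreal (4^k * (D k x)\<^sup>2))"
        by (rule le_suminf)
      also have "\<dots> = ennreal s" unfolding s_def using fin by (simp add: ennreal_enn2real_if)
      finally have "4^k * (D k x)\<^sup>2 \<le> s" by (subst (asm) ennreal_le_iff) (simp_all only: s_def enn2real_nonneg)
      moreover have "(2^k)\<^sup>2 = (4::real)^k"
        unfolding power2_eq_square power_mult_distrib[symmetric] by simp
      ultimately have "(2^k * D k x)\<^sup>2 \<le> s" by (simp add: power_mult_distrib)
      then have "2^k * D k x \<le> sqrt s" by (rule real_le_rsqrt)
      then have "(2^k * D k x) * (1/2)^k \<le> sqrt s * (1/2)^k" by (rule mult_right_mono) simp
      then show ?thesis by (simp add: power_one_over)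
    qed
    then have le: "norm (f (r (Suc k)) x - f (r k) x) \<le> sqrt s * (1/2)^k" for k
      unfolding D_def .
    have "summable (\<lambda>k. sqrt s * (1/2)^k)" by (intro summable_mult summable_geometric) simp
    then have "summable (\<lambda>k. f (r (Suc k)) x - f (r k) x)"
      using le by (rule summable_comparison_test'[where N = 0])
    then have "convergent (\<lambda>n. \<Sum>k<n. f (r (Suc k)) x - f (r k) x)"
      by (rule summable_iff_convergent[THEN iffD1])
    then have "convergent (\<lambda>n. f (r n) x - f (r 0) x)"
      unfolding sum_lessThan_telescope[of "\<lambda>k. f (r k) x"] .
    then show "convergent (\<lambda>k. f (r k) x)"
      unfolding convergent_diff_const_right_iff .
  qed
  define g where "g x = lim (\<lambda>k. f (r k) x)" for x
  have [measurable]: "g \<in> borel_measurable M" unfolding g_def by measurable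
  have lim: "AE x in M. (\<lambda>k. f (r k) x) \<longlonglongrightarrow> g x"
    using conv by eventually_elim (auto simp: g_def convergent_LIMSEQ_iff)
  \<comment> \<open>The index \<open>n\<close> is held fixed while the other one runs along the
    subsequence, so the estimate concerns the whole sequence.\<close>
  have fatou: "(\<integral>\<^sup>+x. ennreal ((norm (f n x - g x))\<^sup>2) \<partial>M) \<le> ennreal (\<epsilon>\<^sup>2)"
    if "\<forall>m\<ge>K. \<forall>n\<ge>K. l2norm M (\<lambda>x. f m x - f n x) < \<epsilon>" "n \<ge> K" for n K \<epsilon>
  proof -
    have "(\<integral>\<^sup>+x. ennreal ((norm (f n x - g x))\<^sup>2) \<partial>M)
       = (\<integral>\<^sup>+x. liminf (\<lambda>k. ennreal ((norm (f n x - f (r k) x))\<^sup>2)) \<partial>M)"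
    proof (rule nn_integral_cong_AE, use lim in eventually_elim)
      fix x assume "(\<lambda>k. f (r k) x) \<longlonglongrightarrow> g x"
      then have "(\<lambda>k. ennreal ((norm (f n x - f (r k) x))\<^sup>2)) \<longlonglongrightarrow> ennreal ((norm (f n x - g x))\<^sup>2)"
        by (intro tendsto_intros tendsto_ennrealI)
      then show "ennreal ((norm (f n x - g x))\<^sup>2) = liminf (\<lambda>k. ennreal ((norm (f n x - f (r k) x))\<^sup>2))"
        by (rule lim_imp_Liminf[OF trivial_limit_sequentially, symmetric])
    qed
    also have "\<dots> \<le> liminf (\<lambda>k. \<integral>\<^sup>+x. ennreal ((norm (f n x - f (r k) x))\<^sup>2) \<partial>M)"
      by (rule nn_integral_liminf) measurable
    also have "\<dots> \<le> limsup (\<lambda>k. \<integral>\<^sup>+x. ennreal ((norm (f n x - f (r k) x))\<^sup>2) \<partial>M)"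
      by (rule Liminf_le_Limsup) simp
    also have "\<dots> \<le> ennreal (\<epsilon>\<^sup>2)"
    proof (rule Limsup_bounded, rule eventually_sequentiallyI[of K])
      fix k assume "K \<le> k"
      then have "r k \<ge> K" using rN(3)[of k] by simp
      have "(\<integral>\<^sup>+x. ennreal ((norm (f n x - f (r k) x))\<^sup>2) \<partial>M) = ennreal ((l2norm M (\<lambda>x. f n x - f (r k) x))\<^sup>2)"
        by (rule nn_integral_square_integrable) (intro square_integrable_diff si)
      also have "\<dots> \<le> ennreal (\<epsilon>\<^sup>2)"
        using that \<open>r k \<ge> K\<close> l2norm_nonneg
        by (intro ennreal_leI power_mono) (auto intro: less_imp_le)
      finally show "(\<integral>\<^sup>+x. ennreal ((norm (f n x - f (r k) x))\<^sup>2) \<partial>M) \<le> ennreal (\<epsilon>\<^sup>2)" .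
    qed
    finally show ?thesis .
  qed
  have sid: "square_integrable M (\<lambda>x. f n x - g x)" if "\<forall>m\<ge>K. \<forall>n\<ge>K. l2norm M (\<lambda>x. f m x - f n x) < \<epsilon>" "n \<ge> K" for n K \<epsilon>
    using fatou[OF that] unfolding square_integrable_def
    by (auto simp: integrable_iff_bounded intro: le_less_trans)
  obtain K0 where K0: "\<forall>m\<ge>K0. \<forall>n\<ge>K0. l2norm M (\<lambda>x. f m x - f n x) < 1" using cau[of 1] by auto
  have g: "square_integrable M g"
    using square_integrable_diff[OF si[of K0] sid[OF K0 order_refl]] by simp
  have "(\<lambda>k. l2norm M (\<lambda>x. f k x - g x)) \<longlonglongrightarrow> 0"
  proof (rule LIMSEQ_I)
    fix \<epsilon> :: real assume "0 < \<epsilon>"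
    obtain K where K: "\<forall>m\<ge>K. \<forall>n\<ge>K. l2norm M (\<lambda>x. f m x - f n x) < \<epsilon> / 2" using cau[of "\<epsilon>/2"] \<open>0 < \<epsilon>\<close> by auto
    have "norm (l2norm M (\<lambda>x. f n x - g x) - 0) < \<epsilon>" if "n \<ge> K" for n
    proof -
      have "ennreal ((l2norm M (\<lambda>x. f n x - g x))\<^sup>2) \<le> ennreal ((\<epsilon>/2)\<^sup>2)"
        using fatou[OF K that] nn_integral_square_integrable[OF sid[OF K that]] by simp
      then have "(l2norm M (\<lambda>x. f n x - g x))\<^sup>2 \<le> (\<epsilon>/2)\<^sup>2" by (subst (asm) ennreal_le_iff) auto
      then have "l2norm M (\<lambda>x. f n x - g x) \<le> \<epsilon>/2" using \<open>0 < \<epsilon>\<close> by (simp add: power2_le_iff_abs_le l2norm_nonneg)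
      then show ?thesis using \<open>0 < \<epsilon>\<close> l2norm_nonneg[of M "\<lambda>x. f n x - g x"] by simp
    qed
    then show "\<exists>no. \<forall>n\<ge>no. norm (l2norm M (\<lambda>x. f n x - g x) - 0) < \<epsilon>" by blast
  qed
  with g show thesis by (rule that)
qed

section \<open>Smooth functions and test functions\<close>

lemma frechet_derivative_eqI:
  "(f has_derivative f') (at x) \<Longrightarrow> frechet_derivative f (at x) = f'"
  by (rule frechet_derivative_at[symmetric])

lemma smooth_on_UNIV_differentiable:
  assumes "smooth_on UNIV f" "bs \<in> lists Basis"
  shows "iter_deriv bs f differentiable at x"
  using assms unfolding smooth_on_def differentiable_on_def by simp

lemma smooth_on_UNIV_continuous:
  assumes "smooth_on UNIV f" "bs \<in> lists Basis"
  shows "continuous_on UNIV (iter_deriv bs f)"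
  using smooth_on_UNIV_differentiable[OF assms] differentiable_imp_continuous_within
  by (auto simp: continuous_on_eq_continuous_within)

lemma iter_deriv_add_scaled:
  assumes "smooth_on UNIV f" "smooth_on UNIV g" "bs \<in> lists Basis"
  shows "iter_deriv bs (\<lambda>x. f x + c * g x) = (\<lambda>x. iter_deriv bs f x + c * iter_deriv bs g x)"
  using assms(3)
proof (induction bs)
  case (Cons b bs)
  then have bs: "bs \<in> lists Basis" by simp
  have "frechet_derivative (\<lambda>x. iter_deriv bs f x + c * iter_deriv bs g x) (at x) b =
    frechet_derivative (iter_deriv bs f) (at x) b + c * frechet_derivative (iter_deriv bs g) (at x) b" for x
  proof -
    have "((\<lambda>x. iter_deriv bs f x + c * iter_deriv bs g x) has_derivative
      (\<lambda>h. frechet_derivative (iter_deriv bs f) (at x) h + c * frechet_derivative (iter_deriv bs g) (at x) h)) (at x)"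
      using smooth_on_UNIV_differentiable[OF assms(1) bs] smooth_on_UNIV_differentiable[OF assms(2) bs]
      by (intro has_derivative_add has_derivative_mult_right) (auto simp: frechet_derivative_works)
    then show ?thesis by (simp add: frechet_derivative_eqI)
  qed
  then show ?case using Cons bs by simp
qed simp

lemma smooth_on_UNIV_add_scaled:
  assumes "smooth_on UNIV f" "smooth_on UNIV g"
  shows "smooth_on UNIV (\<lambda>x. f x + c * g x)"
  unfolding smooth_on_def
proof (intro ballI)
  fix bs :: "'a list" assume bs: "bs \<in> lists Basis"
  show "iter_deriv bs (\<lambda>x. f x + c * g x) differentiable_on UNIV"
    unfolding iter_deriv_add_scaled[OF assms bs]
    using assms bs by (intro differentiable_on_add differentiable_on_mult) (auto simp: smooth_on_def)
qed

text \<open>Iterated derivatives never leave \<open>F\<close>. Explicit functions are shown to be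
  smooth in this way without computing their higher derivatives.\<close>

lemma smooth_on_UNIV_coinduct:
  assumes "f \<in> F" and F: "\<And>g x. g \<in> F \<Longrightarrow> g differentiable at x"
    "\<And>g b. g \<in> F \<Longrightarrow> b \<in> Basis \<Longrightarrow> (\<lambda>x. frechet_derivative g (at x) b) \<in> F"
  shows "smooth_on UNIV f"
proof -
  have "iter_deriv bs f \<in> F" if "bs \<in> lists Basis" for bs
    using that by (induction bs) (use assms in auto)
  then show ?thesis using F(1) unfolding smooth_on_def differentiable_on_def by simp
qed

section \<open>Bump functions of boxes\<close>

definition flat_exp :: "real poly \<Rightarrow> real \<Rightarrow> real" where
  "flat_exp p x = (if 0 < x then poly p (1 / x) * exp (- (1 / x)) else 0)"

lemma tendsto_poly_div_exp: "((\<lambda>y::real. poly p y * exp (- y)) \<longlongrightarrow> 0) at_top"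
proof -
  have "((\<lambda>y::real. \<Sum>i\<le>degree p. coeff p i * (y ^ i / exp y)) \<longlongrightarrow> (\<Sum>i\<le>degree p. coeff p i * 0)) at_top"
    by (intro tendsto_intros tendsto_power_div_exp_0)
  moreover have "(\<lambda>y. \<Sum>i\<le>degree p. coeff p i * (y ^ i / exp y)) = (\<lambda>y. poly p y * exp (- y))"
    by (simp add: poly_altdef sum_distrib_right exp_minus field_simps sum_divide_distrib)
  ultimately show ?thesis by simp
qed

text \<open>The chain rule through \<open>1 / x\<close> produces the factor
  \<open>[:0, 0, 1:]\<close>, evaluated at \<open>1 / x\<close>, and the exponential contributes
  \<open>p\<close> against \<open>pderiv p\<close>. At 0 the right-hand difference quotient is again
  a polynomial in \<open>1 / h\<close> times \<open>exp (- (1 / h))\<close>, with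
  \<open>pCons 0 p\<close> absorbing the division by \<open>h\<close>.\<close>

lemma flat_exp_has_derivative:
  "(flat_exp p has_real_derivative flat_exp ([:0, 0, 1:] * (p - pderiv p)) x) (at x)"
proof -
  consider "x > 0" | "x < 0" | "x = 0" by linarith
  then show ?thesis
  proof cases
    case 1
    have "((\<lambda>x. poly p (1 / x) * exp (- (1 / x))) has_real_derivative
        flat_exp ([:0, 0, 1:] * (p - pderiv p)) x) (at x)"
      unfolding flat_exp_def using 1
      by (auto intro!: derivative_eq_intros DERIV_chain2[OF poly_DERIV] simp: field_simps power2_eq_square)
    then show ?thesis
      by (rule has_field_derivative_transform_within_open[of _ _ _ "{0<..}"])
         (use 1 in \<open>auto simp: flat_exp_def\<close>)
  next
    case 2
    have "((\<lambda>x. 0) has_real_derivative flat_exp ([:0, 0, 1:] * (p - pderiv p)) x) (at x)"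
      using 2 by (simp add: flat_exp_def)
    then show ?thesis
      by (rule has_field_derivative_transform_within_open[of _ _ _ "{..<0}"])
         (use 2 in \<open>auto simp: flat_exp_def\<close>)
  next
    case 3
    have "((\<lambda>h. flat_exp p h / h) \<longlongrightarrow> 0) (at_right 0)"
    proof (rule Lim_transform_eventually)
      show "((\<lambda>h. poly (pCons 0 p) (inverse h) * exp (- inverse h)) \<longlongrightarrow> 0) (at_right (0::real))"
        by (rule filterlim_compose[OF tendsto_poly_div_exp filterlim_inverse_at_top_right])
      show "\<forall>\<^sub>F h in at_right 0. poly (pCons 0 p) (inverse h) * exp (- inverse h) = flat_exp p h / h"
        unfolding eventually_at_right_field
        by (intro exI[of _ 1]) (auto simp: flat_exp_def field_simps)
    qed
    moreover have "((\<lambda>h. flat_exp p h / h) \<longlongrightarrow> 0) (at_left 0)"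
    proof (rule Lim_transform_eventually)
      show "((\<lambda>h. 0) \<longlongrightarrow> (0::real)) (at_left (0::real))" by simp
      show "\<forall>\<^sub>F h in at_left 0. 0 = flat_exp p h / h"
        unfolding eventually_at_left_field
        by (intro exI[of _ "-1"]) (auto simp: flat_exp_def)
    qed
    ultimately have "((\<lambda>h. flat_exp p h / h) \<longlongrightarrow> 0) (at 0)" by (simp add: filterlim_split_at)
    then show ?thesis using 3 by (simp add: has_field_derivative_iff flat_exp_def)
  qed
qed

text \<open>This algebra is closed under partial derivatives, which makes its members smooth, and it contains
  the bump functions of boxes.\<close>

inductive_set flat_algebra :: "('a::euclidean_space \<Rightarrow> real) set" where
  const: "(\<lambda>_. c) \<in> flat_algebra"
| flat: "(\<lambda>x. flat_exp p (v \<bullet> x + c)) \<in> flat_algebra"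
| add: "f \<in> flat_algebra \<Longrightarrow> g \<in> flat_algebra \<Longrightarrow> (\<lambda>x. f x + g x) \<in> flat_algebra"
| mult: "f \<in> flat_algebra \<Longrightarrow> g \<in> flat_algebra \<Longrightarrow> (\<lambda>x. f x * g x) \<in> flat_algebra"

lemma flat_algebra_derivative:
  assumes "f \<in> flat_algebra"
  shows "\<exists>f'. (\<forall>x. (f has_derivative f' x) (at x)) \<and> (\<forall>b. (\<lambda>x. f' x b) \<in> flat_algebra)"
  using assms
proof induction
  case (const c)
  show ?case by (intro exI[of _ "\<lambda>x b. 0"]) (auto intro: flat_algebra.const)
next
  case (flat p v c)
  define p' where "p' = [:0, 0, 1:] * (p - pderiv p)"
  have "((\<lambda>x. flat_exp p (v \<bullet> x + c)) has_derivative (\<lambda>h. (v \<bullet> h) * flat_exp p' (v \<bullet> x + c))) (at x)" for x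
  proof -
    have "((\<lambda>x. v \<bullet> x + c) has_derivative (\<lambda>h. v \<bullet> h)) (at x)"
      by (auto intro!: derivative_eq_intros)
    from has_derivative_compose[OF this flat_exp_has_derivative[THEN has_field_derivative_imp_has_derivative]]
    show ?thesis unfolding p'_def by (simp add: mult.commute)
  qed
  moreover have "(\<lambda>x. (v \<bullet> b) * flat_exp p' (v \<bullet> x + c)) \<in> flat_algebra" for b
    by (intro flat_algebra.mult flat_algebra.const flat_algebra.flat)
  ultimately show ?case by (intro exI[of _ "\<lambda>x h. (v \<bullet> h) * flat_exp p' (v \<bullet> x + c)"]) auto
next
  case (add f g)
  then obtain f' g' where fg: "\<And>x. (f has_derivative f' x) (at x)" "\<And>b. (\<lambda>x. f' x b) \<in> flat_algebra"
    "\<And>x. (g has_derivative g' x) (at x)" "\<And>b. (\<lambda>x. g' x b) \<in> flat_algebra" by blast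
  show ?case
    by (intro exI[of _ "\<lambda>x b. f' x b + g' x b"] conjI allI has_derivative_add flat_algebra.add fg)
next
  case (mult f g)
  then obtain f' g' where fg: "\<And>x. (f has_derivative f' x) (at x)" "\<And>b. (\<lambda>x. f' x b) \<in> flat_algebra"
    "\<And>x. (g has_derivative g' x) (at x)" "\<And>b. (\<lambda>x. g' x b) \<in> flat_algebra" by blast
  show ?case
    by (intro exI[of _ "\<lambda>x b. f x * g' x b + f' x b * g x"] conjI allI has_derivative_mult
        flat_algebra.add flat_algebra.mult fg mult.hyps)
qed

lemma flat_algebra_smooth:
  assumes "f \<in> flat_algebra" shows "smooth_on UNIV f"
proof (rule smooth_on_UNIV_coinduct[OF assms])
  fix g :: "'a \<Rightarrow> real" assume g: "g \<in> flat_algebra"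
  obtain g' where g': "\<And>x. (g has_derivative g' x) (at x)" "\<And>b. (\<lambda>x. g' x b) \<in> flat_algebra"
    using flat_algebra_derivative[OF g] by blast
  show "g differentiable at x" for x using g' differentiable_def by blast
  have "frechet_derivative g (at x) = g' x" for x using g' by (intro frechet_derivative_eqI)
  then show "(\<lambda>x. frechet_derivative g (at x) b) \<in> flat_algebra" for b using g' by simp
qed

lemma flat_algebra_prod:
  "finite I \<Longrightarrow> (\<And>i. i \<in> I \<Longrightarrow> f i \<in> flat_algebra) \<Longrightarrow> (\<lambda>x. \<Prod>i\<in>I. f i x) \<in> flat_algebra"
proof (induction rule: finite_induct)
  case empty
  show ?case using flat_algebra.const[of 1] by simp
next
  case (insert i I)
  then show ?case using flat_algebra.mult[of "f i" "\<lambda>x. \<Prod>i\<in>I. f i x"] by simp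
qed

text \<open>The parameter \<open>t\<close> is a steepness: for \<open>t > 0\<close> the support does
  not change, and for large \<open>t\<close> the bumps approach the indicator of the box. The
  arguments are written as an inner product plus a constant to match the rule
  \<open>flat\<close>.\<close>

definition box_bump :: "'a::euclidean_space \<Rightarrow> 'a \<Rightarrow> real \<Rightarrow> 'a \<Rightarrow> real" where
  "box_bump a c t x = (\<Prod>b\<in>Basis. flat_exp 1 ((t *\<^sub>R b) \<bullet> x + - t * (a \<bullet> b)) *
     flat_exp 1 ((- t *\<^sub>R b) \<bullet> x + t * (c \<bullet> b)))"

lemma box_bump_smooth: "smooth_on UNIV (box_bump a c t)"
  unfolding box_bump_def[abs_def]
  by (intro flat_algebra_smooth flat_algebra_prod flat_algebra.mult flat_algebra.flat finite_Basis)

lemma flat_exp_1_bounds: "0 \<le> flat_exp 1 x" "flat_exp 1 x \<le> 1"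
  by (auto simp: flat_exp_def)

lemma box_bump_bounds: "0 \<le> box_bump a c t x" "box_bump a c t x \<le> 1"
  unfolding box_bump_def
  by (intro prod_nonneg prod_le_1 ballI mult_nonneg_nonneg mult_le_one conjI flat_exp_1_bounds)+

lemma box_bump_factor_pos:
  assumes "0 < t"
  shows "flat_exp 1 ((t *\<^sub>R b) \<bullet> x + - t * (a \<bullet> b)) * flat_exp 1 ((- t *\<^sub>R b) \<bullet> x + t * (c \<bullet> b)) \<noteq> 0
    \<longleftrightarrow> a \<bullet> b < x \<bullet> b \<and> x \<bullet> b < c \<bullet> b"
proof -
  have "(t *\<^sub>R b) \<bullet> x + - t * (a \<bullet> b) = t * (x \<bullet> b - a \<bullet> b)"
    "(- t *\<^sub>R b) \<bullet> x + t * (c \<bullet> b) = t * (c \<bullet> b - x \<bullet> b)"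
    by (auto simp: algebra_simps inner_commute)
  then show ?thesis using assms by (auto simp: flat_exp_def zero_less_mult_iff)
qed

lemma box_bump_nonzero_iff:
  assumes "0 < t" shows "box_bump a c t x \<noteq> 0 \<longleftrightarrow> x \<in> box a c"
proof -
  have "flat_exp 1 ((t *\<^sub>R b) \<bullet> x + - t * (a \<bullet> b)) * flat_exp 1 ((- t *\<^sub>R b) \<bullet> x + t * (c \<bullet> b)) = 0
    \<longleftrightarrow> \<not> (a \<bullet> b < x \<bullet> b \<and> x \<bullet> b < c \<bullet> b)" for b
    using box_bump_factor_pos[OF assms, of b x a c] by blast
  then show ?thesis
    unfolding box_bump_def by (simp only: prod_zero_iff[OF finite_Basis] mem_box) blast
qed

lemma box_bump_tendsto:
  assumes "x \<in> box a c" shows "(\<lambda>n. box_bump a c (real (Suc n)) x) \<longlonglongrightarrow> 1"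
proof -
  have lim: "(\<lambda>n. flat_exp 1 (real (Suc n) * s)) \<longlonglongrightarrow> 1" if "s > 0" for s
  proof -
    have "(\<lambda>n. exp (- (inverse (real (Suc n)) * (1 / s)))) \<longlonglongrightarrow> exp (- (0 * (1 / s)))"
      by (intro tendsto_intros LIMSEQ_inverse_real_of_nat)
    moreover have "exp (- (inverse (real (Suc n)) * (1 / s))) = flat_exp 1 (real (Suc n) * s)" for n
      using that by (simp add: flat_exp_def field_simps add_pos_nonneg)
    ultimately show ?thesis by simp
  qed
  have "(\<lambda>n. box_bump a c (real (Suc n)) x) \<longlonglongrightarrow> (\<Prod>b\<in>(Basis::'a set). 1 * 1)"
    unfolding box_bump_def
  proof (intro tendsto_prod tendsto_mult)
    fix b :: 'a assume b: "b \<in> Basis"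
    have eq: "(t *\<^sub>R b) \<bullet> x + - t * (a \<bullet> b) = t * (x \<bullet> b - a \<bullet> b)"
      "(- t *\<^sub>R b) \<bullet> x + t * (c \<bullet> b) = t * (c \<bullet> b - x \<bullet> b)" for t
      by (auto simp: algebra_simps inner_commute)
    show "(\<lambda>n. flat_exp 1 ((real (Suc n) *\<^sub>R b) \<bullet> x + - real (Suc n) * (a \<bullet> b))) \<longlonglongrightarrow> 1"
      "(\<lambda>n. flat_exp 1 ((- real (Suc n) *\<^sub>R b) \<bullet> x + real (Suc n) * (c \<bullet> b))) \<longlonglongrightarrow> 1"
      unfolding eq using assms b by (auto intro!: lim simp: mem_box simp del: of_nat_Suc)
  qed
  then show ?thesis by simp
qed

lemma box_bump_test_function:
  assumes "0 < t" "cbox a c \<subseteq> \<Omega>" shows "test_function \<Omega> (box_bump a c t)"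
proof -
  have "{x. box_bump a c t x \<noteq> 0} = box a c" using box_bump_nonzero_iff[OF assms(1)] by blast
  moreover have "closure (box a c) \<subseteq> cbox a c" by (rule closure_minimal[OF box_subset_cbox closed_cbox])
  moreover have "compact (closure (box a c))" by (simp add: bounded_box compact_closure)
  ultimately show ?thesis using assms(2) box_bump_smooth unfolding test_function_def by auto
qed

section \<open>Integration by parts for smooth functions\<close>

text \<open>The difference quotients have integral zero by translation invariance of Lebesgue measure.\<close>

lemma integral_directional_derivative_eq_0:
  fixes F :: "'a::euclidean_space \<Rightarrow> real"
  assumes der: "\<And>x. (F has_derivative F' x) (at x)"
    and cont: "continuous_on UNIV (\<lambda>x. F' x b)"
    and K: "compact K" "\<And>x. x \<notin> K \<Longrightarrow> F x = 0"
  shows "(LINT x|lborel. F' x b) = 0"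
proof -
  have zero: "F' x b = 0" if "x \<notin> K" for x
  proof -
    have "open (- K)" using K(1) compact_imp_closed by blast
    then have "(F has_derivative (\<lambda>_. 0)) (at x)"
      using has_derivative_transform_within_open[of "\<lambda>_. 0" "\<lambda>_. 0" x UNIV "- K" F] K(2) that by auto
    then show ?thesis using has_derivative_unique[OF der] by metis
  qed
  have Fcont: "continuous_on UNIV F"
    using has_derivative_continuous[OF der] by (auto simp: continuous_on_eq_continuous_at)
  then have [measurable]: "F \<in> borel_measurable borel" by (rule borel_measurable_continuous_onI)
  obtain B where B: "\<And>x. \<bar>F' x b\<bar> \<le> B"
  proof -
    have "compact ((\<lambda>x. F' x b) ` K)"
      using K(1) cont by (intro compact_continuous_image continuous_on_subset[OF cont]) auto
    then have "bounded ((\<lambda>x. F' x b) ` K)" by (rule compact_imp_bounded)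
    then obtain B where "\<forall>y\<in>(\<lambda>x. F' x b) ` K. norm y \<le> B"
      unfolding bounded_iff by (elim exE)
    then have "\<bar>F' x b\<bar> \<le> max B 0" for x
      using zero[of x] by (cases "x \<in> K") (auto intro: max.coboundedI1)
    then show ?thesis using that by blast
  qed
  obtain R where R: "K \<subseteq> cball 0 R"
    using bounded_subset_ballD[OF compact_imp_bounded[OF K(1)], of 0] ball_subset_cball by (elim exE conjE) (rule that, rule order_trans)
  define h where "h k = inverse (real (Suc k))" for k
  have h: "0 < h k" "h k \<le> 1" for k
    by (auto simp: h_def field_simps)
  have h0: "h \<longlonglongrightarrow> 0" unfolding h_def[abs_def] by (rule LIMSEQ_inverse_real_of_nat)
  have line: "((\<lambda>s. F (x + s *\<^sub>R b)) has_real_derivative F' (x + s *\<^sub>R b) b) (at s)" for x s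
  proof -
    have "((\<lambda>s. x + s *\<^sub>R b) has_derivative (\<lambda>s. s *\<^sub>R b)) (at s)"
      by (auto intro!: derivative_eq_intros)
    from has_derivative_compose[OF this der]
    have "((\<lambda>s. F (x + s *\<^sub>R b)) has_derivative (\<lambda>t. F' (x + s *\<^sub>R b) (t *\<^sub>R b))) (at s)" .
    moreover have "F' (x + s *\<^sub>R b) (t *\<^sub>R b) = F' (x + s *\<^sub>R b) b * t" for t
      using linear_cmul[OF has_derivative_linear[OF der]] by (simp add: mult.commute)
    ultimately show ?thesis by (simp add: has_field_derivative_def mult_commute_abs)
  qed
  define Q where "Q k x = (F (x + h k *\<^sub>R b) - F x) / h k" for k x
  have Qm[measurable]: "Q k \<in> borel_measurable borel" for k unfolding Q_def by measurable
  \<comment> \<open>The mean value theorem along the line bounds the difference quotients by the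
    derivative, uniformly in \<open>k\<close>; this is the domination needed for the limit.\<close>
  have Qbound: "\<bar>Q k x\<bar> \<le> B" for k x
  proof -
    obtain s where "F (x + h k *\<^sub>R b) - F (x + 0 *\<^sub>R b) = (h k - 0) * F' (x + s *\<^sub>R b) b"
      using MVT2[of 0 "h k" "\<lambda>s. F (x + s *\<^sub>R b)" "\<lambda>s. F' (x + s *\<^sub>R b) b"] line h(1) by blast
    then have "Q k x = F' (x + s *\<^sub>R b) b" using h(1)[of k] by (simp add: Q_def)
    then show ?thesis using B by simp
  qed
  have Fint: "integrable lborel F"
  proof -
    have "bounded (F ` K)"
      using K(1) Fcont by (intro compact_imp_bounded compact_continuous_image continuous_on_subset[OF Fcont]) auto
    then obtain C where "\<forall>y\<in>F ` K. norm y \<le> C" unfolding bounded_iff by (elim exE)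
    then have "norm (F x) \<le> norm (indicator (cball 0 R) x * C)" for x
      using K(2)[of x] R by (cases "x \<in> K") (auto simp: indicator_def intro: order_trans)
    moreover have "integrable lborel (\<lambda>x::'a. indicator (cball 0 R) x * C)"
      using emeasure_lborel_cball_finite[of 0 R] by auto
    ultimately show ?thesis by (auto intro: Bochner_Integration.integrable_bound[where f = "\<lambda>x. indicator (cball 0 R) x * C"])
  qed
  have trans: "(LINT x|lborel. F (x + v)) = (LINT x|lborel. F x)" "integrable lborel (\<lambda>x. F (x + v))" for v
  proof -
    have "(LINT x|lborel. F x) = (LINT x|distr lborel borel ((+) v). F x)" by (simp add: lborel_distr_plus)
    also have "\<dots> = (LINT x|lborel. F (x + v))" by (subst integral_distr) (auto simp: add.commute)
    finally show "(LINT x|lborel. F (x + v)) = (LINT x|lborel. F x)" by simp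
    have "integrable (distr lborel borel ((+) v)) F" using Fint by (simp add: lborel_distr_plus)
    then show "integrable lborel (\<lambda>x. F (x + v))" by (subst (asm) integrable_distr_eq) (auto simp: add.commute)
  qed
  have Q0: "(LINT x|lborel. Q k x) = 0" for k
    unfolding Q_def using trans Fint by simp
  have "(\<lambda>k. LINT x|lborel. Q k x) \<longlonglongrightarrow> (LINT x|lborel. F' x b)"
  proof (rule integral_dominated_convergence)
    show "(\<lambda>x. F' x b) \<in> borel_measurable lborel" using borel_measurable_continuous_onI[OF cont] by simp
    \<comment> \<open>Since \<open>h k \<le> 1\<close>, enlarging the ball around \<open>K\<close>
      by \<open>norm b\<close> contains the supports of all difference quotients at once.\<close>
    show "integrable lborel (\<lambda>x. indicator (cball 0 (R + norm b)) x * B)"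
      using emeasure_lborel_cball_finite[of 0 "R + norm b"] by auto
    show "AE x in lborel. (\<lambda>k. Q k x) \<longlonglongrightarrow> F' x b"
    proof (intro AE_I2)
      fix x
      have "((\<lambda>s. (F (x + s *\<^sub>R b) - F (x + 0 *\<^sub>R b)) / (s - 0)) \<longlongrightarrow> F' (x + 0 *\<^sub>R b) b) (at 0)"
        using line[of x 0] unfolding has_field_derivative_iff .
      moreover have "filterlim h (at 0) sequentially"
        unfolding filterlim_at using h h0 by (auto simp: less_imp_neq[symmetric])
      ultimately have "(\<lambda>k. (F (x + h k *\<^sub>R b) - F (x + 0 *\<^sub>R b)) / (h k - 0)) \<longlonglongrightarrow> F' (x + 0 *\<^sub>R b) b"
        by (rule filterlim_compose)
      then show "(\<lambda>k. Q k x) \<longlonglongrightarrow> F' x b" by (simp add: Q_def)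
    qed
    show "AE x in lborel. norm (Q k x) \<le> indicator (cball 0 (R + norm b)) x * B" for k
    proof (intro AE_I2)
      fix x
      show "norm (Q k x) \<le> indicator (cball 0 (R + norm b)) x * B"
      proof (cases "x \<in> cball 0 (R + norm b)")
        case True then show ?thesis using Qbound by simp
      next
        case False
        have "norm (h k *\<^sub>R b) \<le> norm b" using h[of k] by (simp add: mult_left_le_one_le)
        moreover have "norm x \<le> norm (x + h k *\<^sub>R b) + norm (h k *\<^sub>R b)"
          using norm_triangle_ineq4[of "x + h k *\<^sub>R b" "h k *\<^sub>R b"] by simp
        moreover have "norm x > R + norm b" using False by simp
        ultimately have "norm (x + h k *\<^sub>R b) > R" "norm x > R" using norm_ge_zero[of b] by linarith+
        then have "x + h k *\<^sub>R b \<notin> K" "x \<notin> K" using R by auto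
        then show ?thesis using K(2) False by (simp add: Q_def)
      qed
    qed
  qed (use Qm in auto)
  then show ?thesis using Q0 by (simp add: LIMSEQ_const_iff)
qed

definition grad :: "('a::euclidean_space \<Rightarrow> real) \<Rightarrow> 'a \<Rightarrow> 'a" where
  "grad \<phi> x = (\<Sum>b\<in>Basis. iter_deriv [b] \<phi> x *\<^sub>R b)"

lemma grad_inner_Basis: "b \<in> Basis \<Longrightarrow> grad \<phi> x \<bullet> b = iter_deriv [b] \<phi> x"
  unfolding grad_def by (simp add: inner_sum_left inner_Basis if_distrib sum.delta cong: if_cong)

lemma smooth_has_derivative:
  assumes "smooth_on UNIV \<phi>"
  shows "(\<phi> has_derivative frechet_derivative \<phi> (at x)) (at x)"
  using smooth_on_UNIV_differentiable[OF assms, of "[]"] by (simp add: frechet_derivative_works)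

lemma continuous_on_grad:
  assumes "smooth_on UNIV \<phi>" shows "continuous_on UNIV (grad \<phi>)"
  unfolding grad_def[abs_def]
  using smooth_on_UNIV_continuous[OF assms, of "[_]"] by (intro continuous_intros) simp

lemma continuous_imp_square_integrable:
  fixes g :: "'a::euclidean_space \<Rightarrow> 'b::euclidean_space"
  assumes "continuous_on UNIV g" "bounded \<Omega>" "\<Omega> \<in> sets lebesgue"
  shows "square_integrable (lebesgue_on \<Omega>) g"
proof -
  have [measurable]: "g \<in> borel_measurable (lebesgue_on \<Omega>)"
    using assms by (intro measurable_restrict_space1 measurable_completion)
      (simp add: borel_measurable_continuous_onI)
  have "compact (closure \<Omega>)" using assms(2) by (simp add: compact_closure)
  then have "bounded (g ` closure \<Omega>)"
    by (intro compact_imp_bounded compact_continuous_image continuous_on_subset[OF assms(1)]) auto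
  then obtain B where B: "\<And>x. x \<in> closure \<Omega> \<Longrightarrow> norm (g x) \<le> B" unfolding bounded_iff by auto
  have fin: "finite_measure (lebesgue_on \<Omega>)"
    using assms by (intro finite_measure_lebesgue_on bounded_set_imp_lmeasurable)
  have "integrable (lebesgue_on \<Omega>) (\<lambda>x. (norm (g x))\<^sup>2)"
  proof (rule finite_measure.integrable_const_bound[OF fin, of _ "B\<^sup>2"])
    show "AE x in lebesgue_on \<Omega>. norm ((norm (g x))\<^sup>2) \<le> B\<^sup>2"
      using B closure_subset by (intro AE_I2) (auto simp: intro!: power_mono)
  qed measurable
  then show ?thesis by (simp add: square_integrable_def)
qed

lemma lebesgue_on_integral_eq_lborel:
  fixes g :: "'a::euclidean_space \<Rightarrow> real"
  assumes "\<Omega> \<in> sets lebesgue" "g \<in> borel_measurable borel" "\<And>x. x \<notin> \<Omega> \<Longrightarrow> g x = 0"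
  shows "(LINT x|lebesgue_on \<Omega>. g x) = (LINT x|lborel. g x)"
proof -
  have "(LINT x|lebesgue_on \<Omega>. g x) = (LINT x|lebesgue. indicator \<Omega> x *\<^sub>R g x)"
    using assms by (intro integral_restrict_space) auto
  also have "\<dots> = (LINT x|lebesgue. g x)"
    using assms(3) by (intro Bochner_Integration.integral_cong) (auto simp: indicator_def)
  also have "\<dots> = (LINT x|lborel. g x)" using assms(2) by (intro integral_completion) simp
  finally show ?thesis .
qed

lemma test_function_zero_outside: "test_function \<Omega> \<psi> \<Longrightarrow> x \<notin> \<Omega> \<Longrightarrow> \<psi> x = 0"
  unfolding test_function_def using closure_subset[of "{x. \<psi> x \<noteq> 0}"] by blast

lemma test_function_deriv_zero_outside:
  assumes "test_function \<Omega> \<psi>" "x \<notin> \<Omega>" shows "iter_deriv [b] \<psi> x = 0"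
proof -
  define S where "S = - closure {x. \<psi> x \<noteq> 0}"
  have "open S" "x \<in> S" using assms unfolding S_def test_function_def by auto
  moreover have "\<psi> y = 0" if "y \<in> S" for y using that closure_subset[of "{x. \<psi> x \<noteq> 0}"] unfolding S_def by blast
  ultimately have "(\<psi> has_derivative (\<lambda>_. 0)) (at x)"
    using has_derivative_transform_within_open[of "\<lambda>_. 0" "\<lambda>_. 0" x UNIV S \<psi>] by auto
  then show ?thesis by (simp add: frechet_derivative_eqI)
qed

text \<open>The product with a test function is compactly supported in the whole space, so the
  integral of its directional derivative vanishes, and the product rule splits it.\<close>

lemma smooth_has_weak_gradient:
  fixes \<phi> :: "'a::euclidean_space \<Rightarrow> real"
  assumes \<phi>: "smooth_on UNIV \<phi>" and \<Omega>: "bounded \<Omega>" "\<Omega> \<in> sets lebesgue"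
  shows "has_weak_gradient \<Omega> \<phi> (grad \<phi>)"
  unfolding has_weak_gradient_def
proof (intro conjI allI impI)
  show "square_integrable (lebesgue_on \<Omega>) (grad \<phi>)"
    by (intro continuous_imp_square_integrable continuous_on_grad assms)
next
  fix \<psi> and b :: 'a assume \<psi>: "test_function \<Omega> \<psi>" and b: "b \<in> Basis"
  have s\<psi>: "smooth_on UNIV \<psi>" using \<psi> unfolding test_function_def by simp
  define K where "K = closure {x. \<psi> x \<noteq> 0}"
  have K: "\<psi> x = 0" if "x \<notin> K" for x
    using that closure_subset[of "{x. \<psi> x \<noteq> 0}"] unfolding K_def by blast
  have K1: "compact K" using \<psi> unfolding K_def test_function_def by simp
  define D where "D x = \<phi> x * frechet_derivative \<psi> (at x) b + frechet_derivative \<phi> (at x) b * \<psi> x" for x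
  have c: "continuous_on UNIV \<phi>" "continuous_on UNIV \<psi>" "continuous_on UNIV (iter_deriv [b] \<phi>)"
    "continuous_on UNIV (iter_deriv [b] \<psi>)"
    using smooth_on_UNIV_continuous[OF \<phi>, of "[]"] smooth_on_UNIV_continuous[OF s\<psi>, of "[]"]
      smooth_on_UNIV_continuous[OF \<phi>, of "[b]"] smooth_on_UNIV_continuous[OF s\<psi>, of "[b]"] b by auto
  have [measurable]: "\<phi> \<in> borel_measurable borel" "\<psi> \<in> borel_measurable borel"
    "iter_deriv [b] \<phi> \<in> borel_measurable borel" "iter_deriv [b] \<psi> \<in> borel_measurable borel"
    using c by (auto intro: borel_measurable_continuous_onI simp del: iter_deriv.simps)
  have "(LINT x|lborel. \<phi> x * frechet_derivative \<psi> (at x) b + frechet_derivative \<phi> (at x) b * \<psi> x) = 0"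
  proof (rule integral_directional_derivative_eq_0[of "\<lambda>x. \<phi> x * \<psi> x"
        "\<lambda>x h. \<phi> x * frechet_derivative \<psi> (at x) h + frechet_derivative \<phi> (at x) h * \<psi> x" b K])
    show "((\<lambda>x. \<phi> x * \<psi> x) has_derivative
       (\<lambda>h. \<phi> x * frechet_derivative \<psi> (at x) h + frechet_derivative \<phi> (at x) h * \<psi> x)) (at x)" for x
      by (intro has_derivative_mult smooth_has_derivative \<phi> s\<psi>)
    show "continuous_on UNIV (\<lambda>x. \<phi> x * frechet_derivative \<psi> (at x) b + frechet_derivative \<phi> (at x) b * \<psi> x)"
      using c by (intro continuous_intros) auto
  qed (use K K1 in auto)
  then have "(LINT x|lborel. \<phi> x * iter_deriv [b] \<psi> x + iter_deriv [b] \<phi> x * \<psi> x) = 0" by simp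
  then have "(LINT x|lebesgue_on \<Omega>. \<phi> x * iter_deriv [b] \<psi> x + iter_deriv [b] \<phi> x * \<psi> x) = 0"
    using \<Omega> \<psi> test_function_zero_outside[OF \<psi>] test_function_deriv_zero_outside[OF \<psi>]
    by (subst lebesgue_on_integral_eq_lborel) (auto simp del: iter_deriv.simps)
  moreover have "integrable (lebesgue_on \<Omega>) (\<lambda>x. \<phi> x * iter_deriv [b] \<psi> x)"
    "integrable (lebesgue_on \<Omega>) (\<lambda>x. iter_deriv [b] \<phi> x * \<psi> x)"
    using square_integrable_inner[OF continuous_imp_square_integrable[OF c(1) \<Omega>] continuous_imp_square_integrable[OF c(4) \<Omega>]]
     square_integrable_inner[OF continuous_imp_square_integrable[OF c(3) \<Omega>] continuous_imp_square_integrable[OF c(2) \<Omega>]]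
    by simp_all
  ultimately show "(LINT x|lebesgue_on \<Omega>. \<phi> x * iter_deriv [b] \<psi> x) =
        - (LINT x|lebesgue_on \<Omega>. (grad \<phi> x \<bullet> b) * \<psi> x)"
    using b by (simp add: grad_inner_Basis del: iter_deriv.simps)
qed

section \<open>Weak gradients and completeness of the Sobolev space\<close>

lemma sq_norm_Pair: "(norm (a, b))\<^sup>2 = (norm a)\<^sup>2 + (norm b)\<^sup>2"
  by (simp add: norm_Pair)

lemma square_integrable_Pair:
  assumes "square_integrable M u" "square_integrable M G"
  shows "square_integrable M (\<lambda>x. (u x, G x))"
  using assms unfolding square_integrable_def sq_norm_Pair by (auto intro: borel_measurable_Pair)

lemma square_integrable_fst_snd:
  assumes "square_integrable M g"
  shows "square_integrable M (\<lambda>x. fst (g x))" "square_integrable M (\<lambda>x. snd (g x))"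
proof -
  have [measurable]: "(\<lambda>x. fst (g x)) \<in> borel_measurable M" "(\<lambda>x. snd (g x)) \<in> borel_measurable M"
    using assms unfolding square_integrable_def
    by (auto intro: borel_measurable_continuous_on[OF continuous_on_fst[OF continuous_on_id]]
        borel_measurable_continuous_on[OF continuous_on_snd[OF continuous_on_id]])
  have int: "integrable M (\<lambda>x. (norm (g x))\<^sup>2)" using assms unfolding square_integrable_def by simp
  have "integrable M (\<lambda>x. (norm (fst (g x)))\<^sup>2)"
    by (rule Bochner_Integration.integrable_bound[OF int]) (auto simp: norm_prod_def)
  moreover have "integrable M (\<lambda>x. (norm (snd (g x)))\<^sup>2)"
    by (rule Bochner_Integration.integrable_bound[OF int]) (auto simp: norm_prod_def)
  ultimately show "square_integrable M (\<lambda>x. fst (g x))" "square_integrable M (\<lambda>x. snd (g x))"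
    unfolding square_integrable_def by auto
qed

lemma l2norm_mono:
  assumes "square_integrable M f" "square_integrable M g" "\<And>x. norm (f x) \<le> norm (g x)"
  shows "l2norm M f \<le> l2norm M g"
  unfolding l2norm_def using assms
  by (intro real_sqrt_le_mono integral_mono power_mono) (auto simp: square_integrable_def)

section \<open>The fundamental lemma of the calculus of variations\<close>

lemma integral_borel_sets_eq_0:
  fixes f :: "'a::euclidean_space \<Rightarrow> real"
  assumes f: "integrable lborel f" and tot: "(LINT x|lborel. f x) = 0"
    and box: "\<And>a c. (LINT x:box a c|lborel. f x) = 0" and A: "A \<in> sets borel"
  shows "(LINT x:A|lborel. f x) = 0"
proof -
  define G where "G = range (\<lambda>(a, c). box a c :: 'a set)"
  have si: "set_integrable lborel A f" if "A \<in> sets borel" for A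
    unfolding set_integrable_def using integrable_mult_indicator[OF _ f, of A] that by simp
  \<comment> \<open>Preparation for Dynkin's theorem: boxes form an intersection-stable generator,
    and the hypothesis on the total integral handles complements.\<close>
  have "Int_stable G"
  proof (rule Int_stableI)
    fix A B assume "A \<in> G" "B \<in> G"
    then obtain a b c d where "A = box a b" "B = box c d" unfolding G_def by auto
    then have "A \<inter> B = (\<lambda>(a, c). box a c) (\<Sum>i\<in>Basis. max (a\<bullet>i) (c\<bullet>i) *\<^sub>R i, \<Sum>i\<in>Basis. min (b\<bullet>i) (d\<bullet>i) *\<^sub>R i)"
      by (simp add: box_Int_box)
    then show "A \<inter> B \<in> G" unfolding G_def by blast
  qed
  moreover have "G \<subseteq> Pow UNIV" by simp
  moreover have "A \<in> sigma_sets UNIV G"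
    using A unfolding G_def by (subst (asm) borel_eq_box) simp
  ultimately show ?thesis
  proof (induction A rule: sigma_sets_induct_disjoint)
    case (basic A)
    then show ?case using box unfolding G_def by auto
  next
    case empty
    then show ?case by (simp add: set_lebesgue_integral_def)
  next
    case (compl A)
    have "sigma_sets UNIV G = sets borel" unfolding G_def by (subst borel_eq_box) simp
    then have A: "A \<in> sets borel" using compl by simp
    have "(LINT x:UNIV|lborel. f x) = (LINT x:A|lborel. f x) + (LINT x:UNIV - A|lborel. f x)"
      using set_integral_Un[of A "UNIV - A" lborel f] si A by (simp add: Un_Diff_cancel)
    then show ?case using compl tot by (simp add: set_lebesgue_integral_def)
  next
    case (union A)
    have "sigma_sets UNIV G = sets borel" unfolding G_def by (subst borel_eq_box) simp
    then have A: "A i \<in> sets borel" for i using union by blast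
    have "(LINT x:(\<Union>i. A i)|lborel. f x) = (\<Sum>i. (LINT x:(A i)|lborel. f x))"
      using A union(1) by (intro lebesgue_integral_countable_add si) (auto simp: disjoint_family_on_def)
    then show ?case using union by simp
  qed
qed

text \<open>Bumps of steepness tending to infinity turn the hypothesis into vanishing integrals over
  all boxes whose closed box lies in \<open>\<Omega>\<close>. Cutting \<open>w\<close> off outside
  \<open>box a c\<close> makes this a statement about all boxes of the space.\<close>

lemma fundamental_lemma_box:
  fixes w :: "'a::euclidean_space \<Rightarrow> real"
  assumes w: "integrable lborel w" and B: "cbox a c \<subseteq> \<Omega>"
    and zero: "\<And>\<phi>. test_function \<Omega> \<phi> \<Longrightarrow> (LINT x|lborel. w x * \<phi> x) = 0"
  shows "AE x in lborel. x \<in> box a c \<longrightarrow> w x = 0"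
proof -
  have [measurable]: "w \<in> borel_measurable borel" using w by auto
  have boxint: "(LINT x|lborel. w x * indicator (box a' c') x) = 0" if sub: "cbox a' c' \<subseteq> \<Omega>" for a' c'
  proof -
    have bm[measurable]: "box_bump a' c' t \<in> borel_measurable borel" for t
      using smooth_on_UNIV_continuous[OF box_bump_smooth, of "[]", of a' c' t]
      by (intro borel_measurable_continuous_onI) simp
    have "(\<lambda>n. LINT x|lborel. w x * box_bump a' c' (real (Suc n)) x) \<longlonglongrightarrow> (LINT x|lborel. w x * indicator (box a' c') x)"
    proof (rule integral_dominated_convergence)
      show "integrable lborel (\<lambda>x. norm (w x))" using w by simp
      show "AE x in lborel. (\<lambda>n. w x * box_bump a' c' (real (Suc n)) x) \<longlonglongrightarrow> w x * indicator (box a' c') x"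
      proof (intro AE_I2 tendsto_mult tendsto_const)
        fix x show "(\<lambda>n. box_bump a' c' (real (Suc n)) x) \<longlonglongrightarrow> indicator (box a' c') x"
        proof (cases "x \<in> box a' c'")
          case True then show ?thesis using box_bump_tendsto by (simp del: of_nat_Suc)
        next
          case False
          then have "box_bump a' c' (real (Suc n)) x = 0" for n
            using box_bump_nonzero_iff[of "real (Suc n)" a' c' x] by auto
          then show ?thesis using False by (simp del: of_nat_Suc)
        qed
      qed
      show "AE x in lborel. norm (w x * box_bump a' c' (real (Suc n)) x) \<le> norm (w x)" for n
        using box_bump_bounds[of a' c' "real (Suc n)"]
        by (intro AE_I2) (simp add: abs_mult mult_left_le del: of_nat_Suc)
    qed (use bm in measurable)
    moreover have "(LINT x|lborel. w x * box_bump a' c' (real (Suc n)) x) = 0" for n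
      by (intro zero box_bump_test_function sub) simp
    ultimately show ?thesis by (simp add: LIMSEQ_const_iff del: of_nat_Suc)
  qed
  define f where "f x = indicator (box a c) x * w x" for x
  have f: "integrable lborel f"
    unfolding f_def using integrable_mult_indicator[OF _ w, of "box a c"] by simp
  have "AE x in lborel. f x = 0"
  proof (rule density_unique_real)
    fix A :: "'a set" assume "A \<in> sets lborel"
    then have A: "A \<in> sets borel" by simp
    have "(LINT x:A|lborel. f x) = 0"
    proof (rule integral_borel_sets_eq_0[OF f _ _ A])
      show "(LINT x|lborel. f x) = 0" unfolding f_def using boxint[OF B] by (simp add: mult.commute)
      fix a' c'
      obtain a'' c'' where ac: "box a' c' \<inter> box a c = box a'' c''" unfolding box_Int_box by blast
      \<comment> \<open>The corners of an empty intersection carry no information about its closed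
        box, so this case is separated; otherwise the closure of the open box is the closed
        one.\<close>
      have "cbox a'' c'' \<subseteq> \<Omega> \<or> box a'' c'' = {}"
      proof (cases "box a'' c'' = {}")
        case False
        then have "cbox a'' c'' = closure (box a'' c'')" by (rule closure_box[symmetric])
        also have "\<dots> \<subseteq> cbox a c"
          using box_subset_cbox[of a c] unfolding ac[symmetric] by (intro closure_minimal) auto
        finally show ?thesis using B by blast
      qed simp
      then have "(LINT x|lborel. w x * indicator (box a'' c'') x) = 0" using boxint by auto
      moreover have "w x * indicator (box a'' c'') x = indicator (box a' c') x * f x" for x
        unfolding f_def ac[symmetric] by (auto simp: indicator_def)
      ultimately show "(LINT x:box a' c'|lborel. f x) = 0" by (simp add: set_lebesgue_integral_def)
    qed
    then show "(LINT x:A|lborel. f x) = (LINT x:A|lborel. 0)" by (simp add: set_lebesgue_integral_def)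
  qed (use f in auto)
  then show ?thesis by eventually_elim (auto simp: f_def)
qed

locale bounded_open_set =
  fixes \<Omega> :: "'a::euclidean_space set"
  assumes open_\<Omega>: "open \<Omega>" and bounded_\<Omega>: "bounded \<Omega>"
begin

abbreviation vol :: "'a measure" where "vol \<equiv> lebesgue_on \<Omega>"
abbreviation wgrad :: "('a \<Rightarrow> real) \<Rightarrow> 'a \<Rightarrow> 'a" where "wgrad \<equiv> weak_grad \<Omega>"
abbreviation H1norm :: "('a \<Rightarrow> real) \<Rightarrow> real" where "H1norm \<equiv> H1_norm \<Omega>"

lemma lebesgue_\<Omega>[measurable, simp]: "\<Omega> \<in> sets lebesgue"
  using open_\<Omega> by (simp add: borel_open)

lemma finite_M: "finite_measure vol"
  using bounded_\<Omega> by (intro finite_measure_lebesgue_on bounded_set_imp_lmeasurable) auto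

lemma square_integrable_imp_integrable:
  fixes u :: "'a \<Rightarrow> 'b::euclidean_space"
  assumes "square_integrable vol u" shows "integrable vol u"
proof -
  interpret finite_measure vol by (rule finite_M)
  have "norm y \<le> norm (1 + (norm y)\<^sup>2)" for y :: 'b
  proof -
    have "2 * norm y \<le> 1 + (norm y)\<^sup>2" using sum_squares_bound[of 1 "norm y"] by simp
    then have "norm y \<le> 1 + (norm y)\<^sup>2" using norm_ge_zero[of y] by linarith
    then show ?thesis by simp
  qed
  moreover have "integrable vol (\<lambda>x. 1 + (norm (u x))\<^sup>2)"
    using assms by (auto simp: square_integrable_def)
  ultimately show ?thesis
    using assms by (intro Bochner_Integration.integrable_bound[where g = u and f = "\<lambda>x. 1 + (norm (u x))\<^sup>2"])
      (auto simp: square_integrable_def)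
qed

text \<open>Extending by zero and passing to a Borel version brings \<open>w\<close> into the
  setting of a single box. The Lindelof property then reduces the cover of \<open>\<Omega>\<close>
  to countably many boxes, so that the exceptional null sets can be united.\<close>

lemma fundamental_lemma:
  assumes w: "square_integrable vol w" and zero: "\<And>\<phi>. test_function \<Omega> \<phi> \<Longrightarrow> (LINT x|vol. w x * \<phi> x) = 0"
  shows "AE x in vol. w x = (0::real)"
proof -
  define W where "W x = indicator \<Omega> x *\<^sub>R w x" for x
  have Wint: "integrable lebesgue W"
    using square_integrable_imp_integrable[OF w] unfolding W_def by (subst (asm) integrable_restrict_space) auto
  obtain W' where [measurable]: "W' \<in> borel_measurable borel" and W': "AE x in lborel. W x = W' x"
    using completion_ex_borel_measurable_real[of W lborel] Wint by auto
  have "AE x in lebesgue. W x = W' x" using W' by (rule AE_completion)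
  then have "integrable lebesgue W'"
    using Wint by (subst integrable_cong_AE[of W' _ W]) (auto elim: AE_mp simp: eq_commute intro: measurable_completion)
  then have int': "integrable lborel W'" by (subst (asm) integrable_completion) auto
  have zero': "(LINT x|lborel. W' x * \<phi> x) = 0" if \<phi>: "test_function \<Omega> \<phi>" for \<phi>
  proof -
    have "continuous_on UNIV \<phi>"
      using \<phi> smooth_on_UNIV_continuous[of \<phi> "[]"] unfolding test_function_def by simp
    then have [measurable]: "\<phi> \<in> borel_measurable borel" by (rule borel_measurable_continuous_onI)
    have [measurable]: "W \<in> borel_measurable lebesgue" using Wint by auto
    have [measurable]: "\<phi> \<in> borel_measurable lebesgue" "W' \<in> borel_measurable lebesgue"
      by (auto intro: measurable_completion)
    have "(LINT x|lborel. W' x * \<phi> x) = (LINT x|lebesgue. W' x * \<phi> x)"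
      by (rule integral_completion[symmetric]) simp
    also have "\<dots> = (LINT x|lebesgue. W x * \<phi> x)"
      using \<open>AE x in lebesgue. W x = W' x\<close> by (intro integral_cong_AE) (auto elim: AE_mp)
    also have "\<dots> = (LINT x|lebesgue. indicator \<Omega> x *\<^sub>R (w x * \<phi> x))"
      unfolding W_def by (intro Bochner_Integration.integral_cong) auto
    also have "\<dots> = (LINT x|vol. w x * \<phi> x)"
      by (intro integral_restrict_space[symmetric]) auto
    finally show ?thesis using zero[OF \<phi>] by simp
  qed
  define D where "D = {box a c |a c. cbox a c \<subseteq> \<Omega>}"
  obtain D' where D': "D' \<subseteq> D" "countable D'" "\<Union>D' = \<Union>D"
    by (rule Lindelof[of D]) (auto simp: D_def)
  have cover: "\<Omega> \<subseteq> \<Union>D'"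
  proof
    fix x assume "x \<in> \<Omega>"
    then obtain a c where ac: "cbox a c \<subseteq> \<Omega>" "x \<in> box a c"
      by (rule open_contains_cbox[OF open_\<Omega>])
    then have "box a c \<in> D" unfolding D_def by blast
    then show "x \<in> \<Union>D'" using ac D'(3) by blast
  qed
  have "AE x in lborel. \<forall>B\<in>D'. x \<in> B \<longrightarrow> W' x = 0"
  proof (subst AE_ball_countable[OF D'(2)], intro ballI)
    fix B assume "B \<in> D'"
    then obtain a c where B: "B = box a c" "cbox a c \<subseteq> \<Omega>" using D' unfolding D_def by blast
    show "AE x in lborel. x \<in> B \<longrightarrow> W' x = 0"
      unfolding B by (rule fundamental_lemma_box[OF int' B(2) zero'])
  qed
  then have "AE x in lborel. x \<in> \<Omega> \<longrightarrow> w x = 0"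
    using W' by eventually_elim (use cover in \<open>auto simp: W_def\<close>)
  then have "AE x in lebesgue. x \<in> \<Omega> \<longrightarrow> w x = 0" by (rule AE_completion)
  then show ?thesis by (subst AE_restrict_space_iff) auto
qed

end

context bounded_open_set
begin

lemma continuous_square_integrable:
  "continuous_on UNIV (g :: 'a \<Rightarrow> 'b::euclidean_space) \<Longrightarrow> square_integrable vol g"
  by (rule continuous_imp_square_integrable[OF _ bounded_\<Omega> lebesgue_\<Omega>])

lemma test_function_square_integrable:
  assumes "test_function \<Omega> \<phi>"
  shows "square_integrable vol \<phi>" and "b \<in> Basis \<Longrightarrow> square_integrable vol (iter_deriv [b] \<phi>)"
proof -
  have s: "smooth_on UNIV \<phi>" using assms unfolding test_function_def by simp
  show "square_integrable vol \<phi>"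
    using smooth_on_UNIV_continuous[OF s, of "[]"] by (simp add: continuous_square_integrable)
  show "b \<in> Basis \<Longrightarrow> square_integrable vol (iter_deriv [b] \<phi>)"
    using smooth_on_UNIV_continuous[OF s, of "[b]"] by (intro continuous_square_integrable) simp
qed

lemma square_integrable_mult:
  fixes u v :: "'b \<Rightarrow> real"
  shows "square_integrable M u \<Longrightarrow> square_integrable M v \<Longrightarrow> integrable M (\<lambda>x. u x * v x)"
  using square_integrable_inner[of M u v] by simp

lemma square_integrable_component:
  assumes "square_integrable M G" shows "square_integrable M (\<lambda>x. G x \<bullet> b)"
proof -
  have [measurable]: "G \<in> borel_measurable M" using assms by (simp add: square_integrable_def)
  have int: "integrable M (\<lambda>x. (norm (G x))\<^sup>2 * (norm b)\<^sup>2)" using assms by (simp add: square_integrable_def)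
  have "(G x \<bullet> b)\<^sup>2 \<le> (norm (G x))\<^sup>2 * (norm b)\<^sup>2" for x
    using Cauchy_Schwarz_ineq[of "G x" b] by (simp add: power2_norm_eq_inner)
  then have "integrable M (\<lambda>x. (G x \<bullet> b)\<^sup>2)"
    by (intro Bochner_Integration.integrable_bound[OF int]) simp_all
  then show ?thesis by (simp add: square_integrable_def)
qed

section \<open>Linearity and uniqueness of weak gradients\<close>

lemma has_weak_gradient_add_scaled:
  assumes u: "square_integrable vol u" "has_weak_gradient \<Omega> u G"
    and v: "square_integrable vol v" "has_weak_gradient \<Omega> v H"
  shows "has_weak_gradient \<Omega> (\<lambda>x. u x + c * v x) (\<lambda>x. G x + c *\<^sub>R H x)"
  unfolding has_weak_gradient_def
proof (intro conjI allI impI)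
  have G: "square_integrable vol G" and H: "square_integrable vol H"
    using u v by (auto simp: has_weak_gradient_def)
  then show "square_integrable vol (\<lambda>x. G x + c *\<^sub>R H x)"
    by (intro square_integrable_add square_integrable_scaleR)
  fix \<phi> and b :: 'a assume \<phi>: "test_function \<Omega> \<phi>" and b: "b \<in> Basis"
  note s = test_function_square_integrable(1)[OF \<phi>] test_function_square_integrable(2)[OF \<phi> b]
  have "(LINT x|vol. (u x + c * v x) * iter_deriv [b] \<phi> x)
     = (LINT x|vol. u x * iter_deriv [b] \<phi> x) + c * (LINT x|vol. v x * iter_deriv [b] \<phi> x)"
    using square_integrable_mult[OF u(1) s(2)] square_integrable_mult[OF v(1) s(2)]
    by (simp add: distrib_right mult.assoc del: iter_deriv.simps)
  also have "\<dots> = - (LINT x|vol. (G x \<bullet> b) * \<phi> x) + c * - (LINT x|vol. (H x \<bullet> b) * \<phi> x)"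
    using u(2) v(2) \<phi> b unfolding has_weak_gradient_def by (simp del: iter_deriv.simps)
  also have "\<dots> = - (LINT x|vol. ((G x + c *\<^sub>R H x) \<bullet> b) * \<phi> x)"
    using square_integrable_mult[OF square_integrable_component[OF G] s(1)]
      square_integrable_mult[OF square_integrable_component[OF H] s(1)]
    by (simp add: inner_add_left distrib_right mult.assoc)
  finally show "(LINT x|vol. (u x + c * v x) * iter_deriv [b] \<phi> x)
    = - (LINT x|vol. ((G x + c *\<^sub>R H x) \<bullet> b) * \<phi> x)" .
qed

lemma has_weak_gradient_unique:
  assumes u: "has_weak_gradient \<Omega> u G" "has_weak_gradient \<Omega> u H"
  shows "AE x in vol. G x = H x"
proof -
  have G: "square_integrable vol G" and H: "square_integrable vol H"
    using u by (auto simp: has_weak_gradient_def)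
  have "AE x in vol. (G x - H x) \<bullet> b = 0" if b: "b \<in> Basis" for b
  proof (rule fundamental_lemma)
    show "square_integrable vol (\<lambda>x. (G x - H x) \<bullet> b)"
      by (intro square_integrable_component square_integrable_diff G H)
    fix \<phi> assume \<phi>: "test_function \<Omega> \<phi>"
    have "(LINT x|vol. (G x \<bullet> b) * \<phi> x) = (LINT x|vol. (H x \<bullet> b) * \<phi> x)"
      using u \<phi> b unfolding has_weak_gradient_def by (simp del: iter_deriv.simps)
    then show "(LINT x|vol. ((G x - H x) \<bullet> b) * \<phi> x) = 0"
      using square_integrable_mult[OF square_integrable_component[OF G] test_function_square_integrable(1)[OF \<phi>]]
        square_integrable_mult[OF square_integrable_component[OF H] test_function_square_integrable(1)[OF \<phi>]]
      by (simp add: inner_diff_left left_diff_distrib)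
  qed
  then have "AE x in vol. \<forall>b\<in>Basis. (G x - H x) \<bullet> b = 0"
    by (subst AE_ball_countable) (auto simp: countable_finite)
  then show ?thesis
    by eventually_elim (metis euclidean_all_zero_iff eq_iff_diff_eq_0)
qed

lemma H1_iff: "u \<in> H1 \<Omega> \<longleftrightarrow> square_integrable vol u \<and> has_weak_gradient \<Omega> u (wgrad u)"
  unfolding H1_def weak_grad_def using someI_ex[of "has_weak_gradient \<Omega> u"] by auto

lemma H1_square_integrable:
  assumes "u \<in> H1 \<Omega>"
  shows "square_integrable vol u" "square_integrable vol (wgrad u)"
  using assms unfolding H1_iff has_weak_gradient_def by auto

lemma H1I:
  assumes "square_integrable vol u" "has_weak_gradient \<Omega> u G"
  shows "u \<in> H1 \<Omega>" "AE x in vol. wgrad u x = G x"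
proof -
  show "u \<in> H1 \<Omega>" using assms unfolding H1_def by blast
  then show "AE x in vol. wgrad u x = G x"
    using assms unfolding H1_iff by (blast intro: has_weak_gradient_unique)
qed

lemma H1_add_scaled:
  assumes "u \<in> H1 \<Omega>" "v \<in> H1 \<Omega>"
  shows "(\<lambda>x. u x + c * v x) \<in> H1 \<Omega>"
    "AE x in vol. wgrad (\<lambda>x. u x + c * v x) x = wgrad u x + c *\<^sub>R wgrad v x"
proof -
  have "square_integrable vol (\<lambda>x. u x + c *\<^sub>R v x)"
    using assms unfolding H1_iff by (intro square_integrable_add square_integrable_scaleR) auto
  then have *: "square_integrable vol (\<lambda>x. u x + c * v x)" by simp
  have "has_weak_gradient \<Omega> (\<lambda>x. u x + c * v x) (\<lambda>x. wgrad u x + c *\<^sub>R wgrad v x)"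
    using assms unfolding H1_iff by (intro has_weak_gradient_add_scaled) auto
  from H1I[OF * this] show "(\<lambda>x. u x + c * v x) \<in> H1 \<Omega>"
    "AE x in vol. wgrad (\<lambda>x. u x + c * v x) x = wgrad u x + c *\<^sub>R wgrad v x" .
qed

lemma H1_diff: "u \<in> H1 \<Omega> \<Longrightarrow> v \<in> H1 \<Omega> \<Longrightarrow> (\<lambda>x. u x - v x) \<in> H1 \<Omega>"
  using H1_add_scaled(1)[of u v "-1"] by simp

lemma smooth_in_H1:
  assumes "smooth_on UNIV \<phi>"
  shows "\<phi> \<in> H1 \<Omega>" "AE x in vol. wgrad \<phi> x = grad \<phi> x"
proof -
  have "square_integrable vol \<phi>"
    using smooth_on_UNIV_continuous[OF assms, of "[]"] by (simp add: continuous_square_integrable)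
  from H1I[OF this smooth_has_weak_gradient[OF assms bounded_\<Omega> lebesgue_\<Omega>]]
  show "\<phi> \<in> H1 \<Omega>" "AE x in vol. wgrad \<phi> x = grad \<phi> x" .
qed

text \<open>The Sobolev norm is the \<open>l2norm\<close> of the jet and inherits its triangle
  inequality and completeness. Because \<open>weak_grad\<close> is a choice, jets are linear only
  almost everywhere.\<close>

definition jet :: "('a \<Rightarrow> real) \<Rightarrow> 'a \<Rightarrow> real \<times> 'a" where
  "jet u x = (u x, wgrad u x)"

lemma H1_norm_eq_l2norm: "H1norm u = l2norm vol (jet u)"
  unfolding H1_norm_def l2norm_def jet_def sq_norm_Pair by simp

lemma jet_square_integrable: "u \<in> H1 \<Omega> \<Longrightarrow> square_integrable vol (jet u)"
  unfolding jet_def[abs_def] by (intro square_integrable_Pair H1_square_integrable)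

lemma jet_add_scaled:
  assumes "u \<in> H1 \<Omega>" "v \<in> H1 \<Omega>"
  shows "AE x in vol. jet (\<lambda>x. u x + c * v x) x = jet u x + c *\<^sub>R jet v x"
  using H1_add_scaled(2)[OF assms, of c] by eventually_elim (simp add: jet_def)

lemma H1_norm_add_scaled_eq:
  assumes "u \<in> H1 \<Omega>" "v \<in> H1 \<Omega>"
  shows "H1norm (\<lambda>x. u x + c * v x) = l2norm vol (\<lambda>x. jet u x + c *\<^sub>R jet v x)"
  unfolding H1_norm_eq_l2norm
  using jet_add_scaled[OF assms, of c] jet_square_integrable assms H1_add_scaled(1)[OF assms]
  by (intro l2norm_cong_AE square_integrable_measurable square_integrable_add square_integrable_scaleR) auto

lemma H1_norm_diff_eq:
  assumes "u \<in> H1 \<Omega>" "v \<in> H1 \<Omega>"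
  shows "H1norm (\<lambda>x. u x - v x) = l2norm vol (\<lambda>x. jet u x - jet v x)"
  using H1_norm_add_scaled_eq[OF assms, of "-1"] by simp

lemma H1_norm_nonneg: "0 \<le> H1norm u"
  unfolding H1_norm_eq_l2norm by (rule l2norm_nonneg)

lemma H1_norm_add_scaled_le:
  assumes "u \<in> H1 \<Omega>" "v \<in> H1 \<Omega>"
  shows "H1norm (\<lambda>x. u x + c * v x) \<le> H1norm u + \<bar>c\<bar> * H1norm v"
  unfolding H1_norm_add_scaled_eq[OF assms] H1_norm_eq_l2norm l2norm_scaleR[symmetric]
  by (intro l2norm_triangle square_integrable_scaleR jet_square_integrable assms)

lemma H1_norm_add_le:
  "u \<in> H1 \<Omega> \<Longrightarrow> v \<in> H1 \<Omega> \<Longrightarrow> H1norm (\<lambda>x. u x + v x) \<le> H1norm u + H1norm v"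
  using H1_norm_add_scaled_le[of u v 1] by simp

lemma H1_norm_minus_commute:
  "u \<in> H1 \<Omega> \<Longrightarrow> v \<in> H1 \<Omega> \<Longrightarrow> H1norm (\<lambda>x. u x - v x) = H1norm (\<lambda>x. v x - u x)"
  by (simp only: H1_norm_diff_eq) (rule l2norm_minus_commute)

lemma l2norm_le_H1_norm:
  assumes "u \<in> H1 \<Omega>"
  shows "l2norm vol u \<le> H1norm u" "l2norm vol (wgrad u) \<le> H1norm u"
  unfolding H1_norm_eq_l2norm using assms
  by (auto intro!: l2norm_mono jet_square_integrable H1_square_integrable simp: jet_def norm_Pair
      simp del: real_norm_def)

text \<open>The zero field is a weak gradient of \<open>u\<close>, hence agrees almost everywhere
  with the chosen one. This lets functions that agree almost everywhere be exchanged inside bounded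
  forms.\<close>

lemma H1_norm_zero_AE:
  assumes "u \<in> H1 \<Omega>" "AE x in vol. u x = 0"
  shows "H1norm u = 0"
proof -
  have [measurable]: "u \<in> borel_measurable vol"
    using H1_square_integrable[OF assms(1)] by (simp add: square_integrable_def)
  have "has_weak_gradient \<Omega> u (\<lambda>_. 0)"
    unfolding has_weak_gradient_def
  proof (intro conjI allI impI)
    show "square_integrable vol (\<lambda>_. 0::'a)" by (simp add: square_integrable_def)
    fix \<phi> and b :: 'a assume "test_function \<Omega> \<phi>" "b \<in> Basis"
    then have [measurable]: "iter_deriv [b] \<phi> \<in> borel_measurable vol"
      using test_function_square_integrable(2) square_integrable_measurable by blast
    have "(LINT x|vol. u x * iter_deriv [b] \<phi> x) = (LINT x|vol. 0)"
      using assms(2) by (intro integral_cong_AE) (auto simp del: iter_deriv.simps)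
    then show "(LINT x|vol. u x * iter_deriv [b] \<phi> x) = - (LINT x|vol. (0 \<bullet> b) * \<phi> x)"
      by (simp del: iter_deriv.simps)
  qed
  from H1I(2)[OF H1_square_integrable(1)[OF assms(1)] this]
  have "AE x in vol. jet u x = 0" using assms(2) by eventually_elim (simp add: jet_def zero_prod_def)
  then have "l2norm vol (jet u) = l2norm vol (\<lambda>_. 0 :: real \<times> 'a)"
    using jet_square_integrable[OF assms(1)] by (intro l2norm_cong_AE) (auto simp: square_integrable_def)
  then show ?thesis unfolding H1_norm_eq_l2norm by (simp add: l2norm_def)
qed

text \<open>The jets converge in the mean to some pair. The identity defining a weak gradient
  involves only pairings with fixed square-integrable functions, so it survives the limit and makes
  the second component the weak gradient of the first.\<close>

lemma H1_complete:
  assumes u: "\<And>k. u k \<in> H1 \<Omega>"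
    and cau: "\<And>\<epsilon>. 0 < \<epsilon> \<Longrightarrow> \<exists>N. \<forall>m\<ge>N. \<forall>n\<ge>N. H1norm (\<lambda>x. u m x - u n x) < \<epsilon>"
  obtains v where "v \<in> H1 \<Omega>" "(\<lambda>k. H1norm (\<lambda>x. u k x - v x)) \<longlonglongrightarrow> 0"
proof -
  have cau': "\<exists>N. \<forall>m\<ge>N. \<forall>n\<ge>N. l2norm vol (\<lambda>x. jet (u m) x - jet (u n) x) < \<epsilon>" if "0 < \<epsilon>" for \<epsilon>
    using cau[OF that] H1_norm_diff_eq[OF u u] by simp
  obtain g where g: "square_integrable vol g"
    and lim: "(\<lambda>k. l2norm vol (\<lambda>x. jet (u k) x - g x)) \<longlonglongrightarrow> 0"
    using square_integrable_complete[of vol "\<lambda>k. jet (u k)", OF jet_square_integrable[OF u] cau'] .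
  define v where "v x = fst (g x)" for x
  define G where "G x = snd (g x)" for x
  have v: "square_integrable vol v" and G: "square_integrable vol G"
    using square_integrable_fst_snd[OF g] unfolding v_def[abs_def] G_def[abs_def] by auto
  have jet_diff: "jet (u k) x - g x = (u k x - v x, wgrad (u k) x - G x)" for k x
    by (simp add: jet_def v_def G_def prod_eq_iff)
  \<comment> \<open>General in \<open>F\<close> because it is applied once to the functions and once
    to their gradients; both differences are components of the difference of jets.\<close>
  have limI: "(\<lambda>k. LINT x|vol. F k x \<bullet> h x) \<longlonglongrightarrow> (LINT x|vol. F' x \<bullet> h x)"
    if F: "\<And>k. square_integrable vol (F k)" "square_integrable vol F'" "square_integrable vol h"
      and le: "\<And>k x. norm (F k x - F' x) \<le> norm (jet (u k) x - g x)"
    for F :: "nat \<Rightarrow> 'a \<Rightarrow> 'z::euclidean_space" and F' h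
  proof (rule LIM_zero_cancel, rule Lim_null_comparison)
    show "\<forall>\<^sub>F k in sequentially. norm ((LINT x|vol. F k x \<bullet> h x) - (LINT x|vol. F' x \<bullet> h x))
      \<le> l2norm vol (\<lambda>x. jet (u k) x - g x) * l2norm vol h"
    proof (intro always_eventually allI)
      fix k
      have "(LINT x|vol. F k x \<bullet> h x) - (LINT x|vol. F' x \<bullet> h x) = (LINT x|vol. (F k x - F' x) \<bullet> h x)"
        using square_integrable_inner[OF F(1)[of k] F(3)] square_integrable_inner[OF F(2,3)]
        by (simp add: inner_diff_left)
      moreover have "\<bar>\<dots>\<bar> \<le> l2norm vol (\<lambda>x. F k x - F' x) * l2norm vol h"
        by (intro l2norm_Cauchy_Schwarz square_integrable_diff F)
      moreover have "l2norm vol (\<lambda>x. F k x - F' x) \<le> l2norm vol (\<lambda>x. jet (u k) x - g x)"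
        by (intro l2norm_mono square_integrable_diff F jet_square_integrable u g le)
      then have "l2norm vol (\<lambda>x. F k x - F' x) * l2norm vol h \<le> l2norm vol (\<lambda>x. jet (u k) x - g x) * l2norm vol h"
        by (intro mult_right_mono l2norm_nonneg)
      ultimately show "norm ((LINT x|vol. F k x \<bullet> h x) - (LINT x|vol. F' x \<bullet> h x))
        \<le> l2norm vol (\<lambda>x. jet (u k) x - g x) * l2norm vol h" by simp
    qed
    show "(\<lambda>k. l2norm vol (\<lambda>x. jet (u k) x - g x) * l2norm vol h) \<longlonglongrightarrow> 0"
      using tendsto_mult_left_zero[OF lim] .
  qed
  have "has_weak_gradient \<Omega> v G"
    unfolding has_weak_gradient_def
  proof (intro conjI allI impI G)
    fix \<phi> and b :: 'a assume \<phi>: "test_function \<Omega> \<phi>" and b: "b \<in> Basis"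
    note s = test_function_square_integrable(1)[OF \<phi>] test_function_square_integrable(2)[OF \<phi> b]
    have lim1: "(\<lambda>k. LINT x|vol. u k x \<bullet> iter_deriv [b] \<phi> x) \<longlonglongrightarrow> (LINT x|vol. v x \<bullet> iter_deriv [b] \<phi> x)"
    proof (rule limI)
      show "norm (u k x - v x) \<le> norm (jet (u k) x - g x)" for k x
        unfolding jet_diff by (rule norm_fst_le)
    qed (use H1_square_integrable[OF u] v s in auto)
    have lim2: "(\<lambda>k. LINT x|vol. wgrad (u k) x \<bullet> (\<phi> x *\<^sub>R b)) \<longlonglongrightarrow> (LINT x|vol. G x \<bullet> (\<phi> x *\<^sub>R b))"
    proof (rule limI)
      show "square_integrable vol (\<lambda>x. \<phi> x *\<^sub>R b)"
        using s(1) unfolding square_integrable_def by (auto simp: b power_mult_distrib)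
      show "norm (wgrad (u k) x - G x) \<le> norm (jet (u k) x - g x)" for k x
        unfolding jet_diff by (rule norm_snd_le)
    qed (use H1_square_integrable[OF u] G in auto)
    have eq: "(LINT x|vol. wgrad (u k) x \<bullet> (\<phi> x *\<^sub>R b)) = - (LINT x|vol. u k x \<bullet> iter_deriv [b] \<phi> x)" for k
      using u[of k] \<phi> b unfolding H1_iff has_weak_gradient_def by (simp add: mult.commute del: iter_deriv.simps)
    have "- (LINT x|vol. v x \<bullet> iter_deriv [b] \<phi> x) = (LINT x|vol. G x \<bullet> (\<phi> x *\<^sub>R b))"
      by (rule LIMSEQ_unique[OF tendsto_minus[OF lim1] lim2[unfolded eq]])
    then show "(LINT x|vol. v x * iter_deriv [b] \<phi> x) = - (LINT x|vol. (G x \<bullet> b) * \<phi> x)"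
      by (simp add: mult.commute del: iter_deriv.simps)
  qed
  from H1I[OF v this] have vH: "v \<in> H1 \<Omega>" and gv: "AE x in vol. wgrad v x = G x" by auto
  from gv have "AE x in vol. jet v x = g x" by eventually_elim (simp add: jet_def v_def G_def)
  then have "H1norm (\<lambda>x. u k x - v x) = l2norm vol (\<lambda>x. jet (u k) x - g x)" for k
    unfolding H1_norm_diff_eq[OF u vH]
    by (intro l2norm_cong_AE square_integrable_measurable square_integrable_diff jet_square_integrable u vH g) auto
  then show thesis using that[OF vH] lim by simp
qed

end

section \<open>The Hausdorff measure\<close>

locale metric_outer_measure =
  fixes \<mu> :: "'a::metric_space set \<Rightarrow> ennreal"
  assumes empty: "\<mu> {} = 0"
    and mono: "\<And>A B. A \<subseteq> B \<Longrightarrow> \<mu> A \<le> \<mu> B"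
    and subadd: "\<And>A. \<mu> (\<Union>i::nat. A i) \<le> (\<Sum>i. \<mu> (A i))"
    and separated: "\<And>e A B. 0 < e \<Longrightarrow> (\<And>x y. x \<in> A \<Longrightarrow> y \<in> B \<Longrightarrow> e \<le> dist x y) \<Longrightarrow> \<mu> A + \<mu> B \<le> \<mu> (A \<union> B)"
begin

lemma subadd2: "\<mu> (A \<union> B) \<le> \<mu> A + \<mu> B"
proof -
  have "\<mu> (A \<union> B) = \<mu> (\<Union>i. binaryset A B i)" by (simp add: UN_binaryset_eq)
  also have "\<dots> \<le> (\<Sum>i. \<mu> (binaryset A B i))" by (rule subadd)
  also have "\<dots> = \<mu> A + \<mu> B" using suminf_binaryset_eq[of \<mu> A B] empty by simp
  finally show ?thesis .
qed

text \<open>The first set is split off from the union of all later ones. The induction therefore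
  needs the claim for every tail \<open>{k..}\<close> at once.\<close>

lemma separated_sum_le:
  assumes sep: "\<And>i j::nat. i < j \<Longrightarrow> \<exists>e>0. \<forall>x\<in>R i. \<forall>y\<in>(\<Union>k\<in>{j..}. R k). e \<le> dist x y"
  shows "(\<Sum>i<n. \<mu> (R i)) \<le> \<mu> (\<Union>i. R i)"
proof -
  have "(\<Sum>i<n. \<mu> (R (k + i))) \<le> \<mu> (\<Union>i\<in>{k..}. R i)" for k
  proof (induction n arbitrary: k)
    case (Suc n)
    have "(\<Sum>i<Suc n. \<mu> (R (k + i))) = \<mu> (R k) + (\<Sum>i<n. \<mu> (R (Suc k + i)))"
      by (subst sum.lessThan_Suc_shift) simp
    also have "\<dots> \<le> \<mu> (R k) + \<mu> (\<Union>i\<in>{Suc k..}. R i)" by (intro add_left_mono Suc.IH)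
    also have "\<dots> \<le> \<mu> (R k \<union> (\<Union>i\<in>{Suc k..}. R i))"
    proof -
      obtain e where e: "e > 0" "\<forall>x\<in>R k. \<forall>y\<in>(\<Union>i\<in>{Suc k..}. R i). e \<le> dist x y"
        using sep[of k "Suc k"] by blast
      then show ?thesis by (intro separated[of e]) blast+
    qed
    also have "R k \<union> (\<Union>i\<in>{Suc k..}. R i) = (\<Union>i\<in>{k..}. R i)"
    proof -
      have "{k..} = insert k {Suc k..}" by auto
      then show ?thesis by simp
    qed
    finally show ?case .
  qed simp
  from this[of 0] show ?thesis by simp
qed

text \<open>The sets \<open>D n\<close> exhaust \<open>A - F\<close>; the annuli \<open>R n\<close> between them are separated from each other within
  each parity class, so \<open>\<Sum> \<mu> (R n) \<le> 2 \<mu> A\<close> and the tails of this series vanish.\<close>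

lemma closed_caratheodory:
  assumes F: "closed F" shows "\<mu> (A \<inter> F) + \<mu> (A - F) \<le> \<mu> A"
proof (cases "F = {} \<or> \<mu> A = \<infinity>")
  \<comment> \<open>By convention \<open>infdist\<close> to the empty set is 0, and then the sets
    \<open>D n\<close> would not exhaust \<open>A - F\<close>.\<close>
  case True
  then show ?thesis using empty by auto
next
  case False
  then have F0: "F \<noteq> {}" and fin: "\<mu> A < \<infinity>" by (auto simp: less_top)
  define D where "D n = {x\<in>A. inverse (real (Suc n)) \<le> infdist x F}" for n
  define R where "R n = D (Suc n) - D n" for n
  have Dmono: "D m \<subseteq> D n" if "m \<le> n" for m n
  proof -
    have le: "inverse (real (Suc n)) \<le> inverse (real (Suc m))" using that by (simp add: le_imp_inverse_le)
    show ?thesis unfolding D_def using order_trans[OF le] by blast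
  qed
  have AF: "A - F = (\<Union>n. D n)"
  proof (intro set_eqI iffI)
    fix x assume x: "x \<in> A - F"
    then have "infdist x F > 0" using F F0 by (simp add: infdist_pos_not_in_closed)
    then obtain n where "inverse (real (Suc n)) < infdist x F" using reals_Archimedean by blast
    then show "x \<in> (\<Union>n. D n)" using x less_imp_le unfolding D_def by blast
  next
    fix x assume "x \<in> (\<Union>n. D n)"
    then obtain n where n: "x \<in> A" "inverse (real (Suc n)) \<le> infdist x F" unfolding D_def by blast
    moreover have "0 < inverse (real (Suc n))" by simp
    ultimately have "infdist x F > 0" by linarith
    then show "x \<in> A - F" using n by auto
  qed
  have sepD: "\<exists>e>0. \<forall>x\<in>R i. \<forall>y\<in>(\<Union>k\<in>{j..}. R k). e \<le> dist x y" if "Suc i < j" for i j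
  proof -
    \<comment> \<open>Points of \<open>R i\<close> have distance at least \<open>1 / (i + 2)\<close>
      from \<open>F\<close>, while points of \<open>R k\<close> with \<open>k \<ge> i + 2\<close>
      are closer than \<open>1 / (i + 3)\<close>. Consecutive sets may touch, which is why the
      parities are summed separately.\<close>
    define e where "e = inverse (real (Suc (Suc i))) - inverse (real (Suc (Suc (Suc i))))"
    have "inverse (real (Suc (Suc (Suc i)))) < inverse (real (Suc (Suc i)))"
      by (rule less_imp_inverse_less) auto
    then have "e > 0" unfolding e_def by simp
    moreover have "e \<le> dist x y" if x: "x \<in> R i" and k: "k \<ge> j" "y \<in> R k" for x y k
    proof -
      have "inverse (real (Suc (Suc i))) \<le> infdist x F" using x unfolding R_def D_def by blast
      moreover have "y \<notin> D (Suc (Suc i))"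
        using k \<open>Suc i < j\<close> Dmono[of "Suc (Suc i)" k] unfolding R_def by auto
      then have "infdist y F < inverse (real (Suc (Suc (Suc i))))"
        using k unfolding R_def D_def by auto
      moreover have "infdist x F \<le> infdist y F + dist x y" by (rule infdist_triangle)
      ultimately show ?thesis unfolding e_def by linarith
    qed
    ultimately show ?thesis by blast
  qed
  have even: "(\<Sum>i<n. \<mu> (R (2 * i))) \<le> \<mu> A" and odd: "(\<Sum>i<n. \<mu> (R (2 * i + 1))) \<le> \<mu> A" for n
  proof -
    have sub: "(\<Union>k\<in>{j..}. R (2 * k)) \<subseteq> (\<Union>k\<in>{2*j..}. R k)"
      "(\<Union>k\<in>{j..}. R (2 * k + 1)) \<subseteq> (\<Union>k\<in>{2*j+1..}. R k)" for j
      by (fastforce intro: mult_le_mono2)+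
    have s: "\<exists>e>0. \<forall>x\<in>R (2 * i). \<forall>y\<in>(\<Union>k\<in>{j..}. R (2 * k)). e \<le> dist x y"
      "\<exists>e>0. \<forall>x\<in>R (2 * i + 1). \<forall>y\<in>(\<Union>k\<in>{j..}. R (2 * k + 1)). e \<le> dist x y" if "i < j" for i j
    proof -
      obtain e where e: "e > 0" "\<forall>x\<in>R (2 * i). \<forall>y\<in>(\<Union>k\<in>{2*j..}. R k). e \<le> dist x y"
        using sepD[of "2 * i" "2 * j"] \<open>i < j\<close> by auto
      show "\<exists>e>0. \<forall>x\<in>R (2 * i). \<forall>y\<in>(\<Union>k\<in>{j..}. R (2 * k)). e \<le> dist x y"
        by (intro exI[of _ e] conjI ballI e(1)) (use e(2) sub(1)[of j] in blast)
      obtain e' where e': "e' > 0" "\<forall>x\<in>R (2 * i + 1). \<forall>y\<in>(\<Union>k\<in>{2*j+1..}. R k). e' \<le> dist x y"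
        using sepD[of "2 * i + 1" "2 * j + 1"] \<open>i < j\<close> by auto
      show "\<exists>e>0. \<forall>x\<in>R (2 * i + 1). \<forall>y\<in>(\<Union>k\<in>{j..}. R (2 * k + 1)). e \<le> dist x y"
        by (intro exI[of _ e'] conjI ballI e'(1)) (use e'(2) sub(2)[of j] in blast)
    qed
    have sA: "(\<Union>i. R (2 * i)) \<subseteq> A" "(\<Union>i. R (2 * i + 1)) \<subseteq> A" unfolding R_def D_def by auto
    show "(\<Sum>i<n. \<mu> (R (2 * i))) \<le> \<mu> A"
      by (rule order_trans[OF separated_sum_le[of "\<lambda>i. R (2 * i)", OF s(1)] mono[OF sA(1)]])
    show "(\<Sum>i<n. \<mu> (R (2 * i + 1))) \<le> \<mu> A"
      by (rule order_trans[OF separated_sum_le[of "\<lambda>i. R (2 * i + 1)", OF s(2)] mono[OF sA(2)]])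
  qed
  have summ: "(\<Sum>i<n. \<mu> (R i)) \<le> 2 * \<mu> A" for n
  proof -
    have "(\<Sum>i<n. \<mu> (R i)) \<le> (\<Sum>i<2 * n. \<mu> (R i))" by (intro sum_mono2) auto
    also have "\<dots> = (\<Sum>i<n. \<mu> (R (2 * i))) + (\<Sum>i<n. \<mu> (R (2 * i + 1)))"
      by (induction n) (auto simp: algebra_simps)
    also have "\<dots> \<le> \<mu> A + \<mu> A" by (intro add_mono even odd)
    finally show ?thesis by (simp add: mult_2)
  qed
  define s where "s n = (\<Sum>i. \<mu> (R (n + i)))" for n
  have "(\<Sum>i. \<mu> (R i)) \<le> 2 * \<mu> A" by (intro suminf_le_const summ) auto
  also have "\<dots> < \<infinity>" using fin by (simp add: ennreal_mult_less_top)
  finally have sfin: "(\<Sum>i. \<mu> (R i)) \<noteq> top" by simp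
  have slim: "s \<longlonglongrightarrow> 0"
  proof -
    \<comment> \<open>All terms are finite, so the series can be moved to the reals, where the tails
      of a convergent series tend to 0.\<close>
    have "\<mu> (R i) \<noteq> top" for i using ennreal_suminf_lessD[of "\<lambda>i. \<mu> (R i)" top i] sfin by (auto simp: less_top)
    then have eq: "ennreal (enn2real (\<mu> (R i))) = \<mu> (R i)" for i by (simp add: less_top)
    have sm: "summable (\<lambda>i. enn2real (\<mu> (R i)))"
      using sfin eq by (intro summable_suminf_not_top) auto
    have "(\<lambda>n. \<Sum>i. enn2real (\<mu> (R (i + n)))) \<longlonglongrightarrow> 0"
      using suminf_exist_split2[OF sm] .
    then have "(\<lambda>n. ennreal (\<Sum>i. enn2real (\<mu> (R (i + n))))) \<longlonglongrightarrow> ennreal 0" by (rule tendsto_ennrealI)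
    moreover have "ennreal (\<Sum>i. enn2real (\<mu> (R (i + n)))) = s n" for n
    proof -
      have "(\<Sum>i. ennreal (enn2real (\<mu> (R (i + n))))) = ennreal (\<Sum>i. enn2real (\<mu> (R (i + n))))"
        by (rule suminf_ennreal2[OF enn2real_nonneg summable_ignore_initial_segment[OF sm]])
      then show ?thesis unfolding s_def eq by (simp add: add.commute)
    qed
    ultimately show ?thesis by simp
  qed
  \<comment> \<open>\<open>D n\<close> keeps a positive distance from \<open>F\<close>, so
    additivity applies to \<open>A \<inter> F\<close> and \<open>D n\<close>; what is missing from
    \<open>A - F\<close> costs at most the tail \<open>s n\<close>.\<close>
  have le: "\<mu> (A \<inter> F) + \<mu> (A - F) \<le> \<mu> A + s n" for n
  proof -
    have "A - F \<subseteq> D n \<union> (\<Union>i. R (n + i))"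
    proof
      fix x assume "x \<in> A - F"
      then obtain m where m: "x \<in> D m" unfolding AF by blast
      show "x \<in> D n \<union> (\<Union>i. R (n + i))"
      proof (cases "x \<in> D n")
        case False
        define p where "p = (LEAST p. x \<in> D p)"
        have p: "x \<in> D p" unfolding p_def using m by (rule LeastI)
        have "p > n" using p False Dmono[of p n] by (metis not_le subsetD)
        then obtain j where j: "p = Suc (n + j)" using less_iff_Suc_add by blast
        have "x \<notin> D (n + j)" using not_less_Least[of "n + j" "\<lambda>p. x \<in> D p"] j unfolding p_def by auto
        then show ?thesis using p j unfolding R_def by auto
      qed simp
    qed
    then have "\<mu> (A - F) \<le> \<mu> (D n \<union> (\<Union>i. R (n + i)))" by (rule mono)
    also have "\<dots> \<le> \<mu> (D n) + \<mu> (\<Union>i. R (n + i))" by (rule subadd2)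
    also have "\<dots> \<le> \<mu> (D n) + s n" unfolding s_def by (intro add_left_mono subadd)
    finally have "\<mu> (A \<inter> F) + \<mu> (A - F) \<le> \<mu> (A \<inter> F) + \<mu> (D n) + s n"
      by (simp add: add.assoc add_left_mono)
    also have "\<mu> (A \<inter> F) + \<mu> (D n) \<le> \<mu> ((A \<inter> F) \<union> D n)"
    proof (rule separated[of "inverse (real (Suc n))"])
      fix x y assume "x \<in> A \<inter> F" "y \<in> D n"
      then have "inverse (real (Suc n)) \<le> infdist y F" "x \<in> F" unfolding D_def by auto
      moreover have "infdist y F \<le> dist y x" using \<open>x \<in> F\<close> by (rule infdist_le)
      ultimately show "inverse (real (Suc n)) \<le> dist x y" by (simp add: dist_commute)
    qed simp
    also have "\<dots> \<le> \<mu> A" by (rule mono) (auto simp: D_def)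
    finally show ?thesis by (simp add: add_right_mono)
  qed
  have "(\<lambda>n. \<mu> A + s n) \<longlonglongrightarrow> \<mu> A + 0" by (intro tendsto_intros slim)
  then show ?thesis using le by (intro LIMSEQ_le_const[of "\<lambda>n. \<mu> A + s n"]) auto
qed

text \<open>The Caratheodory measurable sets form a sigma-algebra that contains the closed sets and
  hence the Borel sets; the measure obtained there is restricted to them.\<close>

lemma measure_space_borel: "measure_space UNIV (sets borel) \<mu>"
proof -
  interpret P: sigma_algebra UNIV "Pow UNIV :: 'a set set" by (rule sigma_algebra_Pow)
  have "outer_measure_space (Pow UNIV) \<mu>"
    unfolding outer_measure_space_def positive_def increasing_def countably_subadditive_def
    using empty mono subadd by auto
  then have ms: "measure_space UNIV (lambda_system UNIV (Pow UNIV) \<mu>) \<mu>"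
    by (rule P.caratheodory_lemma)
  then have sa: "sigma_algebra UNIV (lambda_system UNIV (Pow UNIV) \<mu>)" by (simp add: measure_space_def)
  have "F \<in> lambda_system UNIV (Pow UNIV) \<mu>" if "closed F" for F
  proof -
    have "\<mu> (A \<inter> F) + \<mu> (A - F) = \<mu> A" for A
    proof (rule antisym)
      show "\<mu> (A \<inter> F) + \<mu> (A - F) \<le> \<mu> A" by (rule closed_caratheodory[OF that])
      have "\<mu> A = \<mu> ((A \<inter> F) \<union> (A - F))" by (simp add: Int_Diff_Un)
      also have "\<dots> \<le> \<mu> (A \<inter> F) + \<mu> (A - F)" by (rule subadd2)
      finally show "\<mu> A \<le> \<mu> (A \<inter> F) + \<mu> (A - F)" .
    qed
    then show ?thesis unfolding P.lambda_system_eq by simp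
  qed
  then have "sigma_sets UNIV {F. closed F} \<subseteq> lambda_system UNIV (Pow UNIV) \<mu>"
    by (intro sigma_algebra.sigma_sets_subset[OF sa]) auto
  moreover have "sets borel = sigma_sets UNIV {F :: 'a set. closed F}" by (simp add: borel_eq_closed)
  moreover have "sigma_algebra UNIV (sets (borel :: 'a measure))" using sets.sigma_algebra_axioms[of borel] by simp
  ultimately show ?thesis using measure_down[OF ms] by simp
qed

end

section \<open>Hausdorff contents and the Hausdorff measure\<close>

definition hausdorff_content :: "nat \<Rightarrow> real \<Rightarrow> 'a::euclidean_space set \<Rightarrow> ennreal" where
  "hausdorff_content s \<delta> A = (INF C\<in>{C::nat \<Rightarrow> 'a set. A \<subseteq> (\<Union>i. C i) \<and> (\<forall>i. bounded (C i) \<and> diameter (C i) \<le> \<delta>)}.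
       \<Sum>i. ennreal (unit_ball_vol (real s) * (diameter (C i) / 2) ^ s))"

lemma hausdorff_outer_eq: "hausdorff_outer s A = (SUP \<delta>\<in>{0<..}. hausdorff_content s \<delta> A)"
  unfolding hausdorff_outer_def hausdorff_content_def ..

lemma hausdorff_content_lower:
  assumes "A \<subseteq> (\<Union>i. C i)" "\<And>i. bounded (C i)" "\<And>i. diameter (C i) \<le> \<delta>"
  shows "hausdorff_content s \<delta> A \<le> (\<Sum>i::nat. ennreal (unit_ball_vol (real s) * (diameter (C i) / 2) ^ s))"
  unfolding hausdorff_content_def by (rule INF_lower) (use assms in auto)

lemma hausdorff_content_antimono:
  assumes "\<delta> \<le> \<delta>'" shows "hausdorff_content s \<delta>' A \<le> hausdorff_content s \<delta> A"
  unfolding hausdorff_content_def by (rule INF_superset_mono) (use assms in \<open>auto intro: order_trans\<close>)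

lemma hausdorff_content_le_outer: "0 < \<delta> \<Longrightarrow> hausdorff_content s \<delta> A \<le> hausdorff_outer s A"
  unfolding hausdorff_outer_eq by (rule SUP_upper) simp

lemma hausdorff_content_empty:
  assumes "0 < s" "0 < \<delta>" shows "hausdorff_content s \<delta> {} = 0"
proof -
  have "hausdorff_content s \<delta> ({} :: 'a set)
    \<le> (\<Sum>i::nat. ennreal (unit_ball_vol (real s) * (diameter ({}::'a set) / 2) ^ s))"
    by (rule hausdorff_content_lower) (use assms in auto)
  also have "\<dots> = 0" using assms by (simp add: zero_power)
  finally show ?thesis by simp
qed

lemma hausdorff_content_mono: "A \<subseteq> B \<Longrightarrow> hausdorff_content s \<delta> A \<le> hausdorff_content s \<delta> B"
  unfolding hausdorff_content_def by (rule INF_superset_mono) auto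

text \<open>Covers that are optimal up to \<open>e * (1/2)^Suc n\<close> are chosen for each
  \<open>A n\<close> and merged into one sequence by a pairing of the natural numbers; the errors
  add up to \<open>e\<close>.\<close>

lemma hausdorff_content_countable_subadd:
  "hausdorff_content s \<delta> (\<Union>n. A n) \<le> (\<Sum>n. hausdorff_content s \<delta> (A n))"
proof (rule ennreal_le_epsilon)
  fix e :: real assume fin: "(\<Sum>n. hausdorff_content s \<delta> (A n)) < top" and e: "0 < e"
  define g where "g C = ennreal (unit_ball_vol (real s) * (diameter C / 2) ^ s)" for C :: "'a set"
  have "\<exists>C. A n \<subseteq> (\<Union>i. C i) \<and> (\<forall>i. bounded (C i) \<and> diameter (C i) \<le> \<delta>)
    \<and> (\<Sum>i::nat. g (C i)) \<le> hausdorff_content s \<delta> (A n) + ennreal (e * (1/2)^Suc n)" for n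
  proof -
    have "hausdorff_content s \<delta> (A n) < top" by (rule ennreal_suminf_lessD[OF fin])
    then have "hausdorff_content s \<delta> (A n) < hausdorff_content s \<delta> (A n) + ennreal (e * (1/2)^Suc n)"
      using e by simp
    then show ?thesis
      by (subst (asm) (1) hausdorff_content_def) (auto simp: INF_less_iff g_def intro!: less_imp_le)
  qed
  then obtain C where C: "\<And>n. A n \<subseteq> (\<Union>i. C n i)" "\<And>n i. bounded (C n i)" "\<And>n i. diameter (C n i) \<le> \<delta>"
    "\<And>n. (\<Sum>i::nat. g (C n i)) \<le> hausdorff_content s \<delta> (A n) + ennreal (e * (1/2)^Suc n)"
    by metis
  define K where "K j = case_prod C (prod_decode j)" for j
  have "(\<Union>n. A n) \<subseteq> (\<Union>j. K j)"
  proof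
    fix x assume "x \<in> (\<Union>n. A n)"
    then obtain n i where "x \<in> C n i" using C(1) by blast
    then have "x \<in> K (prod_encode (n, i))" unfolding K_def by simp
    then show "x \<in> (\<Union>j. K j)" by blast
  qed
  then have "hausdorff_content s \<delta> (\<Union>n. A n) \<le> (\<Sum>j. g (K j))"
    unfolding g_def by (rule hausdorff_content_lower) (use C in \<open>auto simp: K_def split: prod.split\<close>)
  also have "\<dots> = (\<Sum>j. (\<lambda>(n, i). g (C n i)) (prod_decode j))"
    by (simp add: K_def split_beta)
  also have "\<dots> = (\<Sum>n. \<Sum>i. g (C n i))" by (rule suminf_ennreal_2dimen) simp
  also have "\<dots> \<le> (\<Sum>n. hausdorff_content s \<delta> (A n) + ennreal (e * (1/2)^Suc n))"
    by (intro suminf_le C) auto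
  also have "\<dots> = (\<Sum>n. hausdorff_content s \<delta> (A n)) + (\<Sum>n. ennreal (e * (1/2)^Suc n))"
    by (rule suminf_add[symmetric]) auto
  also have "(\<Sum>n. ennreal (e * (1/2)^Suc n)) = ennreal e"
    using e sums_mult[OF power_half_series, of e] by (intro suminf_ennreal_eq) auto
  finally show "hausdorff_content s \<delta> (\<Union>n. A n) \<le> (\<Sum>n. hausdorff_content s \<delta> (A n)) + ennreal e" .
qed

text \<open>A set of diameter less than \<open>e\<close> cannot meet both \<open>A\<close> and
  \<open>B\<close>, so every cover of the union splits into a cover of \<open>A\<close> and a cover
  of \<open>B\<close> without sharing members.\<close>

lemma hausdorff_content_separated:
  assumes s: "0 < s" and \<delta>: "0 < \<delta>" "\<delta> < e" and sep: "\<And>x y. x \<in> A \<Longrightarrow> y \<in> B \<Longrightarrow> e \<le> dist x y"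
  shows "hausdorff_content s \<delta> A + hausdorff_content s \<delta> B \<le> hausdorff_content s \<delta> (A \<union> B)"
  unfolding hausdorff_content_def[of s \<delta> "A \<union> B"]
proof (rule INF_greatest)
  fix C :: "nat \<Rightarrow> 'a set"
  assume "C \<in> {C. A \<union> B \<subseteq> (\<Union>i. C i) \<and> (\<forall>i. bounded (C i) \<and> diameter (C i) \<le> \<delta>)}"
  then have C: "A \<union> B \<subseteq> (\<Union>i. C i)" "\<And>i. bounded (C i)" "\<And>i. diameter (C i) \<le> \<delta>" by auto
  define g where "g C = ennreal (unit_ball_vol (real s) * (diameter C / 2) ^ s)" for C :: "'a set"
  have g0: "g {} = 0" using s by (simp add: g_def)
  \<comment> \<open>Members that miss \<open>A\<close> become empty sets, which weigh nothing for
    \<open>s > 0\<close>; the cover thus remains a sequence.\<close>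
  define CA where "CA i = (if C i \<inter> A = {} then {} else C i)" for i
  define CB where "CB i = (if C i \<inter> B = {} then {} else C i)" for i
  have "hausdorff_content s \<delta> A \<le> (\<Sum>i. g (CA i))"
    unfolding g_def by (rule hausdorff_content_lower) (use C \<delta> in \<open>fastforce simp: CA_def\<close>)+
  moreover have "hausdorff_content s \<delta> B \<le> (\<Sum>i. g (CB i))"
    unfolding g_def by (rule hausdorff_content_lower) (use C \<delta> in \<open>fastforce simp: CB_def\<close>)+
  ultimately have "hausdorff_content s \<delta> A + hausdorff_content s \<delta> B \<le> (\<Sum>i. g (CA i)) + (\<Sum>i. g (CB i))"
    by (rule add_mono)
  also have "\<dots> = (\<Sum>i. g (CA i) + g (CB i))" by (rule suminf_add) auto
  also have "\<dots> \<le> (\<Sum>i. g (C i))"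
  proof (rule suminf_le)
    fix i
    have "C i \<inter> A = {} \<or> C i \<inter> B = {}"
    proof (rule ccontr)
      assume "\<not> ?thesis"
      then obtain x y where "x \<in> C i" "x \<in> A" "y \<in> C i" "y \<in> B" by blast
      then have "e \<le> dist x y" "dist x y \<le> diameter (C i)"
        using sep diameter_bounded_bound[OF C(2)] by auto
      then show False using C(3)[of i] \<delta> by simp
    qed
    then show "g (CA i) + g (CB i) \<le> g (C i)" unfolding CA_def CB_def using g0 by auto
  qed auto
  finally show "hausdorff_content s \<delta> A + hausdorff_content s \<delta> B
    \<le> (\<Sum>i. ennreal (unit_ball_vol (real s) * (diameter (C i) / 2) ^ s))" unfolding g_def .
qed

text \<open>Each property is available at a fixed scale and passes to the supremum over scales. For
  separated sets this requires scales below the separation \<open>e\<close>, and it is enough to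
  consider those, since contents grow as the scale shrinks.\<close>

lemma hausdorff_metric_outer_measure:
  assumes s: "0 < s" shows "metric_outer_measure (hausdorff_outer s :: 'a::euclidean_space set \<Rightarrow> ennreal)"
proof
  show "hausdorff_outer s ({}::'a set) = 0"
  proof -
    have "hausdorff_outer s ({}::'a set) = (SUP \<delta>\<in>{0::real<..}. 0)"
      unfolding hausdorff_outer_eq by (intro SUP_cong refl hausdorff_content_empty s) simp
    then show ?thesis by simp
  qed
  show "hausdorff_outer s A \<le> hausdorff_outer s B" if "A \<subseteq> B" for A B :: "'a set"
    unfolding hausdorff_outer_eq by (intro SUP_mono) (use hausdorff_content_mono[OF that] in blast)
  show "hausdorff_outer s (\<Union>i. A i) \<le> (\<Sum>i. hausdorff_outer s (A i))" for A :: "nat \<Rightarrow> 'a set"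
    unfolding hausdorff_outer_eq[of s "\<Union>i. A i"]
  proof (rule SUP_least)
    fix \<delta> :: real assume "\<delta> \<in> {0<..}"
    then have "(\<Sum>i. hausdorff_content s \<delta> (A i)) \<le> (\<Sum>i. hausdorff_outer s (A i))"
      by (intro suminf_le hausdorff_content_le_outer) auto
    then show "hausdorff_content s \<delta> (\<Union>i. A i) \<le> (\<Sum>i. hausdorff_outer s (A i))"
      using hausdorff_content_countable_subadd order_trans by blast
  qed
  show "hausdorff_outer s A + hausdorff_outer s B \<le> hausdorff_outer s (A \<union> B)"
    if e: "0 < e" and sep: "\<And>x y. x \<in> A \<Longrightarrow> y \<in> B \<Longrightarrow> e \<le> dist x y" for e and A B :: "'a set"
  proof -
    \<comment> \<open>Sum and supremum commute because two scales are dominated by their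
      minimum.\<close>
    have "hausdorff_outer s A + hausdorff_outer s B = (SUP \<delta>\<in>{0<..}. hausdorff_content s \<delta> A + hausdorff_content s \<delta> B)"
      unfolding hausdorff_outer_eq
    proof (rule SUP_add_directed_ennreal[symmetric])
      fix i j :: real assume "i \<in> {0<..}" "j \<in> {0<..}"
      then show "\<exists>k\<in>{0<..}. hausdorff_content s i A + hausdorff_content s j B \<le> hausdorff_content s k A + hausdorff_content s k B"
        by (intro bexI[of _ "min i j"] add_mono hausdorff_content_antimono) auto
    qed
    also have "\<dots> \<le> hausdorff_outer s (A \<union> B)"
    proof (rule SUP_least)
      fix \<delta> :: real assume \<delta>: "\<delta> \<in> {0<..}"
      define \<eta> where "\<eta> = min \<delta> (e / 2)"
      have \<eta>: "0 < \<eta>" "\<eta> < e" "\<eta> \<le> \<delta>" using \<delta> e by (auto simp: \<eta>_def min_def)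
      have "hausdorff_content s \<delta> A + hausdorff_content s \<delta> B \<le> hausdorff_content s \<eta> A + hausdorff_content s \<eta> B"
        by (intro add_mono hausdorff_content_antimono \<eta>)
      also have "\<dots> \<le> hausdorff_content s \<eta> (A \<union> B)"
        by (rule hausdorff_content_separated[OF s \<eta>(1,2) sep])
      also have "\<dots> \<le> hausdorff_outer s (A \<union> B)" by (rule hausdorff_content_le_outer[OF \<eta>(1)])
      finally show "hausdorff_content s \<delta> A + hausdorff_content s \<delta> B \<le> hausdorff_outer s (A \<union> B)" .
    qed
    finally show ?thesis .
  qed
qed

lemma sets_hausdorff_measure[measurable_cong]: "sets (hausdorff_measure s) = sets borel"
  unfolding hausdorff_measure_def using sets.sigma_sets_eq[of borel] by (simp add: sets_measure_of_conv)

text \<open>\<open>measure_of\<close> takes the prescribed values only if these form a measure on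
  the sigma-algebra. This is the point where Caratheodory's criterion is needed to make the surface
  measure meaningful.\<close>

lemma emeasure_hausdorff_measure:
  assumes "0 < s" "A \<in> sets borel"
  shows "emeasure (hausdorff_measure s) A = hausdorff_outer s A"
proof (rule emeasure_measure_of[OF hausdorff_measure_def])
  interpret metric_outer_measure "hausdorff_outer s :: 'a set \<Rightarrow> ennreal"
    by (rule hausdorff_metric_outer_measure[OF assms(1)])
  show "positive (sets (hausdorff_measure s)) (hausdorff_outer s :: 'a set \<Rightarrow> ennreal)"
    "countably_additive (sets (hausdorff_measure s)) (hausdorff_outer s :: 'a set \<Rightarrow> ennreal)"
    using measure_space_borel unfolding measure_space_def sets_hausdorff_measure by auto
qed (use assms in \<open>auto simp: sets_hausdorff_measure\<close>)

section \<open>Traces and Dirichlet-to-Neumann maps\<close>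

lemma sets_surface_measure: "sets (surface_measure \<Omega>) = sets (restrict_space borel (frontier \<Omega>))"
  unfolding surface_measure_def sets_restrict_space sets_hausdorff_measure ..

lemma continuous_borel_measurable_surface:
  fixes g :: "'a::euclidean_space \<Rightarrow> 'b::topological_space"
  assumes "continuous_on UNIV g"
  shows "g \<in> borel_measurable (surface_measure \<Omega>)"
  using borel_measurable_continuous_onI[OF assms] measurable_restrict_space1 sets_surface_measure
  by (metis measurable_cong_sets)

context bounded_open_set
begin

abbreviation surf :: "'a measure" where "surf \<equiv> surface_measure \<Omega>"

section \<open>Linearity of traces and closedness of the zero-trace space\<close>

lemma has_trace_H1: "has_trace \<Omega> u f \<Longrightarrow> u \<in> H1 \<Omega>"
  unfolding has_trace_def by simp

lemma has_trace_add_scaled: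
  assumes "has_trace \<Omega> u f" "has_trace \<Omega> v g"
  shows "has_trace \<Omega> (\<lambda>x. u x + c * v x) (\<lambda>x. f x + c * g x)"
proof -
  obtain \<phi> where \<phi>: "\<And>k. smooth_on UNIV (\<phi> k)" "(\<lambda>k. H1norm (\<lambda>x. u x - \<phi> k x)) \<longlonglongrightarrow> 0"
    "(\<lambda>k. \<integral>\<^sup>+x. ennreal ((f x - \<phi> k x)\<^sup>2) \<partial>surf) \<longlonglongrightarrow> 0"
    using assms(1) unfolding has_trace_def by blast
  obtain \<psi> where \<psi>: "\<And>k. smooth_on UNIV (\<psi> k)" "(\<lambda>k. H1norm (\<lambda>x. v x - \<psi> k x)) \<longlonglongrightarrow> 0"
    "(\<lambda>k. \<integral>\<^sup>+x. ennreal ((g x - \<psi> k x)\<^sup>2) \<partial>surf) \<longlonglongrightarrow> 0"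
    using assms(2) unfolding has_trace_def by blast
  have H: "u \<in> H1 \<Omega>" "v \<in> H1 \<Omega>" and f: "square_integrable surf f" and g: "square_integrable surf g"
    using assms unfolding has_trace_def by auto
  have sm: "smooth_on UNIV (\<lambda>x. \<phi> k x + c * \<psi> k x)" for k
    by (intro smooth_on_UNIV_add_scaled \<phi> \<psi>)
  have "(\<lambda>k. H1norm (\<lambda>x. u x + c * v x - (\<phi> k x + c * \<psi> k x))) \<longlonglongrightarrow> 0"
  proof (rule tendsto_sandwich[where f = "\<lambda>_. 0"])
    show "\<forall>\<^sub>F k in sequentially. H1norm (\<lambda>x. u x + c * v x - (\<phi> k x + c * \<psi> k x))
      \<le> H1norm (\<lambda>x. u x - \<phi> k x) + \<bar>c\<bar> * H1norm (\<lambda>x. v x - \<psi> k x)"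
    proof (intro always_eventually allI)
      fix k
      have eq: "(\<lambda>x. u x + c * v x - (\<phi> k x + c * \<psi> k x)) = (\<lambda>x. (u x - \<phi> k x) + c * (v x - \<psi> k x))"
        by (simp add: algebra_simps)
      show "H1norm (\<lambda>x. u x + c * v x - (\<phi> k x + c * \<psi> k x))
      \<le> H1norm (\<lambda>x. u x - \<phi> k x) + \<bar>c\<bar> * H1norm (\<lambda>x. v x - \<psi> k x)"
        unfolding eq by (intro H1_norm_add_scaled_le H1_diff H smooth_in_H1 \<phi>(1) \<psi>(1))
    qed
    have "(\<lambda>k. H1norm (\<lambda>x. u x - \<phi> k x) + \<bar>c\<bar> * H1norm (\<lambda>x. v x - \<psi> k x)) \<longlonglongrightarrow> 0 + \<bar>c\<bar> * 0"
      by (intro tendsto_intros \<phi>(2) \<psi>(2))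
    then show "(\<lambda>k. H1norm (\<lambda>x. u x - \<phi> k x) + \<bar>c\<bar> * H1norm (\<lambda>x. v x - \<psi> k x)) \<longlonglongrightarrow> 0" by simp
  qed (auto simp: H1_norm_nonneg)
  moreover have "(\<lambda>k. \<integral>\<^sup>+x. ennreal ((f x + c * g x - (\<phi> k x + c * \<psi> k x))\<^sup>2) \<partial>surf) \<longlonglongrightarrow> 0"
  proof (rule tendsto_sandwich[where f = "\<lambda>_. 0"])
    have [measurable]: "f \<in> borel_measurable surf" "g \<in> borel_measurable surf"
      using f g by (auto simp: square_integrable_def)
    have [measurable]: "\<phi> k \<in> borel_measurable surf" "\<psi> k \<in> borel_measurable surf" for k
      using smooth_on_UNIV_continuous[OF \<phi>(1), of "[]"] smooth_on_UNIV_continuous[OF \<psi>(1), of "[]"]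
      by (auto intro: continuous_borel_measurable_surface)
    \<comment> \<open>The surface integrals are extended-valued, so the pointwise bound
      \<open>norm_add_square_le\<close> takes the place of the triangle inequality.\<close>
    show "\<forall>\<^sub>F k in sequentially. (\<integral>\<^sup>+x. ennreal ((f x + c * g x - (\<phi> k x + c * \<psi> k x))\<^sup>2) \<partial>surf)
      \<le> ennreal 2 * (\<integral>\<^sup>+x. ennreal ((f x - \<phi> k x)\<^sup>2) \<partial>surf)
         + ennreal (2 * c\<^sup>2) * (\<integral>\<^sup>+x. ennreal ((g x - \<psi> k x)\<^sup>2) \<partial>surf)"
    proof (intro always_eventually allI)
      fix k
      have "(f x + c * g x - (\<phi> k x + c * \<psi> k x))\<^sup>2 \<le> 2 * (f x - \<phi> k x)\<^sup>2 + 2 * c\<^sup>2 * (g x - \<psi> k x)\<^sup>2" for x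
      proof -
        have eq: "f x + c * g x - (\<phi> k x + c * \<psi> k x) = (f x - \<phi> k x) + c * (g x - \<psi> k x)"
          by (simp add: algebra_simps)
        show ?thesis unfolding eq
          using norm_add_square_le[of "f x - \<phi> k x" "c * (g x - \<psi> k x)"] by (simp add: power_mult_distrib)
      qed
      then have "ennreal ((f x + c * g x - (\<phi> k x + c * \<psi> k x))\<^sup>2)
        \<le> ennreal 2 * ennreal ((f x - \<phi> k x)\<^sup>2) + ennreal (2 * c\<^sup>2) * ennreal ((g x - \<psi> k x)\<^sup>2)" for x
        by (subst (1 2) ennreal_mult[symmetric], simp_all add: ennreal_plus[symmetric] del: ennreal_plus)
      then have "(\<integral>\<^sup>+x. ennreal ((f x + c * g x - (\<phi> k x + c * \<psi> k x))\<^sup>2) \<partial>surf)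
        \<le> (\<integral>\<^sup>+x. ennreal 2 * ennreal ((f x - \<phi> k x)\<^sup>2) + ennreal (2 * c\<^sup>2) * ennreal ((g x - \<psi> k x)\<^sup>2) \<partial>surf)"
        by (intro nn_integral_mono)
      also have "\<dots> = ennreal 2 * (\<integral>\<^sup>+x. ennreal ((f x - \<phi> k x)\<^sup>2) \<partial>surf)
         + ennreal (2 * c\<^sup>2) * (\<integral>\<^sup>+x. ennreal ((g x - \<psi> k x)\<^sup>2) \<partial>surf)"
        by (subst nn_integral_add, measurable, subst (1 2) nn_integral_cmult, auto)
      finally show "(\<integral>\<^sup>+x. ennreal ((f x + c * g x - (\<phi> k x + c * \<psi> k x))\<^sup>2) \<partial>surf)
        \<le> ennreal 2 * (\<integral>\<^sup>+x. ennreal ((f x - \<phi> k x)\<^sup>2) \<partial>surf)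
         + ennreal (2 * c\<^sup>2) * (\<integral>\<^sup>+x. ennreal ((g x - \<psi> k x)\<^sup>2) \<partial>surf)" .
    qed
    have "(\<lambda>k. ennreal 2 * (\<integral>\<^sup>+x. ennreal ((f x - \<phi> k x)\<^sup>2) \<partial>surf)
         + ennreal (2 * c\<^sup>2) * (\<integral>\<^sup>+x. ennreal ((g x - \<psi> k x)\<^sup>2) \<partial>surf)) \<longlonglongrightarrow> ennreal 2 * 0 + ennreal (2 * c\<^sup>2) * 0"
      by (intro tendsto_add tendsto_mult_ennreal tendsto_const \<phi>(3) \<psi>(3)) auto
    then show "(\<lambda>k. ennreal 2 * (\<integral>\<^sup>+x. ennreal ((f x - \<phi> k x)\<^sup>2) \<partial>surf)
         + ennreal (2 * c\<^sup>2) * (\<integral>\<^sup>+x. ennreal ((g x - \<psi> k x)\<^sup>2) \<partial>surf)) \<longlonglongrightarrow> 0" by simp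
  qed auto
  moreover have "square_integrable surf (\<lambda>x. f x + c * g x)"
    using square_integrable_add[OF f square_integrable_scaleR[OF g, of c]] by simp
  ultimately show ?thesis
    using H1_add_scaled(1)[OF H] sm unfolding has_trace_def
    by (intro conjI exI[of _ "\<lambda>k x. \<phi> k x + c * \<psi> k x"]) auto
qed

lemma has_trace_diff:
  "has_trace \<Omega> u f \<Longrightarrow> has_trace \<Omega> v g \<Longrightarrow> has_trace \<Omega> (\<lambda>x. u x - v x) (\<lambda>x. f x - g x)"
  using has_trace_add_scaled[of u f v g "-1"] by simp

lemma has_trace_add:
  "has_trace \<Omega> u f \<Longrightarrow> has_trace \<Omega> v g \<Longrightarrow> has_trace \<Omega> (\<lambda>x. u x + v x) (\<lambda>x. f x + g x)"
  using has_trace_add_scaled[of u f v g 1] by simp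

lemma H1_0_add_scaled:
  "u \<in> H1_0 \<Omega> \<Longrightarrow> v \<in> H1_0 \<Omega> \<Longrightarrow> (\<lambda>x. u x + c * v x) \<in> H1_0 \<Omega>"
  using has_trace_add_scaled[of u "\<lambda>_. 0" v "\<lambda>_. 0" c] unfolding H1_0_def by simp

lemma H1_0_H1: "u \<in> H1_0 \<Omega> \<Longrightarrow> u \<in> H1 \<Omega>"
  unfolding H1_0_def has_trace_def by simp

lemma has_trace_add_H1_0:
  "has_trace \<Omega> u f \<Longrightarrow> v \<in> H1_0 \<Omega> \<Longrightarrow> has_trace \<Omega> (\<lambda>x. u x + v x) f"
  using has_trace_add[of u f v "\<lambda>_. 0"] unfolding H1_0_def by simp

lemma has_trace_same_diff:
  "has_trace \<Omega> u f \<Longrightarrow> has_trace \<Omega> v f \<Longrightarrow> (\<lambda>x. u x - v x) \<in> H1_0 \<Omega>"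
  using has_trace_diff[of u f v f] unfolding H1_0_def by simp

text \<open>A diagonal argument: some \<open>u k\<close> is close to \<open>v\<close>, and a smooth
  function from its own approximating sequence is close to it in the Sobolev norm while having small
  boundary values.\<close>

lemma H1_0_closed:
  assumes u: "\<And>k. u k \<in> H1_0 \<Omega>" and v: "v \<in> H1 \<Omega>"
    and lim: "(\<lambda>k. H1norm (\<lambda>x. u k x - v x)) \<longlonglongrightarrow> 0"
  shows "v \<in> H1_0 \<Omega>"
proof -
  have "\<exists>\<phi>. smooth_on UNIV \<phi> \<and> H1norm (\<lambda>x. v x - \<phi> x) \<le> 2 * \<epsilon> \<and>
     (\<integral>\<^sup>+x. ennreal ((0 - \<phi> x)\<^sup>2) \<partial>surf) \<le> ennreal \<epsilon>" if "0 < \<epsilon>" for \<epsilon>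
  proof -
    have "\<forall>\<^sub>F k in sequentially. H1norm (\<lambda>x. u k x - v x) < \<epsilon>"
      by (rule order_tendstoD(2)[OF lim that])
    then obtain k where k: "H1norm (\<lambda>x. u k x - v x) < \<epsilon>"
      using eventually_happens'[OF sequentially_bot] by blast
    obtain \<phi> where \<phi>: "\<And>j. smooth_on UNIV (\<phi> j)" "(\<lambda>j. H1norm (\<lambda>x. u k x - \<phi> j x)) \<longlonglongrightarrow> 0"
      "(\<lambda>j. \<integral>\<^sup>+x. ennreal ((0 - \<phi> j x)\<^sup>2) \<partial>surf) \<longlonglongrightarrow> 0"
      using u[of k] unfolding H1_0_def has_trace_def by blast
    have "0 < ennreal \<epsilon>" using that by simp
    have "\<forall>\<^sub>F j in sequentially. H1norm (\<lambda>x. u k x - \<phi> j x) < \<epsilon> \<and> (\<integral>\<^sup>+x. ennreal ((0 - \<phi> j x)\<^sup>2) \<partial>surf) < ennreal \<epsilon>"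
      by (intro eventually_conj order_tendstoD(2)[OF \<phi>(2) that] order_tendstoD(2)[OF \<phi>(3) \<open>0 < ennreal \<epsilon>\<close>])
    then obtain j where j: "H1norm (\<lambda>x. u k x - \<phi> j x) < \<epsilon>" "(\<integral>\<^sup>+x. ennreal ((0 - \<phi> j x)\<^sup>2) \<partial>surf) < ennreal \<epsilon>"
      using eventually_happens'[OF sequentially_bot] by blast
    have uk: "u k \<in> H1 \<Omega>" and p: "\<phi> j \<in> H1 \<Omega>" using H1_0_H1[OF u] smooth_in_H1[OF \<phi>(1)] by auto
    have "H1norm (\<lambda>x. v x - \<phi> j x) = H1norm (\<lambda>x. (v x - u k x) + (u k x - \<phi> j x))" by simp
    also have "\<dots> \<le> H1norm (\<lambda>x. v x - u k x) + H1norm (\<lambda>x. u k x - \<phi> j x)"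
      by (intro H1_norm_add_le H1_diff v uk p)
    also have "\<dots> \<le> 2 * \<epsilon>" using k j H1_norm_minus_commute[OF v uk] by simp
    finally show ?thesis using j \<phi>(1) by (intro exI[of _ "\<phi> j"]) auto
  qed
  then have "\<forall>n. \<exists>\<phi>. smooth_on UNIV \<phi> \<and> H1norm (\<lambda>x. v x - \<phi> x) \<le> 2 * inverse (real (Suc n)) \<and>
     (\<integral>\<^sup>+x. ennreal ((0 - \<phi> x)\<^sup>2) \<partial>surf) \<le> ennreal (inverse (real (Suc n)))" by simp
  then obtain \<phi> where \<phi>: "\<And>n. smooth_on UNIV (\<phi> n)" "\<And>n. H1norm (\<lambda>x. v x - \<phi> n x) \<le> 2 * inverse (real (Suc n))"
     "\<And>n. (\<integral>\<^sup>+x. ennreal ((0 - \<phi> n x)\<^sup>2) \<partial>surf) \<le> ennreal (inverse (real (Suc n)))"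
    unfolding choice_iff by blast
  have 1: "(\<lambda>n. H1norm (\<lambda>x. v x - \<phi> n x)) \<longlonglongrightarrow> 0"
  proof (rule tendsto_sandwich[where f = "\<lambda>_. 0"])
    show "\<forall>\<^sub>F n in sequentially. H1norm (\<lambda>x. v x - \<phi> n x) \<le> 2 * inverse (real (Suc n))"
      using \<phi>(2) by (intro always_eventually allI)
    show "(\<lambda>n. 2 * inverse (real (Suc n))) \<longlonglongrightarrow> 0"
      using tendsto_mult_right_zero[OF LIMSEQ_inverse_real_of_nat] .
  qed (auto simp: H1_norm_nonneg)
  have 2: "(\<lambda>n. \<integral>\<^sup>+x. ennreal ((0 - \<phi> n x)\<^sup>2) \<partial>surf) \<longlonglongrightarrow> 0"
  proof (rule tendsto_sandwich[where f = "\<lambda>_. 0"])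
    show "\<forall>\<^sub>F n in sequentially. (\<integral>\<^sup>+x. ennreal ((0 - \<phi> n x)\<^sup>2) \<partial>surf) \<le> ennreal (inverse (real (Suc n)))"
      using \<phi>(3) by (intro always_eventually allI)
    show "(\<lambda>n. ennreal (inverse (real (Suc n)))) \<longlonglongrightarrow> 0"
      using tendsto_ennrealI[OF LIMSEQ_inverse_real_of_nat] by simp
  qed auto
  show ?thesis
    using v \<phi>(1) 1 2 unfolding H1_0_def has_trace_def
    by (auto simp: square_integrable_def intro!: exI[of _ \<phi>])
qed

section \<open>Dirichlet-to-Neumann maps of bounded symmetric forms\<close>

definition admissible_form :: "'a form \<Rightarrow> bool" where
  "admissible_form a \<longleftrightarrow> (\<forall>u v. a u v = a v u) \<and>
     (\<forall>u\<in>H1 \<Omega>. \<forall>v\<in>H1 \<Omega>. \<forall>w\<in>H1 \<Omega>. \<forall>c. a u (\<lambda>x. v x + c * w x) = a u v + c * a u w) \<and>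
     (\<exists>C\<ge>0. \<forall>u\<in>H1 \<Omega>. \<forall>v\<in>H1 \<Omega>. \<bar>a u v\<bar> \<le> C * H1norm u * H1norm v)"

lemma admissible_form_sym: "admissible_form a \<Longrightarrow> a u v = a v u"
  unfolding admissible_form_def by blast

lemma admissible_form_add_scaled:
  "admissible_form a \<Longrightarrow> u \<in> H1 \<Omega> \<Longrightarrow> v \<in> H1 \<Omega> \<Longrightarrow> w \<in> H1 \<Omega> \<Longrightarrow>
     a u (\<lambda>x. v x + c * w x) = a u v + c * a u w"
  unfolding admissible_form_def by blast

lemma admissible_form_diff:
  "admissible_form a \<Longrightarrow> u \<in> H1 \<Omega> \<Longrightarrow> v \<in> H1 \<Omega> \<Longrightarrow> w \<in> H1 \<Omega> \<Longrightarrow>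
     a u (\<lambda>x. v x - w x) = a u v - a u w"
  using admissible_form_add_scaled[of a u v w "-1"] by simp

text \<open>The difference of the two functions has Sobolev norm 0, and the form is bounded.\<close>

lemma admissible_form_cong_AE:
  assumes a: "admissible_form a" and uv: "u \<in> H1 \<Omega>" "u' \<in> H1 \<Omega>" "v \<in> H1 \<Omega>" and ae: "AE x in vol. u x = u' x"
  shows "a u v = a u' v"
proof -
  obtain C where C: "\<forall>u\<in>H1 \<Omega>. \<forall>v\<in>H1 \<Omega>. \<bar>a u v\<bar> \<le> C * H1norm u * H1norm v"
    using a unfolding admissible_form_def by blast
  have "H1norm (\<lambda>x. u x - u' x) = 0"
    using ae by (intro H1_norm_zero_AE H1_diff uv) auto
  moreover have "\<bar>a v (\<lambda>x. u x - u' x)\<bar> \<le> C * H1norm v * H1norm (\<lambda>x. u x - u' x)"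
    using C H1_diff[OF uv(1,2)] uv(3) by blast
  ultimately have "a v u = a v u'" using admissible_form_diff[OF a uv(3,1,2)] by simp
  then show ?thesis using admissible_form_sym[OF a, of u v] admissible_form_sym[OF a, of u' v] by simp
qed

lemma weak_solution_cong:
  assumes "\<And>u v. u \<in> H1 \<Omega> \<Longrightarrow> v \<in> H1 \<Omega> \<Longrightarrow> a u v = a' u v"
  shows "weak_solution \<Omega> a = weak_solution \<Omega> a'"
proof (intro ext)
  fix f u
  have "a u v = a' u v" if "has_trace \<Omega> u f" "v \<in> H1_0 \<Omega>" for v
    using assms[OF has_trace_H1[OF that(1)] H1_0_H1[OF that(2)]] .
  then show "weak_solution \<Omega> a f u = weak_solution \<Omega> a' f u"
    unfolding weak_solution_def by auto
qed

text \<open>Serves to exchange the representative of a coefficient class: solutions and extensions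
  lie in \<open>H1 \<Omega>\<close>, so values of the form elsewhere never enter.\<close>

lemma dn_map_cong:
  assumes "\<And>u v. u \<in> H1 \<Omega> \<Longrightarrow> v \<in> H1 \<Omega> \<Longrightarrow> a u v = a' u v"
  shows "dn_map \<Omega> a = dn_map \<Omega> a'"
proof -
  have ws: "weak_solution \<Omega> a = weak_solution \<Omega> a'" by (rule weak_solution_cong[OF assms])
  have "(weak_solution \<Omega> a f u \<and> has_trace \<Omega> v g \<and> r = a u v)
     \<longleftrightarrow> (weak_solution \<Omega> a' f u \<and> has_trace \<Omega> v g \<and> r = a' u v)" for f g r u v
    using assms[of u v] has_trace_H1[of u f] has_trace_H1[of v g] unfolding ws
    by (auto simp: weak_solution_def)
  then show ?thesis unfolding dn_map_def by simp
qed

context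
  fixes a assumes a: "admissible_form a" and us: "uniquely_solvable \<Omega> a"
begin

text \<open>The definite description is single-valued: two solutions agree almost everywhere, and
  two extensions of \<open>g\<close> differ by a function of zero trace, which a solution
  annihilates.\<close>

lemma dn_map_eq:
  assumes u: "weak_solution \<Omega> a f u" and v: "has_trace \<Omega> v g"
  shows "dn_map \<Omega> a f g = a u v"
proof -
  have f: "f \<in> Hhalf \<Omega>" and g: "g \<in> Hhalf \<Omega>" using u v unfolding Hhalf_def weak_solution_def by auto
  have uH: "u \<in> H1 \<Omega>" and vH: "v \<in> H1 \<Omega>" using u v has_trace_H1 unfolding weak_solution_def by auto
  have "a u' v' = a u v" if u': "weak_solution \<Omega> a f u'" and v': "has_trace \<Omega> v' g" for u' v'
  proof -
    have uH': "u' \<in> H1 \<Omega>" and vH': "v' \<in> H1 \<Omega>" using u' v' has_trace_H1 unfolding weak_solution_def by auto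
    have "AE x in vol. u' x = u x" using us f u u' unfolding uniquely_solvable_def by blast
    then have "a u' v' = a u v'" by (rule admissible_form_cong_AE[OF a uH' uH vH'])
    moreover have "a u (\<lambda>x. v' x - v x) = 0"
      using u has_trace_same_diff[OF v' v] unfolding weak_solution_def by blast
    ultimately show ?thesis using admissible_form_diff[OF a uH vH' vH] by simp
  qed
  then have "(THE r. \<exists>u v. weak_solution \<Omega> a f u \<and> has_trace \<Omega> v g \<and> r = a u v) = a u v"
    using u v by (intro the_equality) blast+
  then show ?thesis using f g by (simp add: dn_map_def)
qed

lemma ex_weak_solution: "f \<in> Hhalf \<Omega> \<Longrightarrow> \<exists>u. weak_solution \<Omega> a f u"
  using us unfolding uniquely_solvable_def by blast

lemma dn_map_sym:
  assumes "f \<in> Hhalf \<Omega>" "g \<in> Hhalf \<Omega>"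
  shows "dn_map \<Omega> a f g = dn_map \<Omega> a g f"
proof -
  obtain u v where uv: "weak_solution \<Omega> a f u" "weak_solution \<Omega> a g v"
    using assms ex_weak_solution by blast
  then have "has_trace \<Omega> u f" "has_trace \<Omega> v g" unfolding weak_solution_def by auto
  then show ?thesis using dn_map_eq[OF uv(1)] dn_map_eq[OF uv(2)] admissible_form_sym[OF a, of u v] by simp
qed

text \<open>The estimate is in terms of one extension \<open>v\<close> of the difference. Since
  \<open>Hhalf_norm\<close> is the infimum over such extensions, this is continuity without an
  attained minimum. An extension of \<open>g\<close> is obtained by adding \<open>v\<close> to one
  of \<open>g'\<close>.\<close>

lemma dn_map_continuous:
  assumes h: "h \<in> Hhalf \<Omega>"
  obtains K where "0 \<le> K" "\<And>g g' v. has_trace \<Omega> v (\<lambda>x. g x - g' x) \<Longrightarrow> g \<in> Hhalf \<Omega> \<Longrightarrow> g' \<in> Hhalf \<Omega> \<Longrightarrow>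
      \<bar>dn_map \<Omega> a h g - dn_map \<Omega> a h g'\<bar> \<le> K * H1norm v"
proof -
  obtain u where u: "weak_solution \<Omega> a h u" using ex_weak_solution[OF h] by blast
  then have uH: "u \<in> H1 \<Omega>" using has_trace_H1 unfolding weak_solution_def by blast
  obtain C where C: "C \<ge> 0" "\<forall>u\<in>H1 \<Omega>. \<forall>v\<in>H1 \<Omega>. \<bar>a u v\<bar> \<le> C * H1norm u * H1norm v"
    using a unfolding admissible_form_def by blast
  show thesis
  proof (rule that)
    show "0 \<le> C * H1norm u" using C H1_norm_nonneg by simp
    fix g g' v assume v: "has_trace \<Omega> v (\<lambda>x. g x - g' x)" and g: "g \<in> Hhalf \<Omega>" "g' \<in> Hhalf \<Omega>"
    obtain w where w: "has_trace \<Omega> w g'" using g unfolding Hhalf_def by blast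
    have vw: "has_trace \<Omega> (\<lambda>x. w x + 1 * v x) g" using has_trace_add[OF w v] by simp
    have "dn_map \<Omega> a h g = dn_map \<Omega> a h g' + a u v"
      unfolding dn_map_eq[OF u w] dn_map_eq[OF u vw]
      using admissible_form_add_scaled[OF a uH has_trace_H1[OF w] has_trace_H1[OF v], of 1] by simp
    then show "\<bar>dn_map \<Omega> a h g - dn_map \<Omega> a h g'\<bar> \<le> C * H1norm u * H1norm v"
      using C uH has_trace_H1[OF v] by simp
  qed
qed

end

section \<open>Determination of the map by its matrix\<close>

lemma dn_map_eq_of_dense:
  assumes a: "admissible_form a" "uniquely_solvable \<Omega> a" and a': "admissible_form a'" "uniquely_solvable \<Omega> a'"
    and f: "dense_seq_Hhalf \<Omega> f" and h: "h \<in> Hhalf \<Omega>" and g: "g \<in> Hhalf \<Omega>"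
    and eq: "\<And>j. dn_map \<Omega> a h (f j) = dn_map \<Omega> a' h (f j)"
  shows "dn_map \<Omega> a h g = dn_map \<Omega> a' h g"
proof -
  have fH: "f j \<in> Hhalf \<Omega>" for j using f unfolding dense_seq_Hhalf_def by blast
  obtain K where K: "0 \<le> K" "\<And>g g' v. has_trace \<Omega> v (\<lambda>x. g x - g' x) \<Longrightarrow> g \<in> Hhalf \<Omega> \<Longrightarrow> g' \<in> Hhalf \<Omega> \<Longrightarrow>
      \<bar>dn_map \<Omega> a h g - dn_map \<Omega> a h g'\<bar> \<le> K * H1norm v"
    using dn_map_continuous[OF a h] by blast
  obtain K' where K': "0 \<le> K'" "\<And>g g' v. has_trace \<Omega> v (\<lambda>x. g x - g' x) \<Longrightarrow> g \<in> Hhalf \<Omega> \<Longrightarrow> g' \<in> Hhalf \<Omega> \<Longrightarrow>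
      \<bar>dn_map \<Omega> a' h g - dn_map \<Omega> a' h g'\<bar> \<le> K' * H1norm v"
    using dn_map_continuous[OF a' h] by blast
  have "\<bar>dn_map \<Omega> a h g - dn_map \<Omega> a' h g\<bar> \<le> e" if "e > 0" for e
  proof -
    \<comment> \<open>The two continuity constants may both be 0, hence the extra 1 in the
      denominator.\<close>
    define \<epsilon> where "\<epsilon> = e / (K + K' + 1)"
    have "\<epsilon> > 0" using K K' that by (simp add: \<epsilon>_def)
    then obtain j where "Hhalf_norm \<Omega> (\<lambda>x. g x - f j x) < \<epsilon>"
      using f g unfolding dense_seq_Hhalf_def by blast
    moreover obtain w w' where w: "has_trace \<Omega> w g" "has_trace \<Omega> w' (f j)"
      using g fH[of j] unfolding Hhalf_def by blast
    \<comment> \<open>Nonemptiness is what allows an element below \<open>\<epsilon>\<close> to be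
      extracted from the bound on the infimum.\<close>
    have "{H1norm u |u. has_trace \<Omega> u (\<lambda>x. g x - f j x)} \<noteq> {}"
      using has_trace_diff[OF w] by blast
    ultimately obtain v where v: "has_trace \<Omega> v (\<lambda>x. g x - f j x)" "H1norm v < \<epsilon>"
      unfolding Hhalf_norm_def using cInf_lessD[of "{H1norm u |u. has_trace \<Omega> u (\<lambda>x. g x - f j x)}" \<epsilon>] by blast
    have "\<bar>dn_map \<Omega> a h g - dn_map \<Omega> a' h g\<bar> \<le> K * H1norm v + K' * H1norm v"
      using K(2)[OF v(1) g fH] K'(2)[OF v(1) g fH] eq[of j] by linarith
    also have "\<dots> \<le> (K + K' + 1) * \<epsilon>"
    proof -
      have "K * H1norm v \<le> K * \<epsilon>" "K' * H1norm v \<le> K' * \<epsilon>"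
        using v(2) K(1) K'(1) by (auto intro: mult_left_mono)
      then show ?thesis using \<open>\<epsilon> > 0\<close> unfolding distrib_right by linarith
    qed
    also have "\<dots> = e" using K K' unfolding \<epsilon>_def by (simp add: field_simps add_nonneg_eq_0_iff)
    finally show ?thesis .
  qed
  then have "\<bar>dn_map \<Omega> a h g - dn_map \<Omega> a' h g\<bar> \<le> 0" by (meson dense_ge)
  then show ?thesis by simp
qed

lemma dn_map_determined:
  assumes a: "admissible_form a" "uniquely_solvable \<Omega> a" and a': "admissible_form a'" "uniquely_solvable \<Omega> a'"
    and f: "dense_seq_Hhalf \<Omega> f" and eq: "dn_matrix f (dn_map \<Omega> a) = dn_matrix f (dn_map \<Omega> a')"
  shows "dn_map \<Omega> a = dn_map \<Omega> a'"
proof -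
  have fH: "f j \<in> Hhalf \<Omega>" for j using f unfolding dense_seq_Hhalf_def by blast
  have eq1: "dn_map \<Omega> a (f i) (f j) = dn_map \<Omega> a' (f i) (f j)" for i j
    using fun_cong[OF eq, of "(i, j)"] unfolding dn_matrix_def by simp
  have "dn_map \<Omega> a (f i) g = dn_map \<Omega> a' (f i) g" if "g \<in> Hhalf \<Omega>" for i g
    by (rule dn_map_eq_of_dense[OF a a' f fH that eq1])
  then have eq2: "dn_map \<Omega> a g (f i) = dn_map \<Omega> a' g (f i)" if "g \<in> Hhalf \<Omega>" for i g
    using dn_map_sym[OF a that fH] dn_map_sym[OF a' that fH] that by simp
  have "dn_map \<Omega> a h g = dn_map \<Omega> a' h g" if "h \<in> Hhalf \<Omega>" "g \<in> Hhalf \<Omega>" for h g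
    by (rule dn_map_eq_of_dense[OF a a' f that eq2[OF that(1)]])
  \<comment> \<open>Off \<open>Hhalf \<Omega>\<close> both maps have the same value by the
    restricted abstractions, so agreement there is agreement everywhere.\<close>
  then show ?thesis unfolding dn_map_def by (auto simp: restrict_def fun_eq_iff)
qed

end

section \<open>The Friedrichs inequality\<close>

text \<open>A set of diameter \<open>d \<le> 1\<close>, swept over a length \<open>R\<close> along a
  basis vector, lies in a box of volume at most \<open>(2 + R) * (2 * d) ^ m\<close> with
  \<open>m\<close> the dimension minus 1. Writing \<open>2 * d\<close> as \<open>4 * (d / 2)\<close>
  and dividing by \<open>unit_ball_vol\<close> expresses this through the weight used in the
  Hausdorff measure.\<close>

definition cylinder_factor :: "nat \<Rightarrow> real \<Rightarrow> real" where
  "cylinder_factor m R = 4 ^ m * (2 + R) / unit_ball_vol (real m)"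

lemma cylinder_factor_pos: "0 \<le> R \<Longrightarrow> 0 < cylinder_factor m R"
  unfolding cylinder_factor_def by (intro divide_pos_pos mult_pos_pos unit_ball_vol_pos) auto

text \<open>All points of \<open>C\<close> are within its diameter of one of them, coordinate by
  coordinate. Only one side of the resulting box also has to accommodate the sweep.\<close>

lemma cylinder_subset_box:
  fixes C :: "'a::euclidean_space set"
  assumes C: "bounded C" "diameter C \<le> 1" and b: "b \<in> Basis" and R: "0 \<le> R" and n: "2 \<le> DIM('a)"
  shows "\<exists>B\<in>sets borel. {x. \<exists>t\<in>{0..R}. x + t *\<^sub>R b \<in> C} \<subseteq> B \<and>
     emeasure lborel B \<le> ennreal (cylinder_factor (DIM('a) - 1) R)
        * ennreal (unit_ball_vol (real (DIM('a) - 1)) * (diameter C / 2) ^ (DIM('a) - 1))"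
proof (cases "C = {}")
  case True
  then show ?thesis by (intro bexI[of _ "{}"]) auto
next
  case False
  then obtain p where p: "p \<in> C" by blast
  define d where "d = diameter C"
  have d: "0 \<le> d" "d \<le> 1" using C diameter_ge_0 by (auto simp: d_def)
  \<comment> \<open>A point of the cylinder is \<open>y - t *\<^sub>R b\<close> with
    \<open>y\<close> in \<open>C\<close>, so the sweep moves the lower corner only.\<close>
  define l where "l = (\<Sum>i\<in>Basis. (p \<bullet> i - d - (if i = b then R else 0)) *\<^sub>R i)"
  define u where "u = (\<Sum>i\<in>Basis. (p \<bullet> i + d) *\<^sub>R i)"
  have lu: "l \<bullet> i = p \<bullet> i - d - (if i = b then R else 0)" "u \<bullet> i = p \<bullet> i + d" if "i \<in> Basis" for i
    using that by (auto simp: l_def u_def)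
  have sub: "{x. \<exists>t\<in>{0..R}. x + t *\<^sub>R b \<in> C} \<subseteq> cbox l u"
  proof
    fix x assume "x \<in> {x. \<exists>t\<in>{0..R}. x + t *\<^sub>R b \<in> C}"
    then obtain t where t: "0 \<le> t" "t \<le> R" "x + t *\<^sub>R b \<in> C" by auto
    show "x \<in> cbox l u" unfolding mem_box
    proof
      fix i :: 'a assume i: "i \<in> Basis"
      have "\<bar>(x + t *\<^sub>R b - p) \<bullet> i\<bar> \<le> norm (x + t *\<^sub>R b - p)" by (rule Basis_le_norm[OF i])
      also have "\<dots> \<le> d" using diameter_bounded_bound[OF C(1) t(3) p] by (simp add: d_def dist_norm)
      finally have "\<bar>x \<bullet> i + t * (b \<bullet> i) - p \<bullet> i\<bar> \<le> d" by (simp add: inner_add_left inner_diff_left)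
      then show "l \<bullet> i \<le> x \<bullet> i \<and> x \<bullet> i \<le> u \<bullet> i"
        using t i b lu[OF i] R by (auto simp: inner_Basis split: if_splits)
    qed
  qed
  have "emeasure lborel (cbox l u) = ennreal (\<Prod>i\<in>Basis. (u - l) \<bullet> i)"
    by (rule emeasure_lborel_cbox) (use lu d R in \<open>auto simp: inner_diff_left\<close>)
  also have "(\<Prod>i\<in>Basis. (u - l) \<bullet> i) = (2 * d + R) * (2 * d) ^ (DIM('a) - 1)"
  proof -
    have "(\<Prod>i\<in>Basis. (u - l) \<bullet> i) = (\<Prod>i\<in>Basis. 2 * d + (if i = b then R else 0))"
      using lu by (intro prod.cong) (auto simp: inner_diff_left)
    also have "\<dots> = (2 * d + R) * (\<Prod>i\<in>Basis - {b}. 2 * d + (if i = b then R else 0))"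
      using b by (subst prod.remove[of _ b]) auto
    also have "(\<Prod>i\<in>Basis - {b}. 2 * d + (if i = b then R else 0)) = (\<Prod>i\<in>Basis - {b}. 2 * d)"
      by (intro prod.cong) auto
    finally show ?thesis using b by simp
  qed
  also have "\<dots> \<le> (2 + R) * (2 * d) ^ (DIM('a) - 1)"
    using d R by (intro mult_right_mono) auto
  also have "(2 + R) * (2 * d) ^ (DIM('a) - 1) = cylinder_factor (DIM('a) - 1) R
      * (unit_ball_vol (real (DIM('a) - 1)) * (d / 2) ^ (DIM('a) - 1))"
  proof -
    have "unit_ball_vol (real (DIM('a) - 1)) \<noteq> 0" by (rule less_imp_neq[symmetric, OF unit_ball_vol_pos]) simp
    moreover have "(2 * d) ^ m = 4 ^ m * (d / 2) ^ m" for m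
      using power_mult_distrib[of 4 "d / 2" m] by simp
    ultimately show ?thesis by (simp add: cylinder_factor_def)
  qed
  finally have "emeasure lborel (cbox l u) \<le> ennreal (cylinder_factor (DIM('a) - 1) R
      * (unit_ball_vol (real (DIM('a) - 1)) * (d / 2) ^ (DIM('a) - 1)))" by (simp add: ennreal_leI)
  also have "\<dots> = ennreal (cylinder_factor (DIM('a) - 1) R)
      * ennreal (unit_ball_vol (real (DIM('a) - 1)) * (d / 2) ^ (DIM('a) - 1))"
    using d less_imp_le[OF cylinder_factor_pos[OF R]] by (intro ennreal_mult) auto
  finally show ?thesis using sub unfolding d_def by (intro bexI[of _ "cbox l u"]) auto
qed

text \<open>Stands in for the fact that projections do not increase Hausdorff measure: the set \<open>A\<close> lies in the
  cylinder of height \<open>R\<close> over \<open>B\<close>, and a cover of \<open>B\<close> by small sets covers it by thin boxes.\<close>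

lemma emeasure_cylinder_le_hausdorff:
  fixes A B :: "'a::euclidean_space set"
  assumes A: "A \<in> sets borel" and AB: "\<And>x. x \<in> A \<Longrightarrow> \<exists>t\<in>{0..R}. x + t *\<^sub>R b \<in> B"
    and b: "b \<in> Basis" and R: "0 \<le> R" and n: "2 \<le> DIM('a)"
  shows "emeasure lborel A \<le> ennreal (cylinder_factor (DIM('a) - 1) R)
     * hausdorff_outer (DIM('a) - 1) B"
proof -
  define K where "K = cylinder_factor (DIM('a) - 1) R"
  have K: "K > 0" unfolding K_def by (rule cylinder_factor_pos[OF R])
  \<comment> \<open>With the constant moved to the left, the claim is a lower bound for the sum of
    every single cover. Scale 1 suffices, because contents never exceed the Hausdorff
    measure.\<close>
  have "ennreal (1 / K) * emeasure lborel A \<le> hausdorff_content (DIM('a) - 1) 1 B"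
    unfolding hausdorff_content_def
  proof (rule INF_greatest)
    fix C :: "nat \<Rightarrow> 'a set"
    assume "C \<in> {C. B \<subseteq> (\<Union>i. C i) \<and> (\<forall>i. bounded (C i) \<and> diameter (C i) \<le> 1)}"
    then have C: "B \<subseteq> (\<Union>i. C i)" "\<And>i. bounded (C i)" "\<And>i. diameter (C i) \<le> 1" by auto
    define g where "g i = ennreal (unit_ball_vol (real (DIM('a) - 1)) * (diameter (C i) / 2) ^ (DIM('a) - 1))" for i
    have "\<forall>i. \<exists>D. D \<in> sets borel \<and> {x. \<exists>t\<in>{0..R}. x + t *\<^sub>R b \<in> C i} \<subseteq> D \<and> emeasure lborel D \<le> ennreal K * g i"
      using cylinder_subset_box[OF C(2,3) b R n] unfolding K_def g_def by blast
    from choice[OF this] obtain D where D: "\<And>i. D i \<in> sets borel"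
      "\<And>i. {x. \<exists>t\<in>{0..R}. x + t *\<^sub>R b \<in> C i} \<subseteq> D i"
      "\<And>i. emeasure lborel (D i) \<le> ennreal K * g i" by blast
    have "A \<subseteq> (\<Union>i. D i)"
    proof
      fix x assume "x \<in> A"
      then obtain t where "t \<in> {0..R}" "x + t *\<^sub>R b \<in> B" using AB by blast
      then obtain i where "x + t *\<^sub>R b \<in> C i" using C by blast
      then show "x \<in> (\<Union>i. D i)" using D(2)[of i] \<open>t \<in> {0..R}\<close> by blast
    qed
    then have "emeasure lborel A \<le> emeasure lborel (\<Union>i. D i)"
      using D by (intro emeasure_mono) auto
    also have "\<dots> \<le> (\<Sum>i. emeasure lborel (D i))"
      using D by (intro emeasure_subadditive_countably) auto
    also have "\<dots> \<le> (\<Sum>i. ennreal K * g i)" by (intro suminf_le D) auto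
    also have "\<dots> = ennreal K * (\<Sum>i. g i)" by (rule ennreal_suminf_cmult)
    finally have "ennreal (1 / K) * emeasure lborel A \<le> ennreal (1 / K) * (ennreal K * (\<Sum>i. g i))"
      by (rule mult_left_mono) simp
    also have "\<dots> = (\<Sum>i. g i)" using K by (simp add: mult.assoc[symmetric] flip: ennreal_mult)
    finally show "ennreal (1 / K) * emeasure lborel A
      \<le> (\<Sum>i. ennreal (unit_ball_vol (real (DIM('a) - 1)) * (diameter (C i) / 2) ^ (DIM('a) - 1)))"
      unfolding g_def .
  qed
  also have "\<dots> \<le> hausdorff_outer (DIM('a) - 1) B" by (rule hausdorff_content_le_outer) simp
  finally have "ennreal K * (ennreal (1 / K) * emeasure lborel A) \<le> ennreal K * hausdorff_outer (DIM('a) - 1) B"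
    by (rule mult_left_mono) simp
  then show ?thesis using K unfolding K_def[symmetric] by (simp add: mult.assoc[symmetric] flip: ennreal_mult)
qed

text \<open>Cauchy-Schwarz against the indicator of the interval, whose squared norm is
  \<open>t\<close>. The bound is phrased with nonnegative integrals because Tonelli's theorem is
  applied to it later.\<close>

lemma integral_square_le:
  fixes h :: "real \<Rightarrow> real"
  assumes h: "continuous_on UNIV h" and t: "0 \<le> t"
  shows "ennreal ((LINT s|lborel. indicator {0..t} s *\<^sub>R h s)\<^sup>2) \<le> ennreal t * (\<integral>\<^sup>+s. indicator {0..t} s * ennreal ((h s)\<^sup>2) \<partial>lborel)"
proof -
  have [measurable]: "h \<in> borel_measurable borel" using h by (rule borel_measurable_continuous_onI)
  have i1: "integrable lborel (\<lambda>s. indicator {0..t} s *\<^sub>R (h s)\<^sup>2)"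
    by (rule borel_integrable_compact) (auto intro!: continuous_intros continuous_on_subset[OF h])
  have s1: "square_integrable lborel (\<lambda>s. indicator {0..t} s *\<^sub>R h s)"
  proof -
    have "(\<lambda>s. (norm (indicator {0..t} s *\<^sub>R h s))\<^sup>2) = (\<lambda>s. indicator {0..t} s *\<^sub>R (h s)\<^sup>2)"
      by (auto simp: fun_eq_iff indicator_def)
    then show ?thesis unfolding square_integrable_def using i1 by simp
  qed
  have s2: "square_integrable lborel (indicator {0..t} :: real \<Rightarrow> real)"
  proof -
    have "(\<lambda>s. (norm (indicator {0..t} s :: real))\<^sup>2) = indicator {0..t}"
      by (auto simp: fun_eq_iff indicator_def)
    then show ?thesis unfolding square_integrable_def using t by simp
  qed
  have n1: "(l2norm lborel (\<lambda>s. indicator {0..t} s *\<^sub>R h s))\<^sup>2 = (LINT s|lborel. indicator {0..t} s *\<^sub>R (h s)\<^sup>2)"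
    unfolding l2norm_square by (intro Bochner_Integration.integral_cong) (auto simp: indicator_def power2_eq_square)
  have n2: "(l2norm lborel (indicator {0..t} :: real \<Rightarrow> real))\<^sup>2 = t"
  proof -
    have "(l2norm lborel (indicator {0..t} :: real \<Rightarrow> real))\<^sup>2 = (LINT s|lborel. indicator {0..t} s)"
      unfolding l2norm_square by (intro Bochner_Integration.integral_cong) (auto simp: indicator_def)
    then show ?thesis using t by simp
  qed
  have "(LINT s|lborel. indicator {0..t} s *\<^sub>R h s) = (LINT s|lborel. (indicator {0..t} s *\<^sub>R h s) \<bullet> indicator {0..t} s)"
    by (intro Bochner_Integration.integral_cong) (auto simp: indicator_def)
  then have "\<bar>LINT s|lborel. indicator {0..t} s *\<^sub>R h s\<bar>
    \<le> l2norm lborel (\<lambda>s. indicator {0..t} s *\<^sub>R h s) * l2norm lborel (indicator {0..t} :: real \<Rightarrow> real)"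
    using l2norm_Cauchy_Schwarz[OF s1 s2] by simp
  then have "(LINT s|lborel. indicator {0..t} s *\<^sub>R h s)\<^sup>2
    \<le> (l2norm lborel (\<lambda>s. indicator {0..t} s *\<^sub>R h s) * l2norm lborel (indicator {0..t} :: real \<Rightarrow> real))\<^sup>2"
    by (metis abs_ge_zero power2_abs power_mono)
  also have "\<dots> = t * (LINT s|lborel. indicator {0..t} s *\<^sub>R (h s)\<^sup>2)"
    unfolding power_mult_distrib n1 n2 by simp
  finally have "ennreal ((LINT s|lborel. indicator {0..t} s *\<^sub>R h s)\<^sup>2)
     \<le> ennreal t * ennreal (LINT s|lborel. indicator {0..t} s *\<^sub>R (h s)\<^sup>2)"
    using t by (simp add: ennreal_leI flip: ennreal_mult')
  also have "ennreal (LINT s|lborel. indicator {0..t} s *\<^sub>R (h s)\<^sup>2) = (\<integral>\<^sup>+s. ennreal (indicator {0..t} s *\<^sub>R (h s)\<^sup>2) \<partial>lborel)"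
    by (rule nn_integral_eq_integral[symmetric, OF i1]) simp
  also have "\<dots> = (\<integral>\<^sup>+s. indicator {0..t} s * ennreal ((h s)\<^sup>2) \<partial>lborel)"
    by (intro nn_integral_cong) (auto simp: indicator_def)
  finally show ?thesis .
qed

section \<open>Exit times and exit points along a coordinate direction\<close>

context bounded_open_set
begin

context
  fixes b :: 'a and R :: real
  assumes b: "b \<in> Basis" and R: "0 < R" and far: "\<And>x s. x \<in> \<Omega> \<Longrightarrow> R \<le> s \<Longrightarrow> x + s *\<^sub>R b \<notin> \<Omega>"
    and dim: "2 \<le> DIM('a)"
begin

text \<open>The time is 0 for points outside \<open>\<Omega>\<close>, so the function is total and
  its measurability can be discussed on the whole space.\<close>

definition exit_time :: "'a \<Rightarrow> real" where
  "exit_time x = Inf {s. 0 \<le> s \<and> x + s *\<^sub>R b \<notin> \<Omega>}"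

text \<open>The set of times spent outside is closed, because \<open>\<Omega>\<close> is open, and
  nonempty by \<open>far\<close>. Its infimum is thus attained, and all the parts follow from
  that.\<close>

lemma exit_time:
  shows "0 \<le> exit_time x" "x + exit_time x *\<^sub>R b \<notin> \<Omega>"
    "0 \<le> s \<Longrightarrow> s < exit_time x \<Longrightarrow> x + s *\<^sub>R b \<in> \<Omega>"
    "0 \<le> c \<Longrightarrow> c < exit_time x \<longleftrightarrow> (\<forall>s\<in>{0..c}. x + s *\<^sub>R b \<in> \<Omega>)"
    "exit_time x \<le> R"
proof -
  define T where "T = {s. 0 \<le> s \<and> x + s *\<^sub>R b \<notin> \<Omega>}"
  have far': "\<exists>s\<ge>0. s \<le> R \<and> x + s *\<^sub>R b \<notin> \<Omega>"
  proof (cases "x \<in> \<Omega>")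
    case True
    then show ?thesis using far[of x R] R by (intro exI[of _ R]) auto
  next
    case False
    then show ?thesis using R by (intro exI[of _ 0]) auto
  qed
  have "T = {0..} \<inter> (\<lambda>s. x + s *\<^sub>R b) -` (- \<Omega>)" unfolding T_def by auto
  moreover have "closed ((\<lambda>s. x + s *\<^sub>R b) -` (- \<Omega>))"
    using open_\<Omega> by (intro closed_vimage continuous_intros) (simp add: closed_def)
  ultimately have "closed T" by (simp add: closed_Int)
  moreover have ne: "T \<noteq> {}" using far' unfolding T_def by blast
  moreover have bd: "bdd_below T" unfolding T_def by (intro bdd_belowI[of _ 0]) auto
  ultimately have T: "exit_time x \<in> T" unfolding exit_time_def T_def[symmetric] by (intro closed_contains_Inf)
  then show "0 \<le> exit_time x" "x + exit_time x *\<^sub>R b \<notin> \<Omega>" unfolding T_def by auto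
  have low: "exit_time x \<le> s" if "s \<in> T" for s
    unfolding exit_time_def T_def[symmetric] using that bd by (rule cInf_lower)
  show "exit_time x \<le> R" using far' low unfolding T_def by force
  show *: "x + s *\<^sub>R b \<in> \<Omega>" if "0 \<le> s" "s < exit_time x" for s
    using low[of s] that unfolding T_def by force
  show "c < exit_time x \<longleftrightarrow> (\<forall>s\<in>{0..c}. x + s *\<^sub>R b \<in> \<Omega>)" if "0 \<le> c"
  proof
    assume "c < exit_time x" then show "\<forall>s\<in>{0..c}. x + s *\<^sub>R b \<in> \<Omega>" using * by auto
  next
    assume "\<forall>s\<in>{0..c}. x + s *\<^sub>R b \<in> \<Omega>"
    then have "exit_time x \<notin> {0..c}" using T unfolding T_def by auto
    then show "c < exit_time x" using T unfolding T_def by auto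
  qed
qed

definition exit_point :: "'a \<Rightarrow> 'a" where
  "exit_point x = x + exit_time x *\<^sub>R b"

text \<open>Lower semicontinuity: the exit time exceeds \<open>c\<close> exactly if the whole
  segment up to time \<open>c\<close> stays in \<open>\<Omega>\<close>. The points violating this
  form the Minkowski sum of a compact segment with the closed complement of \<open>\<Omega>\<close>,
  a closed set.\<close>

lemma exit_time_measurable: "exit_time \<in> borel_measurable borel"
proof (rule borel_measurableI_greater)
  fix c :: real
  show "{x \<in> space borel. c < exit_time x} \<in> sets borel"
  proof (cases "0 \<le> c")
    case False
    then have "{x \<in> space borel. c < exit_time x} = UNIV" using exit_time(1) by (auto simp: not_le intro: less_le_trans)
    then show ?thesis by simp
  next
    case True
    define Z where "Z = (\<Union>x\<in>(\<lambda>s. - (s *\<^sub>R b)) ` {0..c}. \<Union>y\<in>- \<Omega>. {x + y})"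
    have "{x. c < exit_time x} = - Z"
    proof (intro set_eqI iffI)
      fix x assume "x \<in> {x. c < exit_time x}"
      then have "\<forall>s\<in>{0..c}. x + s *\<^sub>R b \<in> \<Omega>" using exit_time(4)[OF True] by blast
      then show "x \<in> - Z" unfolding Z_def by auto
    next
      fix x assume *: "x \<in> - Z"
      have "x + s *\<^sub>R b \<in> \<Omega>" if "s \<in> {0..c}" for s
      proof (rule ccontr)
        assume "x + s *\<^sub>R b \<notin> \<Omega>"
        moreover have "x = - (s *\<^sub>R b) + (x + s *\<^sub>R b)" by simp
        ultimately have "x \<in> Z" unfolding Z_def
          using that by blast
        then show False using * by blast
      qed
      then show "x \<in> {x. c < exit_time x}" using exit_time(4)[OF True] by blast
    qed
    moreover have "closed Z" unfolding Z_def
      using open_\<Omega> by (intro compact_closed_sums compact_continuous_image continuous_intros) (auto simp: closed_def)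
    ultimately show ?thesis by (simp add: borel_closed borel_comp)
  qed
qed

lemma exit_point_measurable[measurable]: "exit_point \<in> borel_measurable borel"
  unfolding exit_point_def[abs_def] using exit_time_measurable by measurable

text \<open>The exit point is outside \<open>\<Omega>\<close>, and positions shortly before the exit
  are points of \<open>\<Omega>\<close> converging to it.\<close>

lemma exit_point_frontier:
  assumes "x \<in> \<Omega>" shows "exit_point x \<in> frontier \<Omega>"
proof -
  define t where "t = exit_time x"
  have "t \<noteq> 0" using exit_time(2)[of x] assms unfolding t_def by auto
  then have t: "t > 0" using exit_time(1)[of x] unfolding t_def by simp
  have lim: "(\<lambda>n. x + (t - t * inverse (real (Suc n))) *\<^sub>R b) \<longlonglongrightarrow> x + (t - t * 0) *\<^sub>R b"
    by (intro tendsto_intros LIMSEQ_inverse_real_of_nat)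
  have mem: "x + (t - t * inverse (real (Suc n))) *\<^sub>R b \<in> closure \<Omega>" for n
  proof -
    have "inverse (real (Suc n)) \<le> 1" "0 < inverse (real (Suc n))" by (auto simp: field_simps)
    then have "0 \<le> t - t * inverse (real (Suc n))" "t - t * inverse (real (Suc n)) < t"
      using t by (auto simp: mult_left_le)
    then have "x + (t - t * inverse (real (Suc n))) *\<^sub>R b \<in> \<Omega>" using exit_time(3)[of _ x] unfolding t_def by simp
    then show ?thesis using closure_subset by blast
  qed
  have "x + (t - t * 0) *\<^sub>R b \<in> closure \<Omega>"
    by (rule closed_sequentially[OF closed_closure mem lim])
  then have "exit_point x \<in> closure \<Omega>" unfolding exit_point_def t_def by simp
  then show ?thesis
    using exit_time(2)[of x] open_\<Omega> unfolding frontier_def exit_point_def by (simp add: interior_open)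
qed

text \<open>Points of \<open>\<Omega>\<close> that exit through \<open>A\<close> lie in a cylinder
  of height \<open>R\<close> over \<open>A\<close>. Hence the image of Lebesgue measure under
  \<open>exit_point\<close> is dominated by a multiple of the Hausdorff measure, and domination of
  measures carries over to integrals.\<close>

lemma nn_integral_exit_point_le:
  assumes g[measurable]: "g \<in> borel_measurable borel"
  shows "(\<integral>\<^sup>+x. indicator \<Omega> x * g (exit_point x) \<partial>lborel)
    \<le> ennreal (cylinder_factor (DIM('a) - 1) R) * (\<integral>\<^sup>+x. g x \<partial>surf)"
proof -
  define K where "K = ennreal (cylinder_factor (DIM('a) - 1) R)"
  define H where "H = (hausdorff_measure (DIM('a) - 1) :: 'a measure)"
  have setsH[measurable_cong]: "sets H = sets borel" unfolding H_def by (rule sets_hausdorff_measure)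
  have \<Omega>b[measurable]: "\<Omega> \<in> sets borel" using open_\<Omega> by simp
  have fr[measurable]: "frontier \<Omega> \<in> sets borel" by (simp add: borel_closed frontier_closed)
  define N where "N = distr (density lborel (indicator \<Omega>)) borel exit_point"
  have "N \<le> scale_measure K H"
  proof (subst le_measure)
    show "sets N = sets (scale_measure K H)" by (simp add: N_def setsH)
    show "\<forall>A\<in>sets N. emeasure N A \<le> emeasure (scale_measure K H) A"
    proof
      fix A assume "A \<in> sets N"
      then have A[measurable]: "A \<in> sets borel" by (simp add: N_def)
      have [measurable]: "exit_point -` A \<in> sets borel" using measurable_sets[OF exit_point_measurable A] by simp
      have "emeasure N A = (\<integral>\<^sup>+x. indicator \<Omega> x * indicator (exit_point -` A) x \<partial>lborel)"
        unfolding N_def by (subst emeasure_distr) (auto simp: emeasure_density)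
      also have "\<dots> = (\<integral>\<^sup>+x. indicator (\<Omega> \<inter> exit_point -` A) x \<partial>lborel)"
        by (intro nn_integral_cong) (simp add: indicator_inter_arith)
      also have "\<dots> = emeasure lborel (\<Omega> \<inter> exit_point -` A)" by simp
      also have "\<dots> \<le> K * hausdorff_outer (DIM('a) - 1) A"
        unfolding K_def
      proof (rule emeasure_cylinder_le_hausdorff[OF _ _ b _ dim])
        show "\<Omega> \<inter> exit_point -` A \<in> sets borel" using measurable_sets[OF exit_point_measurable A] by auto
        show "\<exists>t\<in>{0..R}. x + t *\<^sub>R b \<in> A" if "x \<in> \<Omega> \<inter> exit_point -` A" for x
          using that exit_time(1,5)[of x] unfolding exit_point_def by auto
      qed (use R in simp)
      also have "\<dots> = emeasure (scale_measure K H) A"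
        unfolding H_def using dim by (simp add: emeasure_hausdorff_measure)
      finally show "emeasure N A \<le> emeasure (scale_measure K H) A" .
    qed
  qed
  then have "(\<integral>\<^sup>+x. g x * indicator (frontier \<Omega>) x \<partial>N) \<le> (\<integral>\<^sup>+x. g x * indicator (frontier \<Omega>) x \<partial>scale_measure K H)"
    by (intro nn_integral_mono_measure) (simp add: N_def setsH)
  also have "\<dots> = K * (\<integral>\<^sup>+x. g x * indicator (frontier \<Omega>) x \<partial>H)"
    by (rule nn_integral_scale_measure) measurable
  also have "(\<integral>\<^sup>+x. g x * indicator (frontier \<Omega>) x \<partial>H) = (\<integral>\<^sup>+x. g x \<partial>surf)"
    unfolding surface_measure_def H_def[symmetric]
    by (subst nn_integral_restrict_space) (auto simp: setsH sets_eq_imp_space_eq[OF setsH])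
  also have "(\<integral>\<^sup>+x. g x * indicator (frontier \<Omega>) x \<partial>N) = (\<integral>\<^sup>+x. indicator \<Omega> x * g (exit_point x) \<partial>lborel)"
    unfolding N_def using exit_point_frontier
    by (subst nn_integral_distr, measurable, subst nn_integral_density)
       (auto intro!: nn_integral_cong simp: indicator_def)
  finally show ?thesis unfolding K_def .
qed

text \<open>The factors 2 come from splitting the square of a sum into boundary value and line
  integral. Of the two factors \<open>R\<close>, one is due to Cauchy-Schwarz on the line, the other
  to Tonelli's theorem with translation invariance over all times up to \<open>R\<close>.\<close>

lemma friedrichs_smooth:
  assumes \<phi>: "smooth_on UNIV \<phi>"
  shows "(\<integral>\<^sup>+x. indicator \<Omega> x * ennreal ((\<phi> x)\<^sup>2) \<partial>lborel)
    \<le> ennreal (2 * (cylinder_factor (DIM('a) - 1) R)) * (\<integral>\<^sup>+x. ennreal ((\<phi> x)\<^sup>2) \<partial>surf)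
     + ennreal (2 * R\<^sup>2) * (\<integral>\<^sup>+x. indicator \<Omega> x * ennreal ((iter_deriv [b] \<phi> x)\<^sup>2) \<partial>lborel)"
proof -
  define f where "f = iter_deriv [b] \<phi>"
  have c\<phi>: "continuous_on UNIV \<phi>" and cf: "continuous_on UNIV f"
    using smooth_on_UNIV_continuous[OF \<phi>, of "[]"] smooth_on_UNIV_continuous[OF \<phi>, of "[b]"] b
    unfolding f_def by auto
  have [measurable]: "\<phi> \<in> borel_measurable borel" "f \<in> borel_measurable borel"
    using c\<phi> cf by (auto intro: borel_measurable_continuous_onI)
  have \<Omega>b[measurable]: "\<Omega> \<in> sets borel" using open_\<Omega> by simp
  have pt: "ennreal ((\<phi> x)\<^sup>2) \<le> ennreal 2 * ennreal ((\<phi> (exit_point x))\<^sup>2)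
     + ennreal (2 * R) * (\<integral>\<^sup>+s. indicator {0..R} s * (indicator \<Omega> (x + s *\<^sub>R b) * ennreal ((f (x + s *\<^sub>R b))\<^sup>2)) \<partial>lborel)" for x
  proof -
    define t where "t = exit_time x"
    have t: "0 \<le> t" "t \<le> R" unfolding t_def using exit_time by auto
    define h where "h s = f (x + s *\<^sub>R b)" for s
    have ch: "continuous_on UNIV h"
      unfolding h_def by (rule continuous_on_compose2[OF cf]) (auto intro!: continuous_intros)
    have [measurable]: "h \<in> borel_measurable borel" using ch by (rule borel_measurable_continuous_onI)
    have der: "((\<lambda>s. \<phi> (x + s *\<^sub>R b)) has_vector_derivative h s) (at s)" for s
    proof -
      have "((\<lambda>s. x + s *\<^sub>R b) has_derivative (\<lambda>s. s *\<^sub>R b)) (at s)"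
        by (auto intro!: derivative_eq_intros)
      from has_derivative_compose[OF this smooth_has_derivative[OF \<phi>]]
      have "((\<lambda>s. \<phi> (x + s *\<^sub>R b)) has_derivative (\<lambda>r. frechet_derivative \<phi> (at (x + s *\<^sub>R b)) (r *\<^sub>R b))) (at s)" .
      moreover have "frechet_derivative \<phi> (at (x + s *\<^sub>R b)) (r *\<^sub>R b) = r *\<^sub>R h s" for r
        using linear_cmul[OF has_derivative_linear[OF smooth_has_derivative[OF \<phi>]]] by (simp add: h_def f_def)
      ultimately show ?thesis by (simp add: has_vector_derivative_def)
    qed
    have "(LINT s|lborel. indicator {0..t} s *\<^sub>R h s) = \<phi> (x + t *\<^sub>R b) - \<phi> (x + 0 *\<^sub>R b)"
      by (rule integral_FTC_Icc[OF t(1)])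
         (auto intro: has_vector_derivative_at_within der continuous_on_subset[OF ch])
    then have eq: "\<phi> x = \<phi> (exit_point x) - (LINT s|lborel. indicator {0..t} s *\<^sub>R h s)"
      unfolding exit_point_def t_def by simp
    define I where "I = (LINT s|lborel. indicator {0..t} s *\<^sub>R h s)"
    have "(\<phi> x)\<^sup>2 \<le> 2 * (\<phi> (exit_point x))\<^sup>2 + 2 * I\<^sup>2"
      using norm_add_square_le[of "\<phi> (exit_point x)" "- I"] unfolding eq I_def by simp
    then have "ennreal ((\<phi> x)\<^sup>2) \<le> ennreal (2 * (\<phi> (exit_point x))\<^sup>2 + 2 * I\<^sup>2)" by (rule ennreal_leI)
    also have "\<dots> = ennreal 2 * ennreal ((\<phi> (exit_point x))\<^sup>2) + ennreal 2 * ennreal (I\<^sup>2)"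
      by (subst ennreal_plus) (auto simp: ennreal_mult)
    also have "ennreal (I\<^sup>2) \<le> ennreal t * (\<integral>\<^sup>+s. indicator {0..t} s * ennreal ((h s)\<^sup>2) \<partial>lborel)"
      unfolding I_def by (rule integral_square_le[OF ch t(1)])
    also have "\<dots> \<le> ennreal R * (\<integral>\<^sup>+s. indicator {0..R} s * (indicator \<Omega> (x + s *\<^sub>R b) * ennreal ((f (x + s *\<^sub>R b))\<^sup>2)) \<partial>lborel)"
    proof (intro mult_mono ennreal_leI t nn_integral_mono_AE)
      \<comment> \<open>Before the exit time the line is inside \<open>\<Omega>\<close>, so the
        indicator of \<open>\<Omega>\<close> can be inserted; the exit time itself is a single point
        and negligible.\<close>
      show "AE s in lborel. indicator {0..t} s * ennreal ((h s)\<^sup>2)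
        \<le> indicator {0..R} s * (indicator \<Omega> (x + s *\<^sub>R b) * ennreal ((f (x + s *\<^sub>R b))\<^sup>2))"
        using AE_lborel_singleton[of t]
      proof eventually_elim
        fix s assume "s \<noteq> t"
        then show "indicator {0..t} s * ennreal ((h s)\<^sup>2)
          \<le> indicator {0..R} s * (indicator \<Omega> (x + s *\<^sub>R b) * ennreal ((f (x + s *\<^sub>R b))\<^sup>2))"
          using exit_time(3)[of s x] t unfolding t_def[symmetric] h_def by (auto simp: indicator_def)
      qed
    qed auto
    finally have "ennreal ((\<phi> x)\<^sup>2) \<le> ennreal 2 * ennreal ((\<phi> (exit_point x))\<^sup>2)
     + ennreal 2 * (ennreal R * (\<integral>\<^sup>+s. indicator {0..R} s * (indicator \<Omega> (x + s *\<^sub>R b) * ennreal ((f (x + s *\<^sub>R b))\<^sup>2)) \<partial>lborel))"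
      by (simp add: add_left_mono mult_left_mono)
    then show ?thesis using R by (simp add: ennreal_mult mult.assoc)
  qed
  define G where "G x = indicator \<Omega> x * ennreal ((f x)\<^sup>2)" for x
  have [measurable]: "G \<in> borel_measurable borel" unfolding G_def by measurable
  \<comment> \<open>The range of \<open>s\<close> no longer depends on \<open>x\<close>, which is
    what makes the order of integration exchangeable. The indicator inside \<open>G\<close> confines
    the integrand to \<open>\<Omega>\<close>.\<close>
  define J where "J x = (\<integral>\<^sup>+s. indicator {0..R} s * G (x + s *\<^sub>R b) \<partial>lborel)" for x
  have Jm[measurable]: "J \<in> borel_measurable borel" unfolding J_def by measurable
  have "(\<integral>\<^sup>+x. indicator \<Omega> x * ennreal ((\<phi> x)\<^sup>2) \<partial>lborel)
    \<le> (\<integral>\<^sup>+x. ennreal 2 * (indicator \<Omega> x * ennreal ((\<phi> (exit_point x))\<^sup>2)) + ennreal (2 * R) * J x \<partial>lborel)"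
  proof (rule nn_integral_mono)
    fix x
    show "indicator \<Omega> x * ennreal ((\<phi> x)\<^sup>2)
      \<le> ennreal 2 * (indicator \<Omega> x * ennreal ((\<phi> (exit_point x))\<^sup>2)) + ennreal (2 * R) * J x"
      using pt[of x] unfolding J_def G_def by (cases "x \<in> \<Omega>") auto
  qed
  also have "\<dots> = ennreal 2 * (\<integral>\<^sup>+x. indicator \<Omega> x * ennreal ((\<phi> (exit_point x))\<^sup>2) \<partial>lborel)
      + ennreal (2 * R) * (\<integral>\<^sup>+x. J x \<partial>lborel)"
    by (subst nn_integral_add, measurable, subst (1 2) nn_integral_cmult, auto)
  also have "(\<integral>\<^sup>+x. indicator \<Omega> x * ennreal ((\<phi> (exit_point x))\<^sup>2) \<partial>lborel)
     \<le> ennreal (cylinder_factor (DIM('a) - 1) R) * (\<integral>\<^sup>+x. ennreal ((\<phi> x)\<^sup>2) \<partial>surf)"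
    by (rule nn_integral_exit_point_le) measurable
  also have "(\<integral>\<^sup>+x. J x \<partial>lborel) = ennreal R * (\<integral>\<^sup>+x. G x \<partial>lborel)"
  proof -
    have "(\<integral>\<^sup>+x. J x \<partial>lborel) = (\<integral>\<^sup>+s. (\<integral>\<^sup>+x. indicator {0..R} s * G (x + s *\<^sub>R b) \<partial>lborel) \<partial>lborel)"
      unfolding J_def by (rule lborel_pair.Fubini') measurable
    also have "\<dots> = (\<integral>\<^sup>+s. indicator {0..R} s * (\<integral>\<^sup>+x. G x \<partial>lborel) \<partial>lborel)"
    proof (rule nn_integral_cong)
      fix s :: real
      have "(\<integral>\<^sup>+x. G x \<partial>lborel) = (\<integral>\<^sup>+x. G x \<partial>distr lborel borel ((+) (s *\<^sub>R b)))" by (simp add: lborel_distr_plus)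
      also have "\<dots> = (\<integral>\<^sup>+x. G (x + s *\<^sub>R b) \<partial>lborel)" by (subst nn_integral_distr) (auto simp: add.commute)
      finally show "(\<integral>\<^sup>+x. indicator {0..R} s * G (x + s *\<^sub>R b) \<partial>lborel) = indicator {0..R} s * (\<integral>\<^sup>+x. G x \<partial>lborel)"
        by (subst nn_integral_cmult) auto
    qed
    also have "\<dots> = (\<integral>\<^sup>+s. indicator {0..R} s \<partial>lborel) * (\<integral>\<^sup>+x. G x \<partial>lborel)"
      by (rule nn_integral_multc) measurable
    also have "(\<integral>\<^sup>+s. indicator {0..R} s \<partial>lborel) = ennreal R" using R by simp
    finally show ?thesis .
  qed
  finally have "(\<integral>\<^sup>+x. indicator \<Omega> x * ennreal ((\<phi> x)\<^sup>2) \<partial>lborel)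
    \<le> ennreal 2 * (ennreal (cylinder_factor (DIM('a) - 1) R) * (\<integral>\<^sup>+x. ennreal ((\<phi> x)\<^sup>2) \<partial>surf))
     + ennreal (2 * R) * (ennreal R * (\<integral>\<^sup>+x. G x \<partial>lborel))"
    by (simp add: add_right_mono mult_left_mono)
  also have "ennreal (2 * R) * (ennreal R * (\<integral>\<^sup>+x. G x \<partial>lborel)) = ennreal (2 * R\<^sup>2) * (\<integral>\<^sup>+x. G x \<partial>lborel)"
    using R by (simp add: mult.assoc[symmetric] power2_eq_square flip: ennreal_mult)
  also have "ennreal 2 * (ennreal (cylinder_factor (DIM('a) - 1) R) * (\<integral>\<^sup>+x. ennreal ((\<phi> x)\<^sup>2) \<partial>surf))
    = ennreal (2 * (cylinder_factor (DIM('a) - 1) R)) * (\<integral>\<^sup>+x. ennreal ((\<phi> x)\<^sup>2) \<partial>surf)"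
    by (subst ennreal_mult'[of 2]) (auto simp: mult.assoc)
  finally show ?thesis unfolding G_def f_def .
qed

end

end

section \<open>Unique solvability\<close>

lemma l2norm_diff_le:
  assumes "square_integrable M f" "square_integrable M g"
  shows "\<bar>l2norm M f - l2norm M g\<bar> \<le> l2norm M (\<lambda>x. f x - g x)"
proof -
  have "l2norm M f \<le> l2norm M (\<lambda>x. f x - g x) + l2norm M g"
    using l2norm_triangle[OF square_integrable_diff[OF assms] assms(2)] by simp
  moreover have "l2norm M g \<le> l2norm M (\<lambda>x. g x - f x) + l2norm M f"
    using l2norm_triangle[OF square_integrable_diff[OF assms(2,1)] assms(1)] by simp
  ultimately show ?thesis using l2norm_minus_commute[of M f g] by linarith
qed

lemma square_integrable_bounded_mult:
  fixes F :: "'a \<Rightarrow> 'b::euclidean_space"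
  assumes h: "h \<in> borel_measurable M" "AE x in M. \<bar>h x\<bar> \<le> B" and F: "square_integrable M F" and B: "0 \<le> B"
  shows "square_integrable M (\<lambda>x. h x *\<^sub>R F x)" "l2norm M (\<lambda>x. h x *\<^sub>R F x) \<le> B * l2norm M F"
proof -
  note h(1)[measurable]
  have [measurable]: "F \<in> borel_measurable M" using F by (simp add: square_integrable_def)
  have int: "integrable M (\<lambda>x. B\<^sup>2 * (norm (F x))\<^sup>2)" using F by (simp add: square_integrable_def)
  have le: "AE x in M. (norm (h x *\<^sub>R F x))\<^sup>2 \<le> B\<^sup>2 * (norm (F x))\<^sup>2"
    using h(2)
  proof eventually_elim
    fix x assume "\<bar>h x\<bar> \<le> B"
    then have "\<bar>h x\<bar>\<^sup>2 \<le> B\<^sup>2" by (rule power_mono) simp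
    then show "(norm (h x *\<^sub>R F x))\<^sup>2 \<le> B\<^sup>2 * (norm (F x))\<^sup>2"
      by (simp add: power_mult_distrib mult_right_mono)
  qed
  have int2: "integrable M (\<lambda>x. (norm (h x *\<^sub>R F x))\<^sup>2)"
    by (rule Bochner_Integration.integrable_bound[OF int]) (use le in \<open>auto elim: AE_mp\<close>)
  then show "square_integrable M (\<lambda>x. h x *\<^sub>R F x)" by (simp add: square_integrable_def)
  have "(LINT x|M. (norm (h x *\<^sub>R F x))\<^sup>2) \<le> (LINT x|M. B\<^sup>2 * (norm (F x))\<^sup>2)"
    by (rule integral_mono_AE[OF int2 int le])
  then have "l2norm M (\<lambda>x. h x *\<^sub>R F x) \<le> sqrt (B\<^sup>2 * (LINT x|M. (norm (F x))\<^sup>2))"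
    unfolding l2norm_def by simp
  also have "\<dots> = B * l2norm M F" unfolding l2norm_def using B by (simp add: real_sqrt_mult)
  finally show "l2norm M (\<lambda>x. h x *\<^sub>R F x) \<le> B * l2norm M F" .
qed

section \<open>The Poincare inequality for functions of zero trace\<close>

context bounded_open_set
begin

lemma H1_norm_square:
  assumes "u \<in> H1 \<Omega>"
  shows "(H1norm u)\<^sup>2 = (l2norm vol u)\<^sup>2 + (l2norm vol (wgrad u))\<^sup>2"
proof -
  have "(l2norm vol (jet u))\<^sup>2 = (LINT x|vol. u x \<bullet> u x + wgrad u x \<bullet> wgrad u x)"
    unfolding l2norm_square jet_def by simp
  also have "\<dots> = (LINT x|vol. u x \<bullet> u x) + (LINT x|vol. wgrad u x \<bullet> wgrad u x)"
    using H1_square_integrable[OF assms] by (intro Bochner_Integration.integral_add square_integrable_inner)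
  finally show ?thesis unfolding H1_norm_eq_l2norm l2norm_square[of _ u] l2norm_square[of _ "wgrad u"] .
qed

lemma nn_integral_M_eq_lborel:
  assumes [measurable]: "g \<in> borel_measurable borel"
  shows "(\<integral>\<^sup>+x. g x \<partial>vol) = (\<integral>\<^sup>+x. indicator \<Omega> x * g x \<partial>lborel)"
proof -
  have [measurable]: "\<Omega> \<in> sets borel" using open_\<Omega> by simp
  have "(\<integral>\<^sup>+x. g x \<partial>vol) = (\<integral>\<^sup>+x. g x * indicator \<Omega> x \<partial>lebesgue)"
    by (rule nn_integral_restrict_space) simp
  also have "\<dots> = (\<integral>\<^sup>+x. g x * indicator \<Omega> x \<partial>lborel)"
    by (rule nn_integral_completion)
  finally show ?thesis by (simp add: mult.commute)
qed

lemma l2norm_weak_grad_diff_le: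
  assumes "u \<in> H1 \<Omega>" "v \<in> H1 \<Omega>"
  shows "\<bar>l2norm vol (wgrad u) - l2norm vol (wgrad v)\<bar> \<le> H1norm (\<lambda>x. u x - v x)"
proof -
  have "\<bar>l2norm vol (wgrad u) - l2norm vol (wgrad v)\<bar>
      \<le> l2norm vol (\<lambda>x. wgrad u x - wgrad v x)"
    by (intro l2norm_diff_le H1_square_integrable assms)
  also have "\<dots> = l2norm vol (wgrad (\<lambda>x. u x - v x))"
    using H1_add_scaled(2)[OF assms, of "-1"] H1_square_integrable[OF H1_diff[OF assms]] H1_square_integrable assms
    by (intro l2norm_cong_AE square_integrable_measurable square_integrable_diff) (auto simp: eq_commute)
  also have "\<dots> \<le> H1norm (\<lambda>x. u x - v x)" by (intro l2norm_le_H1_norm H1_diff assms)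
  finally show ?thesis .
qed

text \<open>Passage to the limit in \<open>friedrichs_smooth\<close> along the smooth functions that
  witness the zero trace: their boundary integrals tend to 0, and only the gradient term
  survives.\<close>

lemma poincare_H1_0:
  assumes dim: "2 \<le> DIM('a)"
  obtains C where "0 \<le> C" "\<And>v. v \<in> H1_0 \<Omega> \<Longrightarrow> (l2norm vol v)\<^sup>2 \<le> C * (l2norm vol (wgrad v))\<^sup>2"
proof -
  obtain b :: 'a where b: "b \<in> Basis" using nonempty_Basis by blast
  obtain r where r: "r > 0" "\<And>x. x \<in> \<Omega> \<Longrightarrow> norm x \<le> r" using bounded_\<Omega> unfolding bounded_pos by blast
  \<comment> \<open>More than the diameter of a ball containing \<open>\<Omega>\<close>, so that a
    line has left \<open>\<Omega>\<close> for good by the time \<open>R\<close>.\<close>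
  define R where "R = 2 * r + 1"
  have R: "R > 0" using r by (simp add: R_def)
  have far: "x + s *\<^sub>R b \<notin> \<Omega>" if "x \<in> \<Omega>" "R \<le> s" for x s
  proof
    assume "x + s *\<^sub>R b \<in> \<Omega>"
    then have "norm (x + s *\<^sub>R b) \<le> r" "norm x \<le> r" using r that by auto
    moreover have "norm (s *\<^sub>R b) \<le> norm (x + s *\<^sub>R b) + norm x"
      using norm_triangle_ineq4[of "x + s *\<^sub>R b" x] by simp
    moreover have "norm (s *\<^sub>R b) = s" using b that R by simp
    ultimately show False using that by (simp add: R_def)
  qed
  define K where "K = 2 * cylinder_factor (DIM('a) - 1) R"
  have smooth: "ennreal ((l2norm vol \<phi>)\<^sup>2) \<le> ennreal K * (\<integral>\<^sup>+x. ennreal ((\<phi> x)\<^sup>2) \<partial>surf)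
      + ennreal (2 * R\<^sup>2) * ennreal ((l2norm vol (wgrad \<phi>))\<^sup>2)" if \<phi>: "smooth_on UNIV \<phi>" for \<phi>
  proof -
    have c: "continuous_on UNIV \<phi>" "continuous_on UNIV (iter_deriv [b] \<phi>)"
      using smooth_on_UNIV_continuous[OF \<phi>, of "[]"] smooth_on_UNIV_continuous[OF \<phi>, of "[b]"] b by auto
    then have [measurable]: "\<phi> \<in> borel_measurable borel" "iter_deriv [b] \<phi> \<in> borel_measurable borel"
      by (auto intro: borel_measurable_continuous_onI simp del: iter_deriv.simps)
    note H = smooth_in_H1[OF \<phi>]
    have 1: "(\<integral>\<^sup>+x. indicator \<Omega> x * ennreal ((\<phi> x)\<^sup>2) \<partial>lborel) = ennreal ((l2norm vol \<phi>)\<^sup>2)"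
      using nn_integral_square_integrable[OF H1_square_integrable(1)[OF H(1)]]
      by (subst nn_integral_M_eq_lborel[symmetric]) auto
    have "(\<integral>\<^sup>+x. indicator \<Omega> x * ennreal ((iter_deriv [b] \<phi> x)\<^sup>2) \<partial>lborel)
       = (\<integral>\<^sup>+x. ennreal ((iter_deriv [b] \<phi> x)\<^sup>2) \<partial>vol)"
      by (subst nn_integral_M_eq_lborel) (auto simp del: iter_deriv.simps)
    also have "\<dots> \<le> (\<integral>\<^sup>+x. ennreal ((norm (wgrad \<phi> x))\<^sup>2) \<partial>vol)"
    proof (rule nn_integral_mono_AE, use H(2) in eventually_elim)
      fix x assume "wgrad \<phi> x = grad \<phi> x"
      then have "\<bar>iter_deriv [b] \<phi> x\<bar> \<le> norm (wgrad \<phi> x)"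
        using Basis_le_norm[OF b, of "grad \<phi> x"] by (simp add: grad_inner_Basis[OF b] del: iter_deriv.simps)
      then show "ennreal ((iter_deriv [b] \<phi> x)\<^sup>2) \<le> ennreal ((norm (wgrad \<phi> x))\<^sup>2)"
        by (intro ennreal_leI) (simp add: abs_le_square_iff[symmetric] del: iter_deriv.simps)
    qed
    also have "\<dots> = ennreal ((l2norm vol (wgrad \<phi>))\<^sup>2)"
      by (rule nn_integral_square_integrable[OF H1_square_integrable(2)[OF H(1)]])
    finally have 2: "(\<integral>\<^sup>+x. indicator \<Omega> x * ennreal ((iter_deriv [b] \<phi> x)\<^sup>2) \<partial>lborel)
      \<le> ennreal ((l2norm vol (wgrad \<phi>))\<^sup>2)" .
    have "ennreal ((l2norm vol \<phi>)\<^sup>2) \<le> ennreal K * (\<integral>\<^sup>+x. ennreal ((\<phi> x)\<^sup>2) \<partial>surf)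
      + ennreal (2 * R\<^sup>2) * (\<integral>\<^sup>+x. indicator \<Omega> x * ennreal ((iter_deriv [b] \<phi> x)\<^sup>2) \<partial>lborel)"
      using friedrichs_smooth[OF b R far dim \<phi>] unfolding 1 K_def by simp
    also have "\<dots> \<le> ennreal K * (\<integral>\<^sup>+x. ennreal ((\<phi> x)\<^sup>2) \<partial>surf)
      + ennreal (2 * R\<^sup>2) * ennreal ((l2norm vol (wgrad \<phi>))\<^sup>2)"
      by (intro add_left_mono mult_left_mono 2) simp
    finally show ?thesis .
  qed
  show thesis
  proof (rule that)
    show "0 \<le> 2 * R\<^sup>2" by simp
    fix v assume "v \<in> H1_0 \<Omega>"
    then obtain \<phi> where v: "v \<in> H1 \<Omega>" and \<phi>: "\<And>k. smooth_on UNIV (\<phi> k)"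
      and lim: "(\<lambda>k. H1norm (\<lambda>x. v x - \<phi> k x)) \<longlonglongrightarrow> 0"
      and lim0: "(\<lambda>k. \<integral>\<^sup>+x. ennreal ((0 - \<phi> k x)\<^sup>2) \<partial>surf) \<longlonglongrightarrow> 0"
      unfolding H1_0_def has_trace_def by blast
    have p: "\<phi> k \<in> H1 \<Omega>" for k using smooth_in_H1[OF \<phi>] by simp
    have l1: "(\<lambda>k. l2norm vol (\<phi> k)) \<longlonglongrightarrow> l2norm vol v"
    proof (rule LIM_zero_cancel, rule Lim_null_comparison[OF always_eventually lim], rule allI)
      fix k
      have "\<bar>l2norm vol v - l2norm vol (\<phi> k)\<bar> \<le> l2norm vol (\<lambda>x. v x - \<phi> k x)"
        by (intro l2norm_diff_le H1_square_integrable v p)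
      also have "\<dots> \<le> H1norm (\<lambda>x. v x - \<phi> k x)" by (intro l2norm_le_H1_norm H1_diff v p)
      finally show "norm (l2norm vol (\<phi> k) - l2norm vol v) \<le> H1norm (\<lambda>x. v x - \<phi> k x)" by simp
    qed
    have l2: "(\<lambda>k. l2norm vol (wgrad (\<phi> k))) \<longlonglongrightarrow> l2norm vol (wgrad v)"
    proof (rule LIM_zero_cancel, rule Lim_null_comparison[OF always_eventually lim], rule allI)
      fix k
      show "norm (l2norm vol (wgrad (\<phi> k)) - l2norm vol (wgrad v)) \<le> H1norm (\<lambda>x. v x - \<phi> k x)"
        using l2norm_weak_grad_diff_le[OF v p[of k]] by simp
    qed
    have limY: "(\<lambda>k. ennreal K * (\<integral>\<^sup>+x. ennreal ((0 - \<phi> k x)\<^sup>2) \<partial>surf)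
        + ennreal (2 * R\<^sup>2) * ennreal ((l2norm vol (wgrad (\<phi> k)))\<^sup>2)) \<longlonglongrightarrow>
        ennreal K * 0 + ennreal (2 * R\<^sup>2) * ennreal ((l2norm vol (wgrad v))\<^sup>2)"
      by (intro tendsto_add tendsto_mult_ennreal tendsto_const lim0 tendsto_ennrealI tendsto_power l2) auto
    have limX: "(\<lambda>k. ennreal ((l2norm vol (\<phi> k))\<^sup>2)) \<longlonglongrightarrow> ennreal ((l2norm vol v)\<^sup>2)"
      by (intro tendsto_ennrealI tendsto_power l1)
    have "ennreal ((l2norm vol v)\<^sup>2) \<le> ennreal K * 0 + ennreal (2 * R\<^sup>2) * ennreal ((l2norm vol (wgrad v))\<^sup>2)"
      by (rule LIMSEQ_le[OF limX limY]) (use smooth[OF \<phi>] in auto)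
    also have "\<dots> = ennreal (2 * R\<^sup>2 * (l2norm vol (wgrad v))\<^sup>2)"
      by (simp add: ennreal_mult)
    finally show "(l2norm vol v)\<^sup>2 \<le> 2 * R\<^sup>2 * (l2norm vol (wgrad v))\<^sup>2"
      by (subst (asm) ennreal_le_iff) auto
  qed
qed

section \<open>Weak solutions by minimization of energy\<close>

lemma admissible_form_add_scaled_left:
  "admissible_form a \<Longrightarrow> u \<in> H1 \<Omega> \<Longrightarrow> v \<in> H1 \<Omega> \<Longrightarrow> w \<in> H1 \<Omega> \<Longrightarrow>
     a (\<lambda>x. v x + c * w x) u = a v u + c * a w u"
  using admissible_form_add_scaled[of a u v w c] admissible_form_sym[of a] by metis

lemma admissible_form_square:
  assumes "admissible_form a" "u \<in> H1 \<Omega>" "v \<in> H1 \<Omega>"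
  shows "a (\<lambda>x. u x + c * v x) (\<lambda>x. u x + c * v x) = a u u + 2 * c * a u v + c\<^sup>2 * a v v"
proof -
  have "a (\<lambda>x. u x + c * v x) (\<lambda>x. u x + c * v x) = a (\<lambda>x. u x + c * v x) u + c * a (\<lambda>x. u x + c * v x) v"
    by (intro admissible_form_add_scaled H1_add_scaled assms)
  then show ?thesis
    using admissible_form_add_scaled_left[OF assms(1,2,2,3), of c]
      admissible_form_add_scaled_left[OF assms(1,3,2,3), of c] admissible_form_sym[OF assms(1), of v u]
    by (simp add: power2_eq_square algebra_simps)
qed

text \<open>A minimizing sequence of the energy \<open>J\<close> is Cauchy by the parallelogram law. The weak equation is read
  off from \<open>m \<le> J (v k + t w)\<close> by letting \<open>k\<close> tend to infinity first.\<close>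

lemma coercive_weak_solution_exists:
  assumes a: "admissible_form a" and c: "0 < c"
    and coercive: "\<And>v. v \<in> H1_0 \<Omega> \<Longrightarrow> c * (H1norm v)\<^sup>2 \<le> a v v"
    and u0: "has_trace \<Omega> u0 f"
  shows "\<exists>u. weak_solution \<Omega> a f u"
proof -
  have u0H: "u0 \<in> H1 \<Omega>" by (rule has_trace_H1[OF u0])
  obtain C where C: "C \<ge> 0" "\<And>u v. u \<in> H1 \<Omega> \<Longrightarrow> v \<in> H1 \<Omega> \<Longrightarrow> \<bar>a u v\<bar> \<le> C * H1norm u * H1norm v"
    using a unfolding admissible_form_def by blast
  \<comment> \<open>The energy of \<open>u0 + v\<close>, expanded, so that the minimization runs
    over the linear space of zero-trace functions.\<close>
  define J where "J v = a u0 u0 + 2 * a u0 v + a v v" for v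
  define m where "m = Inf (J ` H1_0 \<Omega>)"
  have zero: "(\<lambda>_. 0) \<in> H1_0 \<Omega>"
    using has_trace_same_diff[OF u0 u0] by simp
  \<comment> \<open>Coercivity bounds the quadratic term from below and boundedness the linear one;
    completing the square in the norm \<open>n\<close> gives a bound independent of
    \<open>v\<close>.\<close>
  have Jlow: "a u0 u0 - (C * H1norm u0)\<^sup>2 / c \<le> J v" if v: "v \<in> H1_0 \<Omega>" for v
  proof -
    define n where "n = H1norm v"
    define B where "B = C * H1norm u0"
    have "- (B * n) \<le> a u0 v" using C(2)[OF u0H H1_0_H1[OF v]] by (simp add: B_def n_def)
    moreover have "c * n\<^sup>2 \<le> a v v" using coercive[OF v] by (simp add: n_def)
    moreover have "c * n\<^sup>2 - 2 * (B * n) + B\<^sup>2 / c = (c * n - B)\<^sup>2 / c"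
      using c by (simp add: power2_eq_square field_simps)
    then have "0 \<le> c * n\<^sup>2 - 2 * (B * n) + B\<^sup>2 / c" using c by simp
    ultimately show ?thesis unfolding J_def B_def[symmetric] by linarith
  qed
  have bdd: "bdd_below (J ` H1_0 \<Omega>)" using Jlow by (intro bdd_belowI2)
  have mle: "m \<le> J v" if "v \<in> H1_0 \<Omega>" for v
    unfolding m_def using bdd that by (intro cInf_lower) auto
  have "\<exists>v\<in>H1_0 \<Omega>. J v < m + inverse (real (Suc k))" for k
  proof -
    have "\<exists>x\<in>J ` H1_0 \<Omega>. x < m + inverse (real (Suc k))"
      unfolding m_def using zero by (intro cInf_lessD) auto
    then show ?thesis by blast
  qed
  then have "\<forall>k. \<exists>v. v \<in> H1_0 \<Omega> \<and> J v < m + inverse (real (Suc k))" by blast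
  from choice[OF this] obtain v where v: "\<And>k. v k \<in> H1_0 \<Omega>" "\<And>k. J (v k) < m + inverse (real (Suc k))" by blast
  have vH: "v k \<in> H1 \<Omega>" for k by (rule H1_0_H1[OF v(1)])
  have vary: "- inverse (real (Suc k)) \<le> 2 * t * (a u0 w + a (v k) w) + t\<^sup>2 * a w w" if w: "w \<in> H1_0 \<Omega>" for k w t
  proof -
    have wH: "w \<in> H1 \<Omega>" by (rule H1_0_H1[OF w])
    have "m \<le> J (\<lambda>x. v k x + t * w x)" by (intro mle H1_0_add_scaled v w)
    also have "\<dots> = J (v k) + 2 * t * (a u0 w + a (v k) w) + t\<^sup>2 * a w w"
      unfolding J_def admissible_form_square[OF a vH wH] admissible_form_add_scaled[OF a u0H vH wH]
      by (simp add: algebra_simps)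
    finally show ?thesis using v(2)[of k] by linarith
  qed
  have dist: "c / 4 * (H1norm (\<lambda>x. v i x - v j x))\<^sup>2 \<le> (inverse (real (Suc i)) + inverse (real (Suc j))) / 2" for i j
  proof -
    define w where "w x = v j x - v i x" for x
    have w: "w \<in> H1_0 \<Omega>" using H1_0_add_scaled[OF v(1)[of j] v(1)[of i], of "-1"] by (simp add: w_def[abs_def])
    have wH: "w \<in> H1 \<Omega>" by (rule H1_0_H1[OF w])
    have J': "J (\<lambda>x. v i x + s * w x) = J (v i) + 2 * s * (a u0 w + a (v i) w) + s\<^sup>2 * a w w" for s
      unfolding J_def admissible_form_square[OF a vH wH] admissible_form_add_scaled[OF a u0H vH wH]
      by (simp add: algebra_simps)
    have eqj: "(\<lambda>x. v i x + 1 * w x) = v j" by (auto simp: w_def)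
    \<comment> \<open>The midpoint has energy at least \<open>m\<close>, whereas both endpoints are
      nearly minimal. The endpoint energies exceed twice the midpoint energy by exactly
      \<open>a w w / 2\<close>, which therefore has to be small.\<close>
    have "m \<le> J (\<lambda>x. v i x + 1/2 * w x)" by (intro mle H1_0_add_scaled v w)
    also have "\<dots> = J (v i) + (a u0 w + a (v i) w) + a w w / 4"
      unfolding J'[of "1/2"] by (simp add: power2_eq_square)
    finally have "m \<le> J (v i) + (a u0 w + a (v i) w) + a w w / 4" .
    moreover have "J (v j) = J (v i) + 2 * (a u0 w + a (v i) w) + a w w"
      using J'[of 1] unfolding eqj by simp
    moreover have "c * (H1norm w)\<^sup>2 \<le> a w w" by (rule coercive[OF w])
    moreover have "X / 4 \<le> (p + r) / 2" if "m \<le> I + A + W / 4" "K = I + 2 * A + W" "X \<le> W" "I < m + p" "K < m + r"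
      for X p r I A W K :: real
      using that by (simp add: field_simps)
    ultimately have "c * (H1norm w)\<^sup>2 / 4 \<le> (inverse (real (Suc i)) + inverse (real (Suc j))) / 2"
      using v(2)[of i] v(2)[of j] by blast
    moreover have "H1norm w = H1norm (\<lambda>x. v i x - v j x)"
      unfolding w_def[abs_def] by (rule H1_norm_minus_commute[OF vH vH])
    ultimately show ?thesis by simp
  qed
  have cauchy: "\<exists>N. \<forall>i\<ge>N. \<forall>j\<ge>N. H1norm (\<lambda>x. v i x - v j x) < \<epsilon>" if "0 < \<epsilon>" for \<epsilon>
  proof -
    have "0 < c / 4 * \<epsilon>\<^sup>2" using c that by simp
    then obtain N where N: "inverse (real (Suc N)) < c / 4 * \<epsilon>\<^sup>2" using reals_Archimedean by blast
    have "H1norm (\<lambda>x. v i x - v j x) < \<epsilon>" if ij: "i \<ge> N" "j \<ge> N" for i j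
    proof -
      have "inverse (real (Suc i)) \<le> inverse (real (Suc N))" "inverse (real (Suc j)) \<le> inverse (real (Suc N))"
        using ij by (auto intro!: le_imp_inverse_le)
      then have "(inverse (real (Suc i)) + inverse (real (Suc j))) / 2 \<le> inverse (real (Suc N))"
        unfolding divide_le_eq_numeral1 mult_2_right by (rule add_mono)
      then have "c / 4 * (H1norm (\<lambda>x. v i x - v j x))\<^sup>2 < c / 4 * \<epsilon>\<^sup>2"
        using dist[of i j] N by (meson le_less_trans)
      then have "(H1norm (\<lambda>x. v i x - v j x))\<^sup>2 < \<epsilon>\<^sup>2" using c by simp
      then show ?thesis by (rule power2_less_imp_less) (use \<open>0 < \<epsilon>\<close> in simp)
    qed
    then show ?thesis by blast
  qed
  obtain z where z: "z \<in> H1 \<Omega>" and lim: "(\<lambda>k. H1norm (\<lambda>x. v k x - z x)) \<longlonglongrightarrow> 0"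
    using H1_complete[of v, OF vH cauchy] .
  have z0: "z \<in> H1_0 \<Omega>" by (rule H1_0_closed[OF v(1) z lim])
  define u where "u x = u0 x + z x" for x
  have ut: "has_trace \<Omega> u f" unfolding u_def by (rule has_trace_add_H1_0[OF u0 z0])
  have "a u w = 0" if w: "w \<in> H1_0 \<Omega>" for w
  proof -
    have wH: "w \<in> H1 \<Omega>" by (rule H1_0_H1[OF w])
    have "a u w = a u0 w + a z w"
      using admissible_form_add_scaled_left[OF a wH u0H z, of 1] by (simp add: u_def[abs_def])
    have conv: "(\<lambda>k. a (v k) w) \<longlonglongrightarrow> a z w"
    proof (rule LIM_zero_cancel, rule Lim_null_comparison[OF always_eventually], rule allI)
      fix k
      have "a (v k) w - a z w = a (\<lambda>x. v k x - z x) w"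
        using admissible_form_add_scaled_left[OF a wH vH z, of k "-1"] by simp
      then show "norm (a (v k) w - a z w) \<le> C * H1norm (\<lambda>x. v k x - z x) * H1norm w"
        using C(2)[OF H1_diff[OF vH z] wH, of k] by simp
    next
      show "(\<lambda>k. C * H1norm (\<lambda>x. v k x - z x) * H1norm w) \<longlonglongrightarrow> 0"
        by (intro tendsto_mult_left_zero tendsto_mult_right_zero lim)
    qed
    have "0 \<le> 0 + 2 * t * a u w + t\<^sup>2 * a w w" for t
    proof (rule LIMSEQ_le)
      show "(\<lambda>k. - inverse (real (Suc k))) \<longlonglongrightarrow> 0" using tendsto_minus[OF LIMSEQ_inverse_real_of_nat] by simp
      have "(\<lambda>k. 2 * t * (a u0 w + a (v k) w) + t\<^sup>2 * a w w) \<longlonglongrightarrow> 2 * t * (a u0 w + a z w) + t\<^sup>2 * a w w"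
        by (intro tendsto_intros conv)
      then show "(\<lambda>k. 2 * t * (a u0 w + a (v k) w) + t\<^sup>2 * a w w) \<longlonglongrightarrow> 0 + 2 * t * a u w + t\<^sup>2 * a w w"
        using \<open>a u w = a u0 w + a z w\<close> by simp
      show "\<exists>N. \<forall>k\<ge>N. - inverse (real (Suc k)) \<le> 2 * t * (a u0 w + a (v k) w) + t\<^sup>2 * a w w"
        using vary[OF w] by blast
    qed
    moreover have "0 \<le> a w w" using coercive[OF w] c by (meson mult_nonneg_nonneg less_imp_le order_trans zero_le_power2)
    \<comment> \<open>A nonnegative quadratic without constant term has no linear term
      either.\<close>
    ultimately have "(a u w)\<^sup>2 \<le> 0 * a w w" by (rule quadratic_nonneg_imp_discriminant)
    then show ?thesis by simp
  qed
  then show ?thesis using ut unfolding weak_solution_def by blast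
qed

text \<open>For uniqueness, the difference of two solutions has zero trace, so it may be used as a
  test function against itself; its energy is 0 and coercivity makes its norm vanish.\<close>

lemma coercive_uniquely_solvable:
  assumes a: "admissible_form a" and c: "0 < c"
    and coercive: "\<And>v. v \<in> H1_0 \<Omega> \<Longrightarrow> c * (H1norm v)\<^sup>2 \<le> a v v"
  shows "uniquely_solvable \<Omega> a"
  unfolding uniquely_solvable_def
proof (intro ballI conjI allI impI)
  fix f assume "f \<in> Hhalf \<Omega>"
  then obtain u0 where "has_trace \<Omega> u0 f" unfolding Hhalf_def by blast
  then show "\<exists>u. weak_solution \<Omega> a f u"
    by (rule coercive_weak_solution_exists[OF a c, rotated]) (rule coercive)
next
  fix f u u' assume u: "weak_solution \<Omega> a f u" and u': "weak_solution \<Omega> a f u'"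
  have uH: "u \<in> H1 \<Omega>" "u' \<in> H1 \<Omega>" using u u' has_trace_H1 unfolding weak_solution_def by auto
  have w: "(\<lambda>x. u x - u' x) \<in> H1_0 \<Omega>"
    using u u' unfolding weak_solution_def by (blast intro: has_trace_same_diff)
  have wH: "(\<lambda>x. u x - u' x) \<in> H1 \<Omega>" by (rule H1_0_H1[OF w])
  have "a (\<lambda>x. u x - u' x) (\<lambda>x. u x - u' x) = a u (\<lambda>x. u x - u' x) - a u' (\<lambda>x. u x - u' x)"
    using admissible_form_add_scaled_left[OF a wH uH, of "-1"] by simp
  also have "\<dots> = 0" using u u' w unfolding weak_solution_def by simp
  finally have "c * (H1norm (\<lambda>x. u x - u' x))\<^sup>2 \<le> 0" using coercive[OF w] by simp
  then have "(H1norm (\<lambda>x. u x - u' x))\<^sup>2 \<le> 0" using c by (simp add: mult_le_0_iff)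
  then have "H1norm (\<lambda>x. u x - u' x) = 0" by simp
  then have "l2norm vol (\<lambda>x. u x - u' x) = 0"
    using l2norm_le_H1_norm(1)[OF wH] l2norm_nonneg[of vol "\<lambda>x. u x - u' x"] by simp
  then have "AE x in vol. u x - u' x = 0"
    using l2norm_eq_0_imp_AE H1_square_integrable(1)[OF wH] by blast
  then show "AE x in vol. u x = u' x" by eventually_elim simp
qed

section \<open>Boundedness of the conductivity and Schroedinger forms\<close>

lemma conductivity_form_admissible:
  assumes \<gamma>: "\<gamma> \<in> borel_measurable vol" "AE x in vol. \<bar>\<gamma> x\<bar> \<le> B" and B: "0 \<le> B"
  shows "admissible_form (conductivity_form \<Omega> \<gamma>)"
proof -
  note \<gamma>(1)[measurable]
  note sm = square_integrable_bounded_mult[OF \<gamma> _ B]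
  have eq: "conductivity_form \<Omega> \<gamma> u v = (LINT x|vol. (\<gamma> x *\<^sub>R wgrad u x) \<bullet> wgrad v x)" for u v
    unfolding conductivity_form_def by simp
  show ?thesis
    unfolding admissible_form_def
  proof (intro conjI allI ballI exI[of _ B])
    show "conductivity_form \<Omega> \<gamma> u v = conductivity_form \<Omega> \<gamma> v u" for u v
      unfolding conductivity_form_def by (simp add: inner_commute)
  next
    fix u v w c assume u: "u \<in> H1 \<Omega>" and v: "v \<in> H1 \<Omega>" and w: "w \<in> H1 \<Omega>"
    note g = sm(1)[OF H1_square_integrable(2)[OF u]] H1_square_integrable(2)[OF v] H1_square_integrable(2)[OF w]
      H1_square_integrable(2)[OF H1_add_scaled(1)[OF v w, of c]]
    have [measurable]: "(\<lambda>x. \<gamma> x *\<^sub>R wgrad u x) \<in> borel_measurable vol" "wgrad v \<in> borel_measurable vol"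
      "wgrad w \<in> borel_measurable vol" "wgrad (\<lambda>x. v x + c * w x) \<in> borel_measurable vol"
      using g by (auto simp: square_integrable_def)
    have "(LINT x|vol. (\<gamma> x *\<^sub>R wgrad u x) \<bullet> wgrad (\<lambda>x. v x + c * w x) x)
     = (LINT x|vol. (\<gamma> x *\<^sub>R wgrad u x) \<bullet> wgrad v x + c * ((\<gamma> x *\<^sub>R wgrad u x) \<bullet> wgrad w x))"
    proof (rule integral_cong_AE)
      show "AE x in vol. (\<gamma> x *\<^sub>R wgrad u x) \<bullet> wgrad (\<lambda>x. v x + c * w x) x
        = (\<gamma> x *\<^sub>R wgrad u x) \<bullet> wgrad v x + c * ((\<gamma> x *\<^sub>R wgrad u x) \<bullet> wgrad w x)"
        using H1_add_scaled(2)[OF v w, of c] by eventually_elim (simp add: inner_add_right algebra_simps)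
    qed measurable
    also have "\<dots> = (LINT x|vol. (\<gamma> x *\<^sub>R wgrad u x) \<bullet> wgrad v x)
        + c * (LINT x|vol. (\<gamma> x *\<^sub>R wgrad u x) \<bullet> wgrad w x)"
      by (subst Bochner_Integration.integral_add)
         (use square_integrable_inner[OF g(1,2)] square_integrable_inner[OF g(1,3)] in auto)
    finally show "conductivity_form \<Omega> \<gamma> u (\<lambda>x. v x + c * w x) = conductivity_form \<Omega> \<gamma> u v + c * conductivity_form \<Omega> \<gamma> u w"
      unfolding eq .
  next
    fix u v assume u: "u \<in> H1 \<Omega>" and v: "v \<in> H1 \<Omega>"
    have "\<bar>conductivity_form \<Omega> \<gamma> u v\<bar> \<le> l2norm vol (\<lambda>x. \<gamma> x *\<^sub>R wgrad u x) * l2norm vol (wgrad v)"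
      unfolding eq by (intro l2norm_Cauchy_Schwarz sm H1_square_integrable u v)
    also have "\<dots> \<le> (B * l2norm vol (wgrad u)) * l2norm vol (wgrad v)"
      by (intro mult_right_mono sm H1_square_integrable u l2norm_nonneg)
    also have "\<dots> \<le> (B * H1norm u) * H1norm v"
      by (intro mult_mono mult_left_mono l2norm_le_H1_norm u v B H1_norm_nonneg l2norm_nonneg mult_nonneg_nonneg)
    finally show "\<bar>conductivity_form \<Omega> \<gamma> u v\<bar> \<le> B * H1norm u * H1norm v" .
  qed (rule B)
qed

lemma schroedinger_form_eq:
  assumes "integrable vol (\<lambda>x. q x * u x * v x)" "u \<in> H1 \<Omega>" "v \<in> H1 \<Omega>"
  shows "schroedinger_form \<Omega> q u v
    = conductivity_form \<Omega> (\<lambda>_. 1) u v + (LINT x|vol. q x * u x * v x)"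
  unfolding schroedinger_form_def conductivity_form_def
  using assms(1) square_integrable_inner[OF H1_square_integrable(2)[OF assms(2)] H1_square_integrable(2)[OF assms(3)]]
  by simp

lemma schroedinger_form_admissible:
  assumes q: "\<And>u v. u \<in> H1 \<Omega> \<Longrightarrow> v \<in> H1 \<Omega> \<Longrightarrow> integrable vol (\<lambda>x. q x * u x * v x)"
    and bound: "\<And>u v. u \<in> H1 \<Omega> \<Longrightarrow> v \<in> H1 \<Omega> \<Longrightarrow>
      \<bar>LINT x|vol. q x * u x * v x\<bar> \<le> C * H1norm u * H1norm v"
  shows "admissible_form (schroedinger_form \<Omega> q)"
proof -
  \<comment> \<open>The Dirichlet integral is the conductivity form of the constant coefficient 1,
    so only the potential term needs separate treatment.\<close>
  have a: "admissible_form (conductivity_form \<Omega> (\<lambda>_. 1))"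
    by (rule conductivity_form_admissible[where B = 1]) auto
  obtain D where D: "0 \<le> D" "\<And>u v. u \<in> H1 \<Omega> \<Longrightarrow> v \<in> H1 \<Omega> \<Longrightarrow>
      \<bar>conductivity_form \<Omega> (\<lambda>_. 1) u v\<bar> \<le> D * H1norm u * H1norm v"
    using a unfolding admissible_form_def by blast
  note eq = schroedinger_form_eq[OF q]
  show ?thesis
    unfolding admissible_form_def
  \<comment> \<open>The given constant \<open>C\<close> comes without a sign; its absolute value is
    a valid bound because Sobolev norms are nonnegative.\<close>
  proof (intro conjI allI ballI exI[of _ "D + \<bar>C\<bar>"])
    show "schroedinger_form \<Omega> q u v = schroedinger_form \<Omega> q v u" for u v
      unfolding schroedinger_form_def by (simp add: inner_commute mult.commute mult.left_commute)
  next
    fix u v w c assume u: "u \<in> H1 \<Omega>" and v: "v \<in> H1 \<Omega>" and w: "w \<in> H1 \<Omega>"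
    note vw = H1_add_scaled(1)[OF v w, of c]
    have "(LINT x|vol. q x * u x * (v x + c * w x)) = (LINT x|vol. q x * u x * v x + c * (q x * u x * w x))"
      by (intro Bochner_Integration.integral_cong) (auto simp: algebra_simps)
    also have "\<dots> = (LINT x|vol. q x * u x * v x) + c * (LINT x|vol. q x * u x * w x)"
      using q[OF u v] q[OF u w] by simp
    finally show "schroedinger_form \<Omega> q u (\<lambda>x. v x + c * w x) = schroedinger_form \<Omega> q u v + c * schroedinger_form \<Omega> q u w"
      unfolding eq[OF u v u v] eq[OF u w u w] eq[OF u vw u vw]
      using admissible_form_add_scaled[OF a u v w, of c] by (simp add: algebra_simps)
  next
    fix u v assume u: "u \<in> H1 \<Omega>" and v: "v \<in> H1 \<Omega>"
    have "C * (H1norm u * H1norm v) \<le> \<bar>C\<bar> * (H1norm u * H1norm v)"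
      by (intro mult_right_mono mult_nonneg_nonneg H1_norm_nonneg) simp
    then show "\<bar>schroedinger_form \<Omega> q u v\<bar> \<le> (D + \<bar>C\<bar>) * H1norm u * H1norm v"
      unfolding eq[OF u v u v] using D(2)[OF u v] bound[OF u v] by (simp add: algebra_simps)
  qed (use D(1) in simp)
qed

lemma schroedinger_dn_defined_admissible:
  assumes "schroedinger_dn_defined \<Omega> q" shows "admissible_form (schroedinger_form \<Omega> q)"
proof -
  obtain C where "\<forall>u\<in>H1 \<Omega>. \<forall>v\<in>H1 \<Omega>. integrable vol (\<lambda>x. q x * u x * v x) \<and>
        \<bar>LINT x|vol. q x * u x * v x\<bar> \<le> C * H1norm u * H1norm v"
    using assms unfolding schroedinger_dn_defined_def by blast
  then show ?thesis by (intro schroedinger_form_admissible) blast+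
qed

end

section \<open>Borel measurability of the boundary data\<close>

lemma openin_imp_borel_of: "openin X U \<Longrightarrow> U \<in> sets (borel_of X)"
  unfolding borel_of_def using openin_subset by (auto simp: sets_measure_of_conv intro: sigma_sets.Basic)

lemma space_borel_of: "space (borel_of X) = topspace X"
  unfolding borel_of_def by (rule space_measure_of) (use openin_subset in blast)

section \<open>Independence of the chosen representative\<close>

context bounded_open_set
begin

lemma rep_ae_class:
  assumes "q \<in> borel_measurable vol"
  shows "rep (ae_class \<Omega> q) \<in> borel_measurable vol" "AE x in vol. rep (ae_class \<Omega> q) x = q x"
proof -
  have "q \<in> ae_class \<Omega> q" using assms unfolding ae_class_def by simp
  then have "rep (ae_class \<Omega> q) \<in> ae_class \<Omega> q" unfolding rep_def by (rule someI[where P = "\<lambda>r. r \<in> ae_class \<Omega> q"])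
  then show "rep (ae_class \<Omega> q) \<in> borel_measurable vol" "AE x in vol. rep (ae_class \<Omega> q) x = q x"
    unfolding ae_class_def by auto
qed

text \<open>Coefficients that agree almost everywhere define the same form on
  \<open>H1 \<Omega>\<close>, so the choice made by \<open>rep\<close> is invisible.\<close>

lemma schroedinger_dn_ae_class:
  assumes q: "q \<in> borel_measurable vol"
  shows "schroedinger_dn \<Omega> (ae_class \<Omega> q) = dn_map \<Omega> (schroedinger_form \<Omega> q)"
  unfolding schroedinger_dn_def
proof (rule dn_map_cong)
  fix u v assume "u \<in> H1 \<Omega>" "v \<in> H1 \<Omega>"
  note uv = H1_square_integrable[OF this(1)] H1_square_integrable[OF this(2)]
  note [measurable] = rep_ae_class(1)[OF q] q uv[THEN square_integrable_measurable]
  show "schroedinger_form \<Omega> (rep (ae_class \<Omega> q)) u v = schroedinger_form \<Omega> q u v"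
    unfolding schroedinger_form_def
    by (rule integral_cong_AE, measurable, use rep_ae_class(2)[OF q] in eventually_elim) simp
qed

lemma conductivity_dn_ae_class:
  assumes q: "q \<in> borel_measurable vol"
  shows "conductivity_dn \<Omega> (ae_class \<Omega> q) = dn_map \<Omega> (conductivity_form \<Omega> q)"
  unfolding conductivity_dn_def
proof (rule dn_map_cong)
  fix u v assume "u \<in> H1 \<Omega>" "v \<in> H1 \<Omega>"
  note uv = H1_square_integrable[OF this(1)] H1_square_integrable[OF this(2)]
  note [measurable] = rep_ae_class(1)[OF q] q uv[THEN square_integrable_measurable]
  show "conductivity_form \<Omega> (rep (ae_class \<Omega> q)) u v = conductivity_form \<Omega> q u v"
    unfolding conductivity_form_def
    by (rule integral_cong_AE, measurable, use rep_ae_class(2)[OF q] in eventually_elim) simp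
qed

text \<open>Common to both equations: \<open>D\<close> singles out the coefficients with a
  well-defined map, \<open>F\<close> gives their forms, and \<open>dn\<close> is the map on
  almost-everywhere classes.\<close>

lemma dn_of_class_determined:
  assumes F: "\<And>p. D p \<Longrightarrow> dn (ae_class \<Omega> p) = dn_map \<Omega> (F p)"
      "\<And>p. D p \<Longrightarrow> admissible_form (F p)" "\<And>p. D p \<Longrightarrow> uniquely_solvable \<Omega> (F p)"
    and f: "dense_seq_Hhalf \<Omega> f" and X: "X \<in> ae_class \<Omega> ` {p. D p}" "Y \<in> ae_class \<Omega> ` {p. D p}"
    and eq: "dn_matrix f (dn X) = dn_matrix f (dn Y)"
  shows "dn X = dn Y"
proof -
  obtain p q where p: "D p" "X = ae_class \<Omega> p" and q: "D q" "Y = ae_class \<Omega> q"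
    using X by blast
  have dn: "dn X = dn_map \<Omega> (F p)" "dn Y = dn_map \<Omega> (F q)" using p q F(1) by auto
  show ?thesis
    unfolding dn by (rule dn_map_determined[OF F(2,3)[OF p(1)] F(2,3)[OF q(1)] f eq[unfolded dn]])
qed

lemma schroedinger_dn_determined:
  assumes "dense_seq_Hhalf \<Omega> f" "X \<in> schroedinger_potentials \<Omega>" "Y \<in> schroedinger_potentials \<Omega>"
    and "dn_matrix f (schroedinger_dn \<Omega> X) = dn_matrix f (schroedinger_dn \<Omega> Y)"
  shows "schroedinger_dn \<Omega> X = schroedinger_dn \<Omega> Y"
proof (rule dn_of_class_determined[where D = "schroedinger_dn_defined \<Omega>" and F = "schroedinger_form \<Omega>",
      OF _ schroedinger_dn_defined_admissible _ assms(1) _ _ assms(4)])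
  show "schroedinger_dn \<Omega> (ae_class \<Omega> p) = dn_map \<Omega> (schroedinger_form \<Omega> p)" if "schroedinger_dn_defined \<Omega> p" for p
    using that unfolding schroedinger_dn_defined_def by (intro schroedinger_dn_ae_class) blast
qed (use assms(2,3) in \<open>auto simp: schroedinger_dn_defined_def schroedinger_potentials_def\<close>)

lemma conductivity_dn_defined_admissible:
  assumes "conductivity_dn_defined \<Omega> \<gamma>" shows "admissible_form (conductivity_form \<Omega> \<gamma>)"
proof -
  obtain C where "\<gamma> \<in> borel_measurable vol" "AE x in vol. 0 < \<gamma> x \<and> \<gamma> x \<le> C"
    using assms unfolding conductivity_dn_defined_def by blast
  then show ?thesis
    \<comment> \<open>If \<open>\<Omega>\<close> is empty, the almost-everywhere bound holds for
      negative \<open>C\<close> as well, and \<open>max C 0\<close> repairs the sign.\<close>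
    by (intro conductivity_form_admissible[where B = "max C 0"]) (auto elim!: AE_mp)
qed

lemma conductivity_dn_determined:
  assumes "dense_seq_Hhalf \<Omega> f" "X \<in> conductivities \<Omega>" "Y \<in> conductivities \<Omega>"
    and "dn_matrix f (conductivity_dn \<Omega> X) = dn_matrix f (conductivity_dn \<Omega> Y)"
  shows "conductivity_dn \<Omega> X = conductivity_dn \<Omega> Y"
proof (rule dn_of_class_determined[where D = "conductivity_dn_defined \<Omega>" and F = "conductivity_form \<Omega>",
      OF _ conductivity_dn_defined_admissible _ assms(1) _ _ assms(4)])
  show "conductivity_dn \<Omega> (ae_class \<Omega> p) = dn_map \<Omega> (conductivity_form \<Omega> p)" if "conductivity_dn_defined \<Omega> p" for p
    using that unfolding conductivity_dn_defined_def by (intro conductivity_dn_ae_class) blast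
qed (use assms(2,3) in \<open>auto simp: conductivity_dn_defined_def conductivities_def\<close>)

section \<open>Bounded nonnegative potentials\<close>

lemma bounded_potential:
  assumes q: "q \<in> borel_measurable vol" "\<forall>x\<in>\<Omega>. \<bar>q x\<bar> \<le> B" and B: "0 \<le> B"
    and u: "u \<in> H1 \<Omega>" and v: "v \<in> H1 \<Omega>"
  shows "integrable vol (\<lambda>x. q x * u x * v x)"
    "\<bar>LINT x|vol. q x * u x * v x\<bar> \<le> B * H1norm u * H1norm v"
proof -
  have ae: "AE x in vol. \<bar>q x\<bar> \<le> B" using q(2) by (intro AE_I2) simp
  note s = square_integrable_bounded_mult[OF q(1) ae H1_square_integrable(1)[OF u] B]
  show "integrable vol (\<lambda>x. q x * u x * v x)"
    using square_integrable_inner[OF s(1) H1_square_integrable(1)[OF v]] by simp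
  have "\<bar>LINT x|vol. q x * u x * v x\<bar> \<le> l2norm vol (\<lambda>x. q x *\<^sub>R u x) * l2norm vol v"
    using l2norm_Cauchy_Schwarz[OF s(1) H1_square_integrable(1)[OF v]] by simp
  also have "\<dots> \<le> (B * l2norm vol u) * l2norm vol v" by (intro mult_right_mono s l2norm_nonneg)
  also have "\<dots> \<le> (B * H1norm u) * H1norm v"
    by (intro mult_mono mult_left_mono l2norm_le_H1_norm u v B H1_norm_nonneg l2norm_nonneg mult_nonneg_nonneg)
  finally show "\<bar>LINT x|vol. q x * u x * v x\<bar> \<le> B * H1norm u * H1norm v" .
qed

lemma nonneg_potential_dn_defined:
  assumes dim: "2 \<le> DIM('a)"
    and q: "q \<in> borel_measurable vol" "\<forall>x\<in>\<Omega>. \<bar>q x\<bar> \<le> B" and B: "0 \<le> B"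
    and nonneg: "\<And>x. x \<in> \<Omega> \<Longrightarrow> 0 \<le> q x"
  shows "schroedinger_dn_defined \<Omega> q"
proof -
  note bp = bounded_potential[OF q B]
  have ad: "admissible_form (schroedinger_form \<Omega> q)" by (rule schroedinger_form_admissible[OF bp])
  obtain C where C: "0 \<le> C" "\<And>v. v \<in> H1_0 \<Omega> \<Longrightarrow> (l2norm vol v)\<^sup>2 \<le> C * (l2norm vol (wgrad v))\<^sup>2"
    using poincare_H1_0[OF dim] by blast
  \<comment> \<open>The Poincare inequality bounds the full Sobolev norm squared by
    \<open>C + 1\<close> times the gradient part; a nonnegative potential can only increase the
    form.\<close>
  have "1 / (C + 1) * (H1norm v)\<^sup>2 \<le> schroedinger_form \<Omega> q v v" if v: "v \<in> H1_0 \<Omega>" for v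
  proof -
    have vH: "v \<in> H1 \<Omega>" by (rule H1_0_H1[OF v])
    have "(H1norm v)\<^sup>2 \<le> (C + 1) * (l2norm vol (wgrad v))\<^sup>2"
      using C(2)[OF v] unfolding H1_norm_square[OF vH] by (simp add: algebra_simps)
    then have "1 / (C + 1) * (H1norm v)\<^sup>2 \<le> (l2norm vol (wgrad v))\<^sup>2"
      using C(1) by (simp add: field_simps)
    also have "\<dots> = conductivity_form \<Omega> (\<lambda>_. 1) v v" by (simp add: l2norm_square conductivity_form_def)
    also have "\<dots> \<le> schroedinger_form \<Omega> q v v"
      unfolding schroedinger_form_eq[OF bp(1)[OF vH vH] vH vH]
      using nonneg by (auto intro!: integral_nonneg_AE AE_I2 simp: mult.assoc)
    finally show ?thesis .
  qed
  then have "uniquely_solvable \<Omega> (schroedinger_form \<Omega> q)"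
    using C(1) by (intro coercive_uniquely_solvable[OF ad, of "1 / (C + 1)"]) auto
  then show ?thesis unfolding schroedinger_dn_defined_def using q(1) bp by blast
qed

section \<open>Smooth potentials and their Frechet topology\<close>

lemma smooth_closure_bounded:
  assumes "q \<in> smooth_closure \<Omega>"
  obtains B where "0 \<le> B" "\<forall>x\<in>\<Omega>. \<bar>q x\<bar> \<le> B"
proof -
  have "continuous_on (closure \<Omega>) q" using assms unfolding smooth_closure_def by blast
  then have "compact (q ` closure \<Omega>)"
    using bounded_\<Omega> by (intro compact_continuous_image) (auto simp: compact_closure)
  then have "bounded (q ` closure \<Omega>)" by (rule compact_imp_bounded)
  then obtain B where B: "0 < B" "\<forall>y\<in>q ` closure \<Omega>. norm y \<le> B" unfolding bounded_pos by (elim exE conjE)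
  show thesis
  proof (rule that[of B])
    show "\<forall>x\<in>\<Omega>. \<bar>q x\<bar> \<le> B" using B(2) closure_subset[of \<Omega>] by (auto simp: subset_iff)
  qed (use B in simp)
qed

lemma smooth_closure_measurable:
  assumes "q \<in> smooth_closure \<Omega>" shows "q \<in> borel_measurable vol"
proof -
  have "continuous_on (closure \<Omega>) q" using assms unfolding smooth_closure_def by simp
  then have "continuous_on \<Omega> q" using closure_subset by (rule continuous_on_subset)
  then show ?thesis by (rule continuous_imp_measurable_on_sets_lebesgue) simp
qed

text \<open>Each \<open>h\<close> lies in the ball of radius 1 around itself. This requires
  \<open>\<Omega>\<close> to be nonempty, since the supremum of the empty set of reals has no
  prescribed value.\<close>

lemma topspace_smooth_closure:
  assumes "\<Omega> \<noteq> {}" shows "topspace (smooth_closure_topology \<Omega>) = smooth_closure \<Omega>"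
proof
  show "topspace (smooth_closure_topology \<Omega>) \<subseteq> smooth_closure \<Omega>"
    unfolding smooth_closure_topology_def topology_generated_by_topspace by (rule Union_least) auto
  show "smooth_closure \<Omega> \<subseteq> topspace (smooth_closure_topology \<Omega>)"
  proof
    fix h assume h: "h \<in> smooth_closure \<Omega>"
    define B where "B = {g \<in> smooth_closure \<Omega>. (SUP x\<in>\<Omega>. \<bar>iter_deriv [] g x - iter_deriv [] h x\<bar>) < 1}"
    have "h \<in> B" using h assms unfolding B_def by simp
    moreover have "B \<in> {{g \<in> smooth_closure \<Omega>. (SUP x\<in>\<Omega>. \<bar>iter_deriv bs g x - iter_deriv bs h x\<bar>) < \<epsilon>} | h bs \<epsilon>.
        h \<in> smooth_closure \<Omega> \<and> bs \<in> lists Basis \<and> 0 < \<epsilon>}"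
      unfolding B_def using h by (intro CollectI exI[of _ h] exI[of _ "[]"] exI[of _ 1]) simp
    ultimately show "h \<in> topspace (smooth_closure_topology \<Omega>)"
      unfolding smooth_closure_topology_def topology_generated_by_topspace by (rule UnionI[rotated])
  qed
qed

lemma space_nonneg_smooth_potentials:
  assumes "\<Omega> \<noteq> {}"
  shows "space (nonneg_smooth_potentials \<Omega>) = {q \<in> smooth_closure \<Omega>. \<forall>x\<in>closure \<Omega>. 0 \<le> q x}"
  unfolding nonneg_smooth_potentials_def space_borel_of
  using topspace_smooth_closure[OF assms] by auto

lemma nonneg_smooth_dn_defined:
  assumes dim: "2 \<le> DIM('a)" and ne: "\<Omega> \<noteq> {}" and q: "q \<in> space (nonneg_smooth_potentials \<Omega>)"
  shows "schroedinger_dn_defined \<Omega> q"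
proof -
  have s: "q \<in> smooth_closure \<Omega>" and pos: "\<And>x. x \<in> \<Omega> \<Longrightarrow> 0 \<le> q x"
    using q closure_subset unfolding space_nonneg_smooth_potentials[OF ne] by auto
  obtain B where B: "0 \<le> B" "\<forall>x\<in>\<Omega>. \<bar>q x\<bar> \<le> B" using smooth_closure_bounded[OF s] by blast
  show ?thesis by (rule nonneg_potential_dn_defined[OF dim smooth_closure_measurable[OF s] B(2,1) pos])
qed

text \<open>For fixed \<open>u\<close> the form is affine in the potential and monotone, so only the
  seminorm without derivatives matters: raising the potential by at most \<open>\<epsilon>\<close>
  raises the form by at most \<open>\<epsilon>\<close> times the integral of the square of
  \<open>u\<close>.\<close>

lemma sublevel_openin:
  assumes ne: "\<Omega> \<noteq> {}" and u: "u \<in> H1 \<Omega>"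
  shows "openin (subtopology (smooth_closure_topology \<Omega>) {q. \<forall>x\<in>closure \<Omega>. 0 \<le> q x})
     {q \<in> space (nonneg_smooth_potentials \<Omega>). schroedinger_form \<Omega> q u u < c}"
proof (subst openin_subopen, intro ballI)
  define I where "I = (LINT x|vol. u x * u x)"
  have I0: "0 \<le> I" unfolding I_def by (intro integral_nonneg_AE) simp
  have ui: "integrable vol (\<lambda>x. u x * u x)"
    by (intro square_integrable_mult H1_square_integrable u)
  fix p assume "p \<in> {q \<in> space (nonneg_smooth_potentials \<Omega>). schroedinger_form \<Omega> q u u < c}"
  then have ps: "p \<in> smooth_closure \<Omega>" and pc: "schroedinger_form \<Omega> p u u < c"
    and ppos: "\<forall>x\<in>closure \<Omega>. 0 \<le> p x"
    unfolding space_nonneg_smooth_potentials[OF ne] by auto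
  \<comment> \<open>The distance of the form from \<open>c\<close>, divided so that the possible
    increase \<open>\<epsilon> * I\<close> stays strictly below that distance; \<open>I + 1\<close>
    also covers \<open>I = 0\<close>.\<close>
  define \<epsilon> where "\<epsilon> = (c - schroedinger_form \<Omega> p u u) / (I + 1)"
  have \<epsilon>: "0 < \<epsilon>" unfolding \<epsilon>_def using pc I0 by simp
  define B where "B = {g \<in> smooth_closure \<Omega>. (SUP x\<in>\<Omega>. \<bar>iter_deriv [] g x - iter_deriv [] p x\<bar>) < \<epsilon>}"
  have "openin (smooth_closure_topology \<Omega>) B"
    unfolding smooth_closure_topology_def
  proof (rule topology_generated_by_Basis)
    show "B \<in> {{g \<in> smooth_closure \<Omega>. (SUP x\<in>\<Omega>. \<bar>iter_deriv bs g x - iter_deriv bs h x\<bar>) < \<epsilon>} | h bs \<epsilon>.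
        h \<in> smooth_closure \<Omega> \<and> bs \<in> lists Basis \<and> 0 < \<epsilon>}"
      unfolding B_def using ps \<epsilon> by (intro CollectI exI[of _ p] exI[of _ "[]"] exI[of _ \<epsilon>]) simp
  qed
  then have op: "openin (subtopology (smooth_closure_topology \<Omega>) {q. \<forall>x\<in>closure \<Omega>. 0 \<le> q x})
    (B \<inter> {q. \<forall>x\<in>closure \<Omega>. 0 \<le> q x})"
    by (rule openin_subtopology_Int)
  have pB: "p \<in> B" unfolding B_def using ps \<epsilon> ne by simp
  have "schroedinger_form \<Omega> g u u < c" if g: "g \<in> B" for g
  proof -
    have gs: "g \<in> smooth_closure \<Omega>" and sup: "(SUP x\<in>\<Omega>. \<bar>g x - p x\<bar>) < \<epsilon>" using g unfolding B_def by auto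
    obtain Bg where Bg: "0 \<le> Bg" "\<forall>x\<in>\<Omega>. \<bar>g x\<bar> \<le> Bg" using smooth_closure_bounded[OF gs] by blast
    obtain Bp where Bp: "0 \<le> Bp" "\<forall>x\<in>\<Omega>. \<bar>p x\<bar> \<le> Bp" using smooth_closure_bounded[OF ps] by blast
    have bdd: "bdd_above ((\<lambda>x. \<bar>g x - p x\<bar>) ` \<Omega>)"
    proof (rule bdd_aboveI2)
      fix x assume "x \<in> \<Omega>"
      then have "\<bar>g x\<bar> \<le> Bg" "\<bar>p x\<bar> \<le> Bp" using Bg(2) Bp(2) by blast+
      then show "\<bar>g x - p x\<bar> \<le> Bg + Bp" by linarith
    qed
    have le: "g x \<le> p x + \<epsilon>" if "x \<in> \<Omega>" for x
    proof -
      have "\<bar>g x - p x\<bar> \<le> (SUP x\<in>\<Omega>. \<bar>g x - p x\<bar>)" by (rule cSUP_upper[OF that bdd])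
      then show ?thesis using sup by linarith
    qed
    note ig = bounded_potential(1)[OF smooth_closure_measurable[OF gs] Bg(2,1) u u]
      and ip = bounded_potential(1)[OF smooth_closure_measurable[OF ps] Bp(2,1) u u]
    have "(LINT x|vol. g x * u x * u x) \<le> (LINT x|vol. p x * u x * u x + \<epsilon> * (u x * u x))"
    proof (rule integral_mono)
      show "integrable vol (\<lambda>x. p x * u x * u x + \<epsilon> * (u x * u x))" using ip ui by simp
      fix x assume "x \<in> space vol"
      then have "g x * (u x * u x) \<le> (p x + \<epsilon>) * (u x * u x)"
        using le by (intro mult_right_mono) auto
      then show "g x * u x * u x \<le> p x * u x * u x + \<epsilon> * (u x * u x)" by (simp add: algebra_simps)
    qed (rule ig)
    also have "\<dots> = (LINT x|vol. p x * u x * u x) + \<epsilon> * I" using ip ui unfolding I_def by simp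
    finally have "schroedinger_form \<Omega> g u u \<le> schroedinger_form \<Omega> p u u + \<epsilon> * I"
      unfolding schroedinger_form_eq[OF ig u u] schroedinger_form_eq[OF ip u u] by simp
    also have "\<dots> < schroedinger_form \<Omega> p u u + \<epsilon> * (I + 1)" using \<epsilon> by (simp add: algebra_simps)
    also have "\<dots> = c" unfolding \<epsilon>_def using I0 by simp
    finally show ?thesis .
  qed
  then have "B \<inter> {q. \<forall>x\<in>closure \<Omega>. 0 \<le> q x}
      \<subseteq> {q \<in> space (nonneg_smooth_potentials \<Omega>). schroedinger_form \<Omega> q u u < c}"
    unfolding space_nonneg_smooth_potentials[OF ne] B_def by auto
  then show "\<exists>T. openin (subtopology (smooth_closure_topology \<Omega>) {q. \<forall>x\<in>closure \<Omega>. 0 \<le> q x}) T \<and> p \<in> T \<and>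
      T \<subseteq> {q \<in> space (nonneg_smooth_potentials \<Omega>). schroedinger_form \<Omega> q u u < c}"
    using op pB ppos by blast
qed

section \<open>The Dirichlet principle and measurability of the matrix entries\<close>

lemma dn_map_dirichlet_principle:
  assumes a: "admissible_form a" "uniquely_solvable \<Omega> a" and f: "f \<in> Hhalf \<Omega>"
    and nonneg: "\<And>w. w \<in> H1_0 \<Omega> \<Longrightarrow> 0 \<le> a w w"
  shows "dn_map \<Omega> a f f < c \<longleftrightarrow> (\<exists>u. has_trace \<Omega> u f \<and> a u u < c)"
proof
  obtain u where u: "weak_solution \<Omega> a f u" using ex_weak_solution[OF a f] by blast
  have ut: "has_trace \<Omega> u f" using u unfolding weak_solution_def by blast
  note dn = dn_map_eq[OF a u ut]
  show "dn_map \<Omega> a f f < c \<Longrightarrow> \<exists>u. has_trace \<Omega> u f \<and> a u u < c" using dn ut by auto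
  assume "\<exists>u. has_trace \<Omega> u f \<and> a u u < c"
  then obtain v where v: "has_trace \<Omega> v f" "a v v < c" by blast
  define w where "w x = v x - u x" for x
  have w: "w \<in> H1_0 \<Omega>" unfolding w_def[abs_def] by (rule has_trace_same_diff[OF v(1) ut])
  \<comment> \<open>A competitor is expanded around the solution; the mixed term vanishes by the
    weak equation, and the rest is the nonnegative energy of the difference.\<close>
  have "a v v = a (\<lambda>x. u x + 1 * w x) (\<lambda>x. u x + 1 * w x)" by (simp add: w_def)
  also have "\<dots> = a u u + 2 * a u w + a w w"
    using admissible_form_square[OF a(1) has_trace_H1[OF ut] H1_0_H1[OF w], of 1] by simp
  also have "a u w = 0" using u w unfolding weak_solution_def by blast
  finally show "dn_map \<Omega> a f f < c" using nonneg[OF w] v(2) dn by simp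
qed

text \<open>By linearity \<open>u + c v\<close> solves the problem with data \<open>f + c g\<close>,
  so the diagonal value is a quadratic polynomial in \<open>c\<close>; comparing
  \<open>c = 1\<close> and \<open>c = -1\<close> isolates the mixed coefficient.\<close>

lemma dn_map_polarization:
  assumes a: "admissible_form a" "uniquely_solvable \<Omega> a" and f: "f \<in> Hhalf \<Omega>" and g: "g \<in> Hhalf \<Omega>"
  shows "dn_map \<Omega> a f g = (dn_map \<Omega> a (\<lambda>x. f x + g x) (\<lambda>x. f x + g x)
     - dn_map \<Omega> a (\<lambda>x. f x - g x) (\<lambda>x. f x - g x)) / 4"
proof -
  obtain u v where u: "weak_solution \<Omega> a f u" and v: "weak_solution \<Omega> a g v"
    using ex_weak_solution[OF a] f g by blast
  have t: "has_trace \<Omega> u f" "has_trace \<Omega> v g" using u v unfolding weak_solution_def by auto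
  note H = has_trace_H1[OF t(1)] has_trace_H1[OF t(2)]
  have ws: "weak_solution \<Omega> a (\<lambda>x. f x + c * g x) (\<lambda>x. u x + c * v x)" for c
    unfolding weak_solution_def
  proof (intro conjI ballI has_trace_add_scaled t)
    fix w assume w: "w \<in> H1_0 \<Omega>"
    show "a (\<lambda>x. u x + c * v x) w = 0"
      using admissible_form_add_scaled_left[OF a(1) H1_0_H1[OF w] H, of c] u v w unfolding weak_solution_def by simp
  qed
  have eq: "dn_map \<Omega> a (\<lambda>x. f x + c * g x) (\<lambda>x. f x + c * g x) = a u u + 2 * c * a u v + c\<^sup>2 * a v v" for c
    using dn_map_eq[OF a ws has_trace_add_scaled[OF t], of c c] admissible_form_square[OF a(1) H, of c] by simp
  show ?thesis
    using eq[of 1] eq[of "-1"] dn_map_eq[OF a u t(2)] by simp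
qed

lemma dn_map_diagonal_measurable:
  assumes dim: "2 \<le> DIM('a)" and ne: "\<Omega> \<noteq> {}" and f: "f \<in> Hhalf \<Omega>"
  shows "(\<lambda>q. dn_map \<Omega> (schroedinger_form \<Omega> q) f f) \<in> borel_measurable (nonneg_smooth_potentials \<Omega>)"
proof (rule borel_measurableI_less)
  fix c
  define X where "X = subtopology (smooth_closure_topology \<Omega>) {q. \<forall>x\<in>closure \<Omega>. 0 \<le> q x}"
  define N where "N = nonneg_smooth_potentials \<Omega>"
  have iff: "dn_map \<Omega> (schroedinger_form \<Omega> q) f f < c \<longleftrightarrow> (\<exists>u. has_trace \<Omega> u f \<and> schroedinger_form \<Omega> q u u < c)"
    if q: "q \<in> space N" for q
  proof -
    have d: "schroedinger_dn_defined \<Omega> q"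
      using nonneg_smooth_dn_defined[OF dim ne] q unfolding N_def by blast
    then have us: "uniquely_solvable \<Omega> (schroedinger_form \<Omega> q)" unfolding schroedinger_dn_defined_def by simp
    have pos: "0 \<le> q x" if "x \<in> \<Omega>" for x
      using q that closure_subset unfolding N_def space_nonneg_smooth_potentials[OF ne] by auto
    have "0 \<le> schroedinger_form \<Omega> q w w" for w
      unfolding schroedinger_form_def using pos by (intro integral_nonneg_AE AE_I2) (auto simp: mult.assoc)
    then show ?thesis
      by (intro dn_map_dirichlet_principle[OF schroedinger_dn_defined_admissible[OF d] us f])
  qed
  \<comment> \<open>The union is uncountable; it is measurable because each of its members is
    open.\<close>
  have "{q \<in> space N. dn_map \<Omega> (schroedinger_form \<Omega> q) f f < c}
    = (\<Union>u\<in>{u. has_trace \<Omega> u f}. {q \<in> space N. schroedinger_form \<Omega> q u u < c})"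
    using iff by blast
  moreover have "openin X (\<Union>u\<in>{u. has_trace \<Omega> u f}. {q \<in> space N. schroedinger_form \<Omega> q u u < c})"
    unfolding X_def N_def using sublevel_openin[OF ne has_trace_H1] by (intro openin_clauses(3)) blast
  ultimately show "{q \<in> space (nonneg_smooth_potentials \<Omega>). dn_map \<Omega> (schroedinger_form \<Omega> q) f f < c}
      \<in> sets (nonneg_smooth_potentials \<Omega>)"
    using openin_imp_borel_of[of X] unfolding N_def[symmetric] by (simp add: N_def nonneg_smooth_potentials_def X_def)
qed

lemma dn_matrix_nonneg_smooth_measurable:
  assumes dim: "2 \<le> DIM('a)" and ne: "\<Omega> \<noteq> {}" and f: "dense_seq_Hhalf \<Omega> f"
  shows "(\<lambda>p. dn_matrix f (schroedinger_dn \<Omega> (ae_class \<Omega> p))) \<in> measurable (nonneg_smooth_potentials \<Omega>) matrix_space"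
proof (rule measurable_PiM_single')
  have fH: "f i \<in> Hhalf \<Omega>" for i using f unfolding dense_seq_Hhalf_def by blast
  have fpm: "(\<lambda>x. f i x + f j x) \<in> Hhalf \<Omega>" "(\<lambda>x. f i x - f j x) \<in> Hhalf \<Omega>" for i j
    using fH[of i] fH[of j] has_trace_add has_trace_diff unfolding Hhalf_def by blast+
  fix ij :: "nat \<times> nat"
  obtain i j where ij: "ij = (i, j)" by (cases ij)
  have "(\<lambda>p. (dn_map \<Omega> (schroedinger_form \<Omega> p) (\<lambda>x. f i x + f j x) (\<lambda>x. f i x + f j x)
       - dn_map \<Omega> (schroedinger_form \<Omega> p) (\<lambda>x. f i x - f j x) (\<lambda>x. f i x - f j x)) / 4)
    \<in> borel_measurable (nonneg_smooth_potentials \<Omega>)"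
    using dn_map_diagonal_measurable[OF dim ne fpm(1)] dn_map_diagonal_measurable[OF dim ne fpm(2)] by simp
  moreover have "dn_matrix f (schroedinger_dn \<Omega> (ae_class \<Omega> p)) ij
     = (dn_map \<Omega> (schroedinger_form \<Omega> p) (\<lambda>x. f i x + f j x) (\<lambda>x. f i x + f j x)
       - dn_map \<Omega> (schroedinger_form \<Omega> p) (\<lambda>x. f i x - f j x) (\<lambda>x. f i x - f j x)) / 4"
    if "p \<in> space (nonneg_smooth_potentials \<Omega>)" for p
  proof -
    have d: "schroedinger_dn_defined \<Omega> p" by (rule nonneg_smooth_dn_defined[OF dim ne that])
    then have us: "uniquely_solvable \<Omega> (schroedinger_form \<Omega> p)" and pm: "p \<in> borel_measurable vol"
      unfolding schroedinger_dn_defined_def by simp_all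
    show ?thesis
      unfolding ij dn_matrix_def schroedinger_dn_ae_class[OF pm]
      using dn_map_polarization[OF schroedinger_dn_defined_admissible[OF d] us fH fH] by simp
  qed
  ultimately show "(\<lambda>p. dn_matrix f (schroedinger_dn \<Omega> (ae_class \<Omega> p)) ij)
      \<in> borel_measurable (nonneg_smooth_potentials \<Omega>)"
    by (subst measurable_cong) auto
qed simp

end

section \<open>From equal laws of the matrices to equal laws of the coefficients\<close>

lemma law_determined_by_dn_matrix:
  fixes L :: "'q \<Rightarrow> 'a form"
  assumes M: "standard_borel M"
    and T: "(\<lambda>p. dn_matrix f (L p)) \<in> measurable M matrix_space"
    and inj: "\<And>p p'. p \<in> space M \<Longrightarrow> p' \<in> space M \<Longrightarrow> dn_matrix f (L p) = dn_matrix f (L p') \<Longrightarrow> p = p'"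
    and P: "prob_space P" "prob_space P'"
    and q: "q \<in> measurable P M" "q' \<in> measurable P' M"
    and eq: "distr P matrix_space (\<lambda>\<omega>. dn_matrix f (L (q \<omega>))) = distr P' matrix_space (\<lambda>\<omega>. dn_matrix f (L (q' \<omega>)))"
  shows "distr P M q = distr P' M q'"
proof (rule distr_eq_of_distr_inj_eq[OF M _ _ P q])
  \<comment> \<open>The index set is countable, so the product sigma-algebra is the Borel
    sigma-algebra of the product topology, the one to which the compactness argument refers.\<close>
  have sets: "sets (matrix_space) = sets (borel :: (nat \<times> nat \<Rightarrow> real) measure)" by (rule sets_PiM_equal_borel)
  show "(\<lambda>p. dn_matrix f (L p)) \<in> borel_measurable M"
    using T measurable_cong_sets[OF refl sets] by blast
  show "inj_on (\<lambda>p. dn_matrix f (L p)) (space M)" using inj by (rule inj_onI)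
  have "distr P borel (\<lambda>\<omega>. dn_matrix f (L (q \<omega>))) = distr P matrix_space (\<lambda>\<omega>. dn_matrix f (L (q \<omega>)))"
    "distr P' borel (\<lambda>\<omega>. dn_matrix f (L (q' \<omega>))) = distr P' matrix_space (\<lambda>\<omega>. dn_matrix f (L (q' \<omega>)))"
    by (rule distr_cong[OF refl sets[symmetric]], simp)+
  then show "distr P borel (\<lambda>\<omega>. dn_matrix f (L (q \<omega>))) = distr P' borel (\<lambda>\<omega>. dn_matrix f (L (q' \<omega>)))"
    using eq by simp
qed

theorem corollary4p3:
  fixes \<Omega> :: "(real ^ 'n) set"
    and f :: "nat \<Rightarrow> real ^ 'n \<Rightarrow> real"
  assumes "CARD('n) \<ge> 2"
    and "smooth_bounded_domain \<Omega>"
    and "dense_seq_Hhalf \<Omega> f"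
  shows
    "(\<forall>(Q :: (real ^ 'n \<Rightarrow> real) set measure)
        (P :: 'w1 measure) (P' :: 'w2 measure) q q'.
        standard_borel Q \<longrightarrow>
        space Q \<subseteq> schroedinger_potentials \<Omega> \<longrightarrow>
        (\<lambda>p. dn_matrix f (schroedinger_dn \<Omega> p)) \<in> measurable Q matrix_space \<longrightarrow>
        (\<forall>q1\<in>space Q. \<forall>q2\<in>space Q.
           schroedinger_dn \<Omega> q1 = schroedinger_dn \<Omega> q2 \<longrightarrow> q1 = q2) \<longrightarrow>
        prob_space P \<longrightarrow> prob_space P' \<longrightarrow>
        q \<in> measurable P Q \<longrightarrow> q' \<in> measurable P' Q \<longrightarrow>
        distr P matrix_space (\<lambda>\<omega>. dn_matrix f (schroedinger_dn \<Omega> (q \<omega>))) =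
        distr P' matrix_space (\<lambda>\<omega>. dn_matrix f (schroedinger_dn \<Omega> (q' \<omega>))) \<longrightarrow>
        distr P Q q = distr P' Q q')
     \<and>
     ((\<forall>p\<in>space (nonneg_smooth_potentials \<Omega>). schroedinger_dn_defined \<Omega> p) \<and>
      (\<lambda>p. dn_matrix f (schroedinger_dn \<Omega> (ae_class \<Omega> p)))
         \<in> measurable (nonneg_smooth_potentials \<Omega>) matrix_space)
     \<and>
     (\<forall>(G :: (real ^ 'n \<Rightarrow> real) set measure)
        (P :: 'w3 measure) (P' :: 'w4 measure) \<gamma> \<gamma>'.
        standard_borel G \<longrightarrow>
        space G \<subseteq> conductivities \<Omega> \<longrightarrow>
        (\<lambda>p. dn_matrix f (conductivity_dn \<Omega> p)) \<in> measurable G matrix_space \<longrightarrow>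
        inj_on (conductivity_dn \<Omega>) (space G) \<longrightarrow>
        prob_space P \<longrightarrow> prob_space P' \<longrightarrow>
        \<gamma> \<in> measurable P G \<longrightarrow> \<gamma>' \<in> measurable P' G \<longrightarrow>
        distr P matrix_space (\<lambda>\<omega>. dn_matrix f (conductivity_dn \<Omega> (\<gamma> \<omega>))) =
        distr P' matrix_space (\<lambda>\<omega>. dn_matrix f (conductivity_dn \<Omega> (\<gamma>' \<omega>))) \<longrightarrow>
        distr P G \<gamma> = distr P' G \<gamma>')"
proof -
  interpret bounded_open_set \<Omega>
    by unfold_locales (use assms(2) in \<open>auto simp: smooth_bounded_domain_def\<close>)
  have ne: "\<Omega> \<noteq> {}" using assms(2) unfolding smooth_bounded_domain_def by blast
  have dim: "2 \<le> DIM(real ^ 'n)" using assms(1) by simp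
  show ?thesis
  proof (intro conjI allI impI ballI)
    fix Q :: "(real ^ 'n \<Rightarrow> real) set measure" and P :: "'w1 measure" and P' :: "'w2 measure" and q q'
    assume Q: "standard_borel Q" "space Q \<subseteq> schroedinger_potentials \<Omega>"
      "(\<lambda>p. dn_matrix f (schroedinger_dn \<Omega> p)) \<in> measurable Q matrix_space"
      and uniq: "\<forall>q1\<in>space Q. \<forall>q2\<in>space Q. schroedinger_dn \<Omega> q1 = schroedinger_dn \<Omega> q2 \<longrightarrow> q1 = q2"
      and P: "prob_space P" "prob_space P'" "q \<in> measurable P Q" "q' \<in> measurable P' Q"
        "distr P matrix_space (\<lambda>\<omega>. dn_matrix f (schroedinger_dn \<Omega> (q \<omega>))) =
         distr P' matrix_space (\<lambda>\<omega>. dn_matrix f (schroedinger_dn \<Omega> (q' \<omega>)))"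
    show "distr P Q q = distr P' Q q'"
    proof (rule law_determined_by_dn_matrix[OF Q(1,3) _ P])
      fix p p' assume p: "p \<in> space Q" "p' \<in> space Q"
        and eq: "dn_matrix f (schroedinger_dn \<Omega> p) = dn_matrix f (schroedinger_dn \<Omega> p')"
      have "schroedinger_dn \<Omega> p = schroedinger_dn \<Omega> p'"
        using schroedinger_dn_determined[OF assms(3) _ _ eq] p Q(2) by blast
      then show "p = p'" using uniq p by blast
    qed
  next
    fix G :: "(real ^ 'n \<Rightarrow> real) set measure" and P :: "'w3 measure" and P' :: "'w4 measure" and \<gamma> \<gamma>'
    assume G: "standard_borel G" "space G \<subseteq> conductivities \<Omega>"
      "(\<lambda>p. dn_matrix f (conductivity_dn \<Omega> p)) \<in> measurable G matrix_space"
      and uniq: "inj_on (conductivity_dn \<Omega>) (space G)"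
      and P: "prob_space P" "prob_space P'" "\<gamma> \<in> measurable P G" "\<gamma>' \<in> measurable P' G"
        "distr P matrix_space (\<lambda>\<omega>. dn_matrix f (conductivity_dn \<Omega> (\<gamma> \<omega>))) =
         distr P' matrix_space (\<lambda>\<omega>. dn_matrix f (conductivity_dn \<Omega> (\<gamma>' \<omega>)))"
    show "distr P G \<gamma> = distr P' G \<gamma>'"
    proof (rule law_determined_by_dn_matrix[OF G(1,3) _ P])
      fix p p' assume p: "p \<in> space G" "p' \<in> space G"
        and eq: "dn_matrix f (conductivity_dn \<Omega> p) = dn_matrix f (conductivity_dn \<Omega> p')"
      have "conductivity_dn \<Omega> p = conductivity_dn \<Omega> p'"
        using conductivity_dn_determined[OF assms(3) _ _ eq] p G(2) by blast
      then show "p = p'" using uniq p by (auto dest: inj_onD)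
    qed
  next
    show "schroedinger_dn_defined \<Omega> p" if "p \<in> space (nonneg_smooth_potentials \<Omega>)" for p
      by (rule nonneg_smooth_dn_defined[OF dim ne that])
    show "(\<lambda>p. dn_matrix f (schroedinger_dn \<Omega> (ae_class \<Omega> p)))
       \<in> measurable (nonneg_smooth_potentials \<Omega>) matrix_space"
      by (rule dn_matrix_nonneg_smooth_measurable[OF dim ne assms(3)])
  qed
qed

end
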